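(* Assume the standing setup and the one-dimensional splitting hypotheses in the context. Then there exist $\bar\beta>0$ and, for each $\beta\in(0,\bar\beta)$, $\bar\varepsilon(\beta)>0$ such that for $0<\beta<\bar\beta$ and $|\varepsilon|<\bar\varepsilon(\beta)$ there exist vector fields $\mathbf v_{1,\varepsilon},\dots,\mathbf v_{d,\varepsilon}$ on $\mathbb T^d$, linearly independent at every $\psi\in\mathbb T^d$, and scalar functions $L_{1,\varepsilon},\dots,L_{d,\varepsilon}$ on $\mathbb T^d$, all analytic in $\varepsilon$ and $\beta$-Hölder continuous in $\psi$, such that $$DA_\varepsilon(H_\varepsilon(\psi))\,\mathbf v_{i,\varepsilon}(\psi)=L_{i,\varepsilon}(\psi)\,\mathbf v_{i,\varepsilon}(A_0\psi)\qquad(\psi\in\mathbb T^d,\ i=1,\dots,d),$$ with $\mathbf v_{i,0}=\mathbf v_i$ and $L_{i,0}=\Lambda_i$.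
   Context: Standing setup. $\mathbb T^d=\mathbb R^d/2\pi\mathbb Z^d$ with the metric $\delta$ inherited from the Euclidean metric; tangent spaces are identified with $\mathbb R^d$. For $f$ on $\mathbb T^d$ and $0<\beta<1$, $|f|_\beta:=\sup_{\psi\neq\psi'}\|f(\psi)-f(\psi')\|/\delta(\psi,\psi')^\beta$, $\|f\|_\infty:=\sup_\psi\|f(\psi)\|$, $\|f\|_\beta:=\|f\|_\infty+|f|_\beta$. $A_0:\mathbb T^d\to\mathbb T^d$ is an analytic Anosov diffeomorphism; $\widetilde A_0$ is its lift to a map $\mathbb T^d\to\mathbb R^d$, $F:\mathbb T^d\to\mathbb R^d$ is analytic, and $A_\varepsilon(\psi):=\widetilde A_0(\psi)+\varepsilon F(\psi)\bmod 2\pi$. It is taken as known that for $|\varepsilon|$ small there is a homeomorphism $H_\varepsilon$ of $\mathbb T^d$ with $H_\varepsilon\circ A_0=A_\varepsilon\circ H_\varepsilon$, $H_\varepsilon(\psi)=\psi+\sum_{n\ge1}\varepsilon^nh^{(n)}(\psi)$, where for every sufficiently small $\beta>0$ there is $C_\beta$ with $\|h^{(n)}\|_\beta\le C_\beta^n$. One-dimensional splitting hypotheses. There are unit vector fields $\mathbf v_1(\psi),\dots,\mathbf v_d(\psi)$ forming a basis of $\mathrm T_\psi\mathbb T^d$ for every $\psi$, $\beta_0$-Hölder in $\psi$ for some $\beta_0>0$, and nonvanishing $\beta_0$-Hölder functions $\Lambda_i$ with $DA_0(\psi)\mathbf v_i(\psi)=\Lambda_i(\psi)\mathbf v_i(A_0\psi)$.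 With $\Lambda_i^{[n]}(\psi):=\prod_{j=0}^{n-1}\Lambda_i(A_0^j\psi)$, there is $N_0$ such that for all $n\ge N_0$ and $i=1,\dots,d-1$: $\|\Lambda_i^{[n]}\|_\infty\,\|(\Lambda_{i+1}^{[n]})^{-1}\|_\infty<1$. *)

theory Defs
  imports "HOL-Analysis.Analysis" "HOL-Library.Extended_Real"
begin

text \<open>The torus T^d = R^d / 2 pi Z^d is modelled by R^d (type real^'d) together with
  the equivalence relation tor_eq; functions on T^d are 2pi-periodic functions on R^d,
  maps T^d -> T^d are represented by lifts R^d -> R^d respecting tor_eq.\<close>

definition tor_eq :: "real^'d \<Rightarrow> real^'d \<Rightarrow> bool" where
  "tor_eq x y \<longleftrightarrow> (\<forall>i. \<exists>k::int. x$i - y$i = 2 * pi * of_int k)"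

definition int_vecs :: "(real^'d) set" where
  "int_vecs = {k. \<forall>i. k$i \<in> \<int>}"

definition tdist :: "real^'d \<Rightarrow> real^'d \<Rightarrow> real" where
  "tdist x y = Inf ((\<lambda>k. norm (x - y + (2 * pi) *\<^sub>R k)) ` int_vecs)"

definition on_torus :: "(real^'d \<Rightarrow> 'b) \<Rightarrow> bool" where
  "on_torus f \<longleftrightarrow> (\<forall>x y. tor_eq x y \<longrightarrow> f x = f y)"

definition torus_map :: "(real^'d \<Rightarrow> real^'d) \<Rightarrow> bool" where
  "torus_map g \<longleftrightarrow> (\<forall>x y. tor_eq x y \<longrightarrow> tor_eq (g x) (g y))"

definition torus_bij :: "(real^'d \<Rightarrow> real^'d) \<Rightarrow> bool" where
  "torus_bij g \<longleftrightarrow> torus_map g \<and> (\<forall>y. \<exists>x. tor_eq (g x) y)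
      \<and> (\<forall>x y. tor_eq (g x) (g y) \<longrightarrow> tor_eq x y)"

text \<open>Homeomorphism of T^d (continuous bijection of the compact Hausdorff space T^d,
  given through a continuous lift).\<close>
definition torus_homeo :: "(real^'d \<Rightarrow> real^'d) \<Rightarrow> bool" where
  "torus_homeo g \<longleftrightarrow> torus_bij g \<and> continuous_on UNIV g"

definition sup_norm :: "(real^'d \<Rightarrow> 'b::real_normed_vector) \<Rightarrow> ereal" where
  "sup_norm f = (SUP x. ereal (norm (f x)))"

definition holder_semi :: "real \<Rightarrow> (real^'d \<Rightarrow> 'b::real_normed_vector) \<Rightarrow> ereal" where
  "holder_semi \<beta> f = (SUP p \<in> {(x, y). \<not> tor_eq x y}.
      ereal (norm (f (fst p) - f (snd p)) / (tdist (fst p) (snd p)) powr \<beta>))"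

definition holder_norm :: "real \<Rightarrow> (real^'d \<Rightarrow> 'b::real_normed_vector) \<Rightarrow> ereal" where
  "holder_norm \<beta> f = sup_norm f + holder_semi \<beta> f"

definition real_analytic_at :: "(real^'d \<Rightarrow> 'b::real_normed_vector) \<Rightarrow> real^'d \<Rightarrow> bool" where
  "real_analytic_at f x0 \<longleftrightarrow> (\<exists>r>0. \<exists>c :: ('d \<Rightarrow> nat) \<Rightarrow> 'b. \<forall>x\<in>ball x0 r.
      ((\<lambda>\<alpha>. (\<Prod>i\<in>UNIV. (x$i - x0$i) ^ (\<alpha> i)) *\<^sub>R c \<alpha>) has_sum f x) UNIV)"

definition real_analytic :: "(real^'d \<Rightarrow> 'b::real_normed_vector) \<Rightarrow> bool" where
  "real_analytic f \<longleftrightarrow> (\<forall>x. real_analytic_at f x)"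

text \<open>Derivative of the n-th iterate (chain rule): D(f^n)(x).\<close>
primrec dpow :: "(real^'d \<Rightarrow> real^'d) \<Rightarrow> nat \<Rightarrow> real^'d \<Rightarrow> real^'d \<Rightarrow> real^'d" where
  "dpow f 0 x = id"
| "dpow f (Suc n) x = frechet_derivative f (at ((f ^^ n) x)) \<circ> dpow f n x"

definition anosov :: "(real^'d \<Rightarrow> real^'d) \<Rightarrow> bool" where
  "anosov f \<longleftrightarrow> torus_bij f \<and> (\<forall>x. f differentiable (at x))
    \<and> (\<forall>x. bij (frechet_derivative f (at x)))
    \<and> (\<exists>Es Eu :: real^'d \<Rightarrow> (real^'d) set. \<exists>C>0. \<exists>lam. 0 < lam \<and> lam < 1 \<and>
         on_torus Es \<and> on_torus Eu \<and>
         (\<forall>x. subspace (Es x) \<and> subspace (Eu x) \<and> Es x \<inter> Eu x = {0}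
              \<and> (\<forall>w. \<exists>a\<in>Es x. \<exists>b\<in>Eu x. w = a + b)
              \<and> frechet_derivative f (at x) ` Es x = Es (f x)
              \<and> frechet_derivative f (at x) ` Eu x = Eu (f x)
              \<and> (\<forall>n. \<forall>w\<in>Es x. norm (dpow f n x w) \<le> C * lam ^ n * norm w)
              \<and> (\<forall>n. \<forall>w\<in>Eu x. norm (dpow f n x w) \<ge> (1 / C) * (1 / lam) ^ n * norm w)))"

end

theory Submission
  imports Defs
begin

text \<open>The coefficients of all series in \<open>\<epsilon>\<close> are kept together as elements of the Banach algebra \<open>W\<close> of
  absolutely summable power series, so that the problem becomes one about Hoelder functions from the
  torus to \<open>W\<close>. Locally the derivative of an analytic map is a power series, into which the \<open>W\<close>-valued
  point \<open>H\<^sub>\<epsilon> \<psi>\<close> can be substituted; in the frame \<open>v\<^sub>i\<close> the perturbed derivative is thus the diagonal cocycle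
  \<open>\<Lambda>\<close> plus a \<open>W\<close>-valued matrix without constant term, which becomes small in the Hoelder norm when the radius of
  convergence is shrunk. After rescaling the frame by Hoelder factors the domination holds in one step,
  and, for small exponents, the coordinates of the \<open>i\<close>-th invariant field, normalised
  by having \<open>i\<close>-th coordinate \<open>1\<close>, are the fixed point of a contraction: those dominated by \<open>\<Lambda>\<^sub>i\<close> are
  transported forwards, the others are pulled back.\<close>

section \<open>Power series with absolutely summable coefficients\<close>

text \<open>The equation is posed over A_0, not over A_\<epsilon>: the conjugacy moves all
  dependence on \<epsilon> into the fibre maps and leaves the base maps fixed. The invariant fields
  are only Hoelder in the base point, so composing them with points that move with \<epsilon> would
  destroy analyticity; only the analytic derivative is evaluated at H_\<epsilon>. Solving once with
  coefficients in W then yields a convergent series, and no derivative in \<epsilon> is ever taken.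
  The bound on \<beta> comes from the Hoelder seminorm: the linear part of the transform contracts
  the sup norm by \<theta> < 1, but composition with A_0 or its inverse, both Lipschitz with
  constant l, can multiply the \<beta>-seminorm by l^\<beta>, so an invariant Hoelder ball needs
  \<theta> l^\<beta> < 1. At \<epsilon> = 0 the coordinates other than the i-th satisfy a
  homogeneous dominated equation, whose only bounded solution is 0. Independence of the fields
  follows from keeping these coordinates so small that the coordinate matrix is diagonally
  dominant.\<close>

typedef wiener = "{f :: real fps. summable (\<lambda>n. \<bar>fps_nth f n\<bar>)}"
  morphisms fps_of_wiener Abs_wiener
  by (rule exI[of _ 0]) simp

setup_lifting type_definition_wiener

text \<open>Absolute values inside the convolution are majorised by the Cauchy product of the two
  nonnegative series, whose sum is the product of the sums. Hence the l1 norm is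
  submultiplicative.\<close>

lemma summable_abs_fps_mult:
  fixes f g :: "real fps"
  assumes "summable (\<lambda>n. \<bar>fps_nth f n\<bar>)" "summable (\<lambda>n. \<bar>fps_nth g n\<bar>)"
  shows "summable (\<lambda>n. \<bar>fps_nth (f * g) n\<bar>)"
    and "(\<Sum>n. \<bar>fps_nth (f * g) n\<bar>) \<le> (\<Sum>n. \<bar>fps_nth f n\<bar>) * (\<Sum>n. \<bar>fps_nth g n\<bar>)"
proof -
  let ?c = "\<lambda>n. \<Sum>i\<le>n. \<bar>fps_nth f i\<bar> * \<bar>fps_nth g (n - i)\<bar>"
  have c: "summable ?c" "(\<Sum>n. \<bar>fps_nth f n\<bar>) * (\<Sum>n. \<bar>fps_nth g n\<bar>) = suminf ?c"
    using summable_Cauchy_product[of "\<lambda>n. \<bar>fps_nth f n\<bar>" "\<lambda>n. \<bar>fps_nth g n\<bar>"]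
      Cauchy_product[of "\<lambda>n. \<bar>fps_nth f n\<bar>" "\<lambda>n. \<bar>fps_nth g n\<bar>"] assms by auto
  have le: "\<bar>fps_nth (f * g) n\<bar> \<le> ?c n" for n
    unfolding fps_mult_nth atLeast0AtMost by (rule order_trans[OF sum_abs]) (simp add: abs_mult)
  show "summable (\<lambda>n. \<bar>fps_nth (f * g) n\<bar>)"
    by (rule summable_comparison_test'[OF c(1), of 0]) (use le in simp)
  then show "(\<Sum>n. \<bar>fps_nth (f * g) n\<bar>) \<le> (\<Sum>n. \<bar>fps_nth f n\<bar>) * (\<Sum>n. \<bar>fps_nth g n\<bar>)"
    unfolding c(2) using c(1) le by (intro suminf_le) auto
qed

lemma summable_abs_fps_add:
  fixes f g :: "real fps"
  assumes "summable (\<lambda>n. \<bar>fps_nth f n\<bar>)" "summable (\<lambda>n. \<bar>fps_nth g n\<bar>)"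
  shows "summable (\<lambda>n. \<bar>fps_nth (f + g) n\<bar>)"
  by (rule summable_comparison_test'[OF summable_add[OF assms], of 0]) (simp add: abs_triangle_ineq)

lemma summable_abs_fps_diff:
  fixes f g :: "real fps"
  assumes "summable (\<lambda>n. \<bar>fps_nth f n\<bar>)" "summable (\<lambda>n. \<bar>fps_nth g n\<bar>)"
  shows "summable (\<lambda>n. \<bar>fps_nth (f - g) n\<bar>)"
  by (rule summable_comparison_test'[OF summable_add[OF assms], of 0]) (simp add: abs_triangle_ineq4)

instantiation wiener :: comm_ring_1
begin
lift_definition zero_wiener :: wiener is 0 by simp
lift_definition one_wiener :: wiener is 1
  by (rule summable_finite[of "{0}"]) auto
lift_definition plus_wiener :: "wiener \<Rightarrow> wiener \<Rightarrow> wiener" is "(+)"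
  by (rule summable_abs_fps_add)
lift_definition minus_wiener :: "wiener \<Rightarrow> wiener \<Rightarrow> wiener" is "(-)"
  by (rule summable_abs_fps_diff)
lift_definition uminus_wiener :: "wiener \<Rightarrow> wiener" is uminus by simp
lift_definition times_wiener :: "wiener \<Rightarrow> wiener \<Rightarrow> wiener" is "(*)"
  by (rule summable_abs_fps_mult)
instance by (standard; transfer; simp add: algebra_simps)
end

instantiation wiener :: real_algebra_1
begin
lift_definition scaleR_wiener :: "real \<Rightarrow> wiener \<Rightarrow> wiener" is "\<lambda>c f. fps_const c * f"
  by (simp add: abs_mult summable_mult)
instance
  by (standard; transfer; simp add: fps_eq_iff distrib_left distrib_right mult.assoc mult.left_commute)
end

instantiation wiener :: real_normed_algebra_1
begin
lift_definition norm_wiener :: "wiener \<Rightarrow> real" is "\<lambda>f. \<Sum>n. \<bar>fps_nth f n\<bar>" .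
definition dist_wiener :: "wiener \<Rightarrow> wiener \<Rightarrow> real" where "dist_wiener a b = norm (a - b)"
definition sgn_wiener :: "wiener \<Rightarrow> wiener" where "sgn_wiener a = inverse (norm a) *\<^sub>R a"
definition uniformity_wiener :: "(wiener \<times> wiener) filter" where
  "uniformity_wiener = (INF e\<in>{0<..}. principal {(x, y). dist x y < e})"
definition open_wiener :: "wiener set \<Rightarrow> bool" where
  "open_wiener U \<longleftrightarrow> (\<forall>x\<in>U. eventually (\<lambda>(x', y). x' = x \<longrightarrow> y \<in> U) uniformity)"
instance
proof
  fix x y :: wiener and a :: real
  show "(norm x = 0) = (x = 0)"
  proof (transfer, safe)
    fix f :: "real fps" assume s: "summable (\<lambda>n. \<bar>fps_nth f n\<bar>)" and z: "(\<Sum>n. \<bar>fps_nth f n\<bar>) = 0"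
    show "f = 0" using suminf_eq_zero_iff[OF s] z by (simp add: fps_eq_iff)
  qed simp
  show "norm (x + y) \<le> norm x + norm y"
  proof transfer
    fix f g :: "real fps" assume s: "summable (\<lambda>n. \<bar>fps_nth f n\<bar>)" "summable (\<lambda>n. \<bar>fps_nth g n\<bar>)"
    have "(\<Sum>n. \<bar>fps_nth (f + g) n\<bar>) \<le> (\<Sum>n. \<bar>fps_nth f n\<bar> + \<bar>fps_nth g n\<bar>)"
      by (intro suminf_le summable_abs_fps_add s summable_add abs_triangle_ineq[THEN order_trans[rotated]]) (simp add: abs_triangle_ineq)
    then show "(\<Sum>n. \<bar>fps_nth (f + g) n\<bar>) \<le> (\<Sum>n. \<bar>fps_nth f n\<bar>) + (\<Sum>n. \<bar>fps_nth g n\<bar>)"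
      by (simp add: suminf_add[OF s])
  qed
  show "norm (a *\<^sub>R x) = \<bar>a\<bar> * norm x" by transfer (simp add: abs_mult suminf_mult)
  show "norm (x * y) \<le> norm x * norm y" by transfer (rule summable_abs_fps_mult)
  show "norm (1 :: wiener) = 1"
  proof transfer
    have "(\<Sum>n. \<bar>fps_nth (1 :: real fps) n\<bar>) = (\<Sum>n\<in>{0::nat}. \<bar>fps_nth (1 :: real fps) n\<bar>)"
      by (rule suminf_finite) auto
    then show "(\<Sum>n. \<bar>fps_nth (1 :: real fps) n\<bar>) = 1" by simp
  qed
qed (auto simp: dist_wiener_def sgn_wiener_def uniformity_wiener_def open_wiener_def divide_inverse)
end

definition wcoef :: "nat \<Rightarrow> wiener \<Rightarrow> real" where "wcoef n a = fps_nth (fps_of_wiener a) n"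

lemma wiener_eqI: "(\<And>n. wcoef n a = wcoef n b) \<Longrightarrow> a = b"
  by (simp add: wcoef_def fps_eq_iff fps_of_wiener_inject[symmetric])

lemma summable_abs_wcoef: "summable (\<lambda>n. \<bar>wcoef n a\<bar>)"
  using fps_of_wiener[of a] by (simp add: wcoef_def)

lemma norm_wiener_suminf: "norm a = (\<Sum>n. \<bar>wcoef n a\<bar>)"
  by (simp add: norm_wiener.rep_eq wcoef_def)

lemma wcoef_simps [simp]:
  "wcoef n (a + b) = wcoef n a + wcoef n b"
  "wcoef n (a - b) = wcoef n a - wcoef n b"
  "wcoef n (c *\<^sub>R a) = c * wcoef n a"
  by (simp_all add: wcoef_def plus_wiener.rep_eq minus_wiener.rep_eq scaleR_wiener.rep_eq)

lemma abs_wcoef_le: "\<bar>wcoef n a\<bar> \<le> norm a"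
  unfolding norm_wiener_suminf
  using sum_le_suminf[OF summable_abs_wcoef, of "{n}" a] by simp

lemma obtain_wiener:
  assumes "summable (\<lambda>n. \<bar>c n :: real\<bar>)"
  obtains a where "\<And>n. wcoef n a = c n"
proof
  show "wcoef n (Abs_wiener (Abs_fps c)) = c n" for n
    using assms by (simp add: wcoef_def Abs_wiener_inverse)
qed

lemma norm_wiener_leI:
  assumes "\<And>N. (\<Sum>n<N. \<bar>wcoef n a\<bar>) \<le> e"
  shows "norm a \<le> e"
  unfolding norm_wiener_suminf by (rule suminf_le_const[OF summable_abs_wcoef assms])

text \<open>Completeness of l1: the limit is found coefficientwise, and the Cauchy estimate is kept
  for finite partial sums, uniformly in their length, until the limit is known to be
  summable.\<close>

instance wiener :: banach
proof
  fix X :: "nat \<Rightarrow> wiener" assume X: "Cauchy X"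
  have "Cauchy (\<lambda>m. wcoef n (X m))" for n
  proof (rule metric_CauchyI)
    fix e :: real assume "e > 0"
    from metric_CauchyD[OF X this] obtain M where M: "\<forall>m\<ge>M. \<forall>k\<ge>M. dist (X m) (X k) < e" by blast
    have "dist (wcoef n (X m)) (wcoef n (X k)) \<le> dist (X m) (X k)" for m k
      using abs_wcoef_le[of n "X m - X k"] by (simp add: dist_norm)
    with M show "\<exists>M. \<forall>m\<ge>M. \<forall>k\<ge>M. dist (wcoef n (X m)) (wcoef n (X k)) < e"
      by (meson order_le_less_trans)
  qed
  then have "\<forall>n. \<exists>c. (\<lambda>m. wcoef n (X m)) \<longlonglongrightarrow> c" by (simp add: Cauchy_convergent_iff convergent_def)
  then obtain c where c: "\<And>n. (\<lambda>m. wcoef n (X m)) \<longlonglongrightarrow> c n" by metis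
  have part: "\<exists>M. \<forall>m\<ge>M. \<forall>N. (\<Sum>n<N. \<bar>wcoef n (X m) - c n\<bar>) \<le> e" if "e > 0" for e
  proof -
    from metric_CauchyD[OF X that] obtain M where M: "\<And>m k. m \<ge> M \<Longrightarrow> k \<ge> M \<Longrightarrow> norm (X m - X k) < e"
      by (auto simp: dist_norm)
    have "(\<Sum>n<N. \<bar>wcoef n (X m) - c n\<bar>) \<le> e" if m: "m \<ge> M" for m N
    proof (rule LIMSEQ_le_const2)
      show "(\<lambda>k. \<Sum>n<N. \<bar>wcoef n (X m) - wcoef n (X k)\<bar>) \<longlonglongrightarrow> (\<Sum>n<N. \<bar>wcoef n (X m) - c n\<bar>)"
        by (intro tendsto_intros c)
      have "(\<Sum>n<N. \<bar>wcoef n (X m) - wcoef n (X k)\<bar>) \<le> e" if "k \<ge> M" for k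
      proof -
        have "(\<Sum>n<N. \<bar>wcoef n (X m - X k)\<bar>) \<le> norm (X m - X k)"
          unfolding norm_wiener_suminf by (rule sum_le_suminf[OF summable_abs_wcoef]) auto
        with M[OF m that] show ?thesis by simp
      qed
      then show "\<exists>K. \<forall>k\<ge>K. (\<Sum>n<N. \<bar>wcoef n (X m) - wcoef n (X k)\<bar>) \<le> e" by blast
    qed
    then show ?thesis by blast
  qed
  \<comment> \<open>A single term \<open>X M\<close> whose partial sums differ from those of
    \<open>c\<close> by at most 1 transfers its summability to \<open>c\<close>.\<close>
  obtain M where M: "\<And>N. (\<Sum>n<N. \<bar>wcoef n (X M) - c n\<bar>) \<le> 1" using part[of 1] by auto
  have "(\<Sum>n<N. \<bar>c n\<bar>) \<le> 1 + norm (X M)" for N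
  proof -
    have "(\<Sum>n<N. \<bar>c n\<bar>) \<le> (\<Sum>n<N. \<bar>wcoef n (X M) - c n\<bar> + \<bar>wcoef n (X M)\<bar>)"
      by (rule sum_mono) simp
    also have "\<dots> \<le> 1 + norm (X M)"
      unfolding sum.distrib norm_wiener_suminf
      by (intro add_mono M sum_le_suminf[OF summable_abs_wcoef]) auto
    finally show ?thesis .
  qed
  then have "summable (\<lambda>n. \<bar>c n\<bar>)" by (intro summableI_nonneg_bounded) auto
  then obtain a where a: "\<And>n. wcoef n a = c n"
    using obtain_wiener by blast
  have "X \<longlonglongrightarrow> a"
  proof (rule metric_LIMSEQ_I)
    fix e :: real assume "e > 0"
    then obtain M where M: "\<forall>m\<ge>M. \<forall>N. (\<Sum>n<N. \<bar>wcoef n (X m) - c n\<bar>) \<le> e / 2" using part[of "e/2"] by auto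
    have "norm (X m - a) \<le> e / 2" if "m \<ge> M" for m
      by (rule norm_wiener_leI) (use M that a in simp)
    then show "\<exists>M. \<forall>m\<ge>M. dist (X m) a < e"
      using \<open>e > 0\<close> by (force simp: dist_norm)
  qed
  then show "convergent X" by (auto simp: convergent_def)
qed

section \<open>Evaluation of a series at a real parameter\<close>

definition wev :: "real \<Rightarrow> wiener \<Rightarrow> real" where "wev t a = eval_fps (fps_of_wiener a) t"

lemma wev_suminf: "wev t a = (\<Sum>n. wcoef n a * t ^ n)"
  by (simp add: wev_def eval_fps_def wcoef_def)

lemma abs_wcoef_mult_power_le: "\<bar>t\<bar> \<le> 1 \<Longrightarrow> \<bar>wcoef n a * t ^ n\<bar> \<le> \<bar>wcoef n a\<bar>"
  by (simp add: abs_mult power_abs mult_left_le power_le_one)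

lemma summable_wev: "\<bar>t\<bar> \<le> 1 \<Longrightarrow> summable (\<lambda>n. \<bar>wcoef n a * t ^ n\<bar>)"
  by (rule summable_comparison_test'[OF summable_abs_wcoef[of a], of 0])
    (use abs_wcoef_mult_power_le in simp)

text \<open>Absolute convergence at 1 bounds the radius from below by 1 and no better, so
  \<open>eval_fps_mult\<close> is available strictly inside: hence \<bar>t\<bar> < 1 in
  \<open>wev_mult\<close>, against \<bar>t\<bar> \<le> 1 in the linear laws.\<close>

lemma fps_conv_radius_wiener: "fps_conv_radius (fps_of_wiener a) \<ge> 1"
proof -
  have "summable (\<lambda>n. norm (fps_nth (fps_of_wiener a) n * 1 ^ n))"
    using summable_abs_wcoef[of a] by (simp add: wcoef_def)
  then have "summable (\<lambda>n. fps_nth (fps_of_wiener a) n * 1 ^ n)" by (rule summable_norm_cancel)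
  from conv_radius_geI[OF this] show ?thesis by (simp add: fps_conv_radius_def one_ereal_def)
qed

lemma abs_wev_le: "\<bar>t\<bar> \<le> 1 \<Longrightarrow> \<bar>wev t a\<bar> \<le> norm a"
  unfolding wev_suminf norm_wiener_suminf
  by (rule order_trans[OF summable_rabs[OF summable_wev] suminf_le])
    (auto intro: summable_wev summable_abs_wcoef simp: abs_wcoef_mult_power_le)

lemma wev_add: "\<bar>t\<bar> \<le> 1 \<Longrightarrow> wev t (a + b) = wev t a + wev t b"
  using suminf_add[OF summable_rabs_cancel[OF summable_wev[of t a]] summable_rabs_cancel[OF summable_wev[of t b]]]
  by (simp add: wev_suminf distrib_right)

lemma wev_scaleR: "\<bar>t\<bar> \<le> 1 \<Longrightarrow> wev t (c *\<^sub>R a) = c * wev t a"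
  using suminf_mult[OF summable_rabs_cancel[OF summable_wev[of t a]]]
  by (simp add: wev_suminf mult.assoc)

lemma wev_diff: "\<bar>t\<bar> \<le> 1 \<Longrightarrow> wev t (a - b) = wev t a - wev t b"
  using wev_add[of t a "- 1 *\<^sub>R b"] wev_scaleR[of t "- 1" b] by simp

text \<open>The first nonzero coefficient of the difference would be the limit at 0 of the
  difference divided by the matching power of t, hence 0.\<close>

lemma wev_eqD:
  assumes ev: "\<And>t. \<bar>t\<bar> < 1 \<Longrightarrow> wev t a = wev t b"
  shows "a = b"
proof (rule ccontr)
  assume "a \<noteq> b"
  define c where "c n = wcoef n (a - b)" for n
  have "\<exists>n. c n \<noteq> 0"
    using \<open>a \<noteq> b\<close> by (auto simp: c_def intro: wiener_eqI)
  define m where "m = (LEAST n. c n \<noteq> 0)"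
  have m: "c m \<noteq> 0" unfolding m_def by (rule LeastI_ex) fact
  have less: "c n = 0" if "n < m" for n using not_less_Least[of n "\<lambda>n. c n \<noteq> 0"] that by (auto simp: m_def)
  have "(\<lambda>n. c (n + m) * t ^ n) sums 0" if t: "norm t < 1" "t \<noteq> 0" for t :: real
  proof -
    have "(\<lambda>n. c n * t ^ n) sums wev t (a - b)"
      unfolding wev_suminf c_def
      by (rule summable_sums[OF summable_rabs_cancel[OF summable_wev]]) (use t in simp)
    moreover have "wev t (a - b) = 0" using t ev[of t] by (simp add: wev_diff)
    ultimately have "(\<lambda>n. c n * t ^ n) sums 0" by simp
    then have "(\<lambda>n. c (n + m) * t ^ (n + m)) sums 0"
      using sums_iff_shift[of "\<lambda>n. c n * t ^ n" m 0] less by simp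
    from sums_mult[OF this, of "inverse (t ^ m)"] show ?thesis
      using t by (simp add: power_add field_simps)
  qed
  from powser_limit_0_strong[of 1, OF _ this] have "((\<lambda>_. 0) \<longlongrightarrow> c m) (at (0::real))" by simp
  with m show False by (simp add: tendsto_const_iff)
qed

lemma bounded_linear_wev: "\<bar>t\<bar> \<le> 1 \<Longrightarrow> bounded_linear (wev t)"
  by (rule bounded_linear_intro[of _ 1]) (auto simp: wev_add wev_scaleR abs_wev_le)

lemma bounded_linear_wcoef: "bounded_linear (wcoef n)"
  by (rule bounded_linear_intro[of _ 1]) (auto simp: abs_wcoef_le)

lemma wev_1 [simp]: "wev t 1 = 1"
  by (simp add: wev_def one_wiener.rep_eq)

lemma wev_of_real [simp]: "\<bar>t\<bar> \<le> 1 \<Longrightarrow> wev t (of_real c) = c"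
  by (simp add: of_real_def wev_scaleR)

lemma wev_mult: "\<bar>t\<bar> < 1 \<Longrightarrow> wev t (a * b) = wev t a * wev t b"
  unfolding wev_def times_wiener.rep_eq
  using fps_conv_radius_wiener[of a] fps_conv_radius_wiener[of b]
  by (intro eval_fps_mult) (auto intro: less_le_trans[of _ 1] simp: one_ereal_def)

lemma wev_prod: "\<bar>t\<bar> < 1 \<Longrightarrow> wev t (\<Prod>i\<in>I. f i) = (\<Prod>i\<in>I. wev t (f i))"
  by (induction I rule: infinite_finite_induct) (simp_all add: wev_mult)

lemma wev_power: "\<bar>t\<bar> < 1 \<Longrightarrow> wev t (a ^ n) = wev t a ^ n"
  by (induction n) (simp_all add: wev_mult)

lemma wev_0_eq_wcoef: "wev 0 a = wcoef 0 a"
  by (simp add: wev_def wcoef_def eval_fps_at_0)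

text \<open>Rescaling of the variable by \<open>s\<close>. The factor is clamped to \<open>[-1, 1]\<close> only to keep the map total.\<close>

lift_definition wscale :: "real \<Rightarrow> wiener \<Rightarrow> wiener"
  is "\<lambda>s f. Abs_fps (\<lambda>n. max (-1) (min 1 s) ^ n * fps_nth f n)"
proof -
  fix s :: real and f :: "real fps" assume s: "summable (\<lambda>n. \<bar>fps_nth f n\<bar>)"
  have "\<bar>max (-1) (min 1 s)\<bar> \<le> 1" by auto
  then have "\<bar>max (-1) (min 1 s) ^ n * fps_nth f n\<bar> \<le> \<bar>fps_nth f n\<bar>" for n
    by (simp add: abs_mult power_abs mult_left_le_one_le power_le_one)
  then show "summable (\<lambda>n. \<bar>fps_nth (Abs_fps (\<lambda>n. max (-1) (min 1 s) ^ n * fps_nth f n)) n\<bar>)"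
    by (intro summable_comparison_test'[OF s, of 0]) auto
qed

lemma wcoef_wscale: "\<bar>s\<bar> \<le> 1 \<Longrightarrow> wcoef n (wscale s a) = s ^ n * wcoef n a"
  by (auto simp: wcoef_def wscale.rep_eq min_def max_def)

lemma wev_wscale: "\<bar>s\<bar> \<le> 1 \<Longrightarrow> wev t (wscale s a) = wev (s * t) a"
  by (simp add: wev_suminf wcoef_wscale power_mult_distrib mult_ac)

lemma wscale_diff: "\<bar>s\<bar> \<le> 1 \<Longrightarrow> wscale s (a - b) = wscale s a - wscale s b"
  by (rule wiener_eqI) (simp add: wcoef_wscale algebra_simps)

lemma norm_wscale_le: "\<bar>s\<bar> \<le> 1 \<Longrightarrow> norm (wscale s a) \<le> norm a"
proof -
  assume s: "\<bar>s\<bar> \<le> 1"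
  then have "\<bar>wcoef n (wscale s a)\<bar> \<le> \<bar>wcoef n a\<bar>" for n
    by (simp add: wcoef_wscale abs_mult power_abs mult_left_le_one_le power_le_one)
  then show ?thesis
    unfolding norm_wiener_suminf by (intro suminf_le summable_abs_wcoef)
qed

text \<open>Shrinking the radius of convergence is what makes perturbation terms small.\<close>

lemma norm_wscale_le_mult:
  assumes s: "\<bar>s\<bar> \<le> 1" and "wcoef 0 a = 0"
  shows "norm (wscale s a) \<le> \<bar>s\<bar> * norm a"
proof -
  have le: "\<bar>wcoef n (wscale s a)\<bar> \<le> \<bar>s\<bar> * \<bar>wcoef n a\<bar>" for n
  proof (cases n)
    case 0 then show ?thesis using assms by (simp add: wcoef_wscale)
  next
    case (Suc m)
    \<comment> \<open>One factor s is kept from the power s^(m+1) and the others are bounded by 1;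
      the coefficient of index 0, which carries no such factor, vanishes.\<close>
    have "\<bar>s\<bar> * (\<bar>s\<bar> ^ m * \<bar>wcoef n a\<bar>) \<le> \<bar>s\<bar> * \<bar>wcoef n a\<bar>"
      using s by (intro mult_left_mono) (auto simp: mult_left_le_one_le power_le_one)
    then show ?thesis using s by (simp add: Suc wcoef_wscale abs_mult power_abs mult_ac)
  qed
  show ?thesis unfolding norm_wiener_suminf
    unfolding suminf_mult[OF summable_abs_wcoef, symmetric]
    by (rule suminf_le) (auto intro: le summable_abs_wcoef summable_mult)
qed

section \<open>Invariant lines of perturbed dominated cocycles\<close>

text \<open>The splitting a (b - d) + (a - c) d serves two purposes later: comparing one product at
  two points, and comparing the products formed with two candidate solutions.\<close>

lemma norm_mult_diff_le:
  fixes a b c d :: "'a::real_normed_algebra"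
  assumes "norm a \<le> A" "norm d \<le> B" "norm (b - d) \<le> \<delta>" "norm (a - c) \<le> \<gamma>"
  shows "norm (a * b - c * d) \<le> A * \<delta> + \<gamma> * B"
proof -
  have A: "0 \<le> A" "0 \<le> \<gamma>" using assms norm_ge_zero order_trans by blast+
  have "a * b - c * d = a * (b - d) + (a - c) * d" by (simp add: algebra_simps)
  also have "norm \<dots> \<le> norm a * norm (b - d) + norm (a - c) * norm d"
    by (intro norm_triangle_mono norm_mult_ineq)
  also have "\<dots> \<le> A * \<delta> + \<gamma> * B" using assms A by (intro add_mono mult_mono) auto
  finally show ?thesis .
qed

lemma norm_sum_UNIV_le:
  fixes f :: "'k::finite \<Rightarrow> 'a::real_normed_vector"
  assumes "\<And>k. norm (f k) \<le> c"
  shows "norm (\<Sum>k\<in>UNIV. f k) \<le> real CARD('k) * c"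
  using sum_norm_bound[of UNIV f c] assms by (simp add: mult.commute)

lemma geometric_increments_convergent:
  fixes U :: "nat \<Rightarrow> 'a::banach"
  assumes "\<And>n. norm (U (Suc n) - U n) \<le> c * q ^ n" and q: "0 \<le> q" "q < 1"
  shows "\<exists>u. U \<longlonglongrightarrow> u"
proof -
  have "summable (\<lambda>n. c * q ^ n)" using q by (intro summable_mult summable_geometric) auto
  then have "summable (\<lambda>n. U (Suc n) - U n)"
    by (rule summable_comparison_test'[of _ 0]) (rule assms)
  then have "(\<lambda>N. \<Sum>n<N. U (Suc n) - U n) \<longlonglongrightarrow> (\<Sum>n. U (Suc n) - U n)"
    by (rule summable_LIMSEQ)
  then have "(\<lambda>N. U N - U 0 + U 0) \<longlonglongrightarrow> (\<Sum>n. U (Suc n) - U n) + U 0"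
    by (intro tendsto_add) (simp_all add: sum_lessThan_telescope)
  then show ?thesis by auto
qed

text \<open>The shape covers both ways of solving a coordinate equation: \<tau>, \<sigma>, \<omega>
  are the base maps that the chosen way composes with, and \<delta> carries the coordinate fixed to
  1. The linear part has norm at most \<theta>; the terms with \<open>P\<close> and
  \<open>Q\<close>, the second quadratic in the unknown, are perturbations of size
  \<open>e\<close>.\<close>

lemma quadratic_graph_transform:
  fixes r :: "'k::finite \<Rightarrow> 'x \<Rightarrow> 'w::{real_normed_algebra_1, banach}"
    and P Q :: "'k \<Rightarrow> 'k \<Rightarrow> 'x \<Rightarrow> 'w" and \<delta> :: "'k \<Rightarrow> 'w"
    and \<tau> \<sigma> \<omega> :: "'k \<Rightarrow> 'x \<Rightarrow> 'x" and dd :: "'x \<Rightarrow> 'x \<Rightarrow> real"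
  defines "N \<equiv> real CARD('k)"
  assumes dd: "\<And>x y. 0 \<le> dd x y" and l: "1 \<le> l"
    and \<tau>: "\<And>k x y. dd (\<tau> k x) (\<tau> k y) \<le> l * dd x y"
    and \<sigma>: "\<And>k x y. dd (\<sigma> k x) (\<sigma> k y) \<le> l * dd x y"
    and \<omega>: "\<And>k x y. dd (\<omega> k x) (\<omega> k y) \<le> l * dd x y"
    and \<theta>: "0 \<le> \<theta>" "\<theta> * l < 1" and R: "0 \<le> R" and e: "0 \<le> e"
    and r: "\<And>k x. norm (r k x) \<le> \<theta>" "\<And>k x y. norm (r k x - r k y) \<le> R * dd x y"
    and P: "\<And>k j x. norm (P k j x) \<le> e" "\<And>k j x y. norm (P k j x - P k j y) \<le> e * dd x y"
    and Q: "\<And>k j x. norm (Q k j x) \<le> e" "\<And>k j x y. norm (Q k j x - Q k j y) \<le> e * dd x y"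
    and \<delta>: "\<And>j. norm (\<delta> j) \<le> 1"
    and a: "0 < a" "a \<le> 1" "R * a \<le> (1 - \<theta> * l) / 2"
    and small: "4 * N * e \<le> (1 - \<theta>) * a" "N * e * (4 * l + 4) \<le> (1 - \<theta> * l) / 2"
  shows "\<exists>u. (\<forall>k x. norm (u k x) \<le> a) \<and> (\<forall>k x y. norm (u k x - u k y) \<le> dd x y) \<and>
    (\<forall>k x. u k x = r k x * u k (\<tau> k x) + (\<Sum>j\<in>UNIV. P k j x * (\<delta> j + u j (\<sigma> k x)))
      + (\<Sum>j\<in>UNIV. Q k j x * (\<delta> j + u j (\<sigma> k x))) * u k (\<omega> k x))"
proof -
  define S where "S T u k x = (\<Sum>j\<in>UNIV. T k j x * (\<delta> j + u j (\<sigma> k x)))"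
    for T :: "'k \<Rightarrow> 'k \<Rightarrow> 'x \<Rightarrow> 'w" and u :: "'k \<Rightarrow> 'x \<Rightarrow> 'w" and k x
  define \<Phi> where "\<Phi> u k x = r k x * u k (\<tau> k x) + S P u k x + S Q u k x * u k (\<omega> k x)"
    for u :: "'k \<Rightarrow> 'x \<Rightarrow> 'w" and k x
  \<comment> \<open>The Lipschitz constant 1 can be preserved because the variation of
    \<open>r\<close>, which may be large, enters only multiplied by the bound \<open>a\<close>; this
    is why \<open>a\<close> has to be small relative to \<open>R\<close>.\<close>
  define D where "D u \<longleftrightarrow> (\<forall>k x. norm (u k x) \<le> a) \<and> (\<forall>k x y. norm (u k x - u k y) \<le> dd x y)"
    for u :: "'k \<Rightarrow> 'x \<Rightarrow> 'w"
  have N: "1 \<le> N" by (simp add: N_def Suc_le_eq)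
  have \<theta>1: "\<theta> < 1" using \<theta> l mult_left_mono[of 1 l \<theta>] by simp
  have two: "norm (\<delta> j + u j x) \<le> 2" if "D u" for u j x
    using that a \<delta>[of j] norm_triangle_ineq[of "\<delta> j" "u j x"] unfolding D_def by (smt (verit))
  have lip: "norm (u k (f x) - u k (f y)) \<le> l * dd x y"
    if "D u" "\<And>x y. dd (f x) (f y) \<le> l * dd x y" for u k x y and f :: "'x \<Rightarrow> 'x"
    using that unfolding D_def by (meson order_trans)
  have S1: "norm (S T u k x) \<le> N * (e * 2)"
    if "D u" "\<And>k j x. norm (T k j x) \<le> e" for T u k x
    unfolding S_def N_def
    by (intro norm_sum_UNIV_le order_trans[OF norm_mult_ineq] mult_mono that two) (simp_all add: e)
  have S2: "norm (S T u k x - S T u k y) \<le> N * (e * (l * dd x y) + (e * dd x y) * 2)"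
    if "D u" "\<And>k j x. norm (T k j x) \<le> e" "\<And>k j x y. norm (T k j x - T k j y) \<le> e * dd x y" for T u k x y
    unfolding S_def N_def sum_subtractf[symmetric]
    by (intro norm_sum_UNIV_le norm_mult_diff_le that two) (use lip[OF that(1) \<sigma>] in simp)
  have S3: "norm (S T u k x - S T u' k x) \<le> N * (e * c)"
    if "\<And>k x. norm (u k x - u' k x) \<le> c" "\<And>k j x. norm (T k j x) \<le> e" for T u u' k x c
    unfolding S_def N_def sum_subtractf[symmetric] right_diff_distrib[symmetric]
    by (intro norm_sum_UNIV_le order_trans[OF norm_mult_ineq] mult_mono that) (simp_all add: e that)
  have step: "D (\<Phi> u)" if u: "D u" for u
    unfolding D_def
  proof safe
    have ua: "norm (u k x) \<le> a" for k x using u by (simp add: D_def)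
    fix k x
    have "norm (\<Phi> u k x) \<le> \<theta> * a + N * (e * 2) + N * (e * 2) * a"
      unfolding \<Phi>_def using e N \<theta>
      by (intro norm_triangle_mono order_trans[OF norm_mult_ineq] mult_mono S1 u ua r P Q) auto
    also have "\<dots> \<le> \<theta> * a + N * (e * 2) + N * (e * 2) * 1"
      using e N a by (intro add_left_mono mult_left_mono) auto
    also have "\<dots> \<le> a" using small(1) by (simp add: algebra_simps)
    finally show "norm (\<Phi> u k x) \<le> a" .
    fix y
    let ?d = "dd x y"
    have "norm (\<Phi> u k x - \<Phi> u k y)
      = norm ((r k x * u k (\<tau> k x) - r k y * u k (\<tau> k y)) + (S P u k x - S P u k y)
        + (S Q u k x * u k (\<omega> k x) - S Q u k y * u k (\<omega> k y)))"
      by (simp only: \<Phi>_def add_diff_add)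
    also have "\<dots> \<le> (\<theta> * (l * ?d) + R * ?d * a) + N * (e * (l * ?d) + (e * ?d) * 2)
        + (N * (e * 2) * (l * ?d) + N * (e * (l * ?d) + (e * ?d) * 2) * a)"
      by (intro norm_triangle_mono norm_mult_diff_le r ua lip[OF u] \<tau> \<omega> S1 S2 u P Q)
    also have "\<dots> \<le> (\<theta> * (l * ?d) + R * ?d * a) + N * (e * (l * ?d) + (e * ?d) * 2)
        + (N * (e * 2) * (l * ?d) + N * (e * (l * ?d) + (e * ?d) * 2) * 1)"
      using e N a l dd[of x y] by (intro add_left_mono mult_left_mono) auto
    \<comment> \<open>The perturbation terms collect to N e (4 l + 4). This sum and R a were each
      allotted half of the gap 1 - \<theta> l.\<close>
    also have "\<dots> = (\<theta> * l + R * a + N * e * (4 * l + 4)) * ?d" by (simp add: algebra_simps)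
    also have "\<dots> \<le> 1 * ?d" using a(3) small(2) dd[of x y] by (intro mult_right_mono) auto
    finally show "norm (\<Phi> u k x - \<Phi> u k y) \<le> dd x y" by simp
  qed
  \<comment> \<open>Midpoint of \<theta> and 1: the perturbation raises the contraction rate
    \<theta> by at most 4 N e \<le> (1 - \<theta>) / 2.\<close>
  define q where "q = (1 + \<theta>) / 2"
  have q: "0 \<le> q" "q < 1" using \<theta> \<theta>1 by (auto simp: q_def)
  have contr: "norm (\<Phi> u k x - \<Phi> u' k x) \<le> q * c"
    if u: "D u" "D u'" "\<And>k x. norm (u k x - u' k x) \<le> c" for u u' k x c
  proof -
    have ua: "norm (u' k x) \<le> a" for k x using u by (simp add: D_def)
    have c: "0 \<le> c" using u(3) norm_ge_zero order_trans by blast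
    have "norm (\<Phi> u k x - \<Phi> u' k x)
      = norm ((r k x * u k (\<tau> k x) - r k x * u' k (\<tau> k x)) + (S P u k x - S P u' k x)
        + (S Q u k x * u k (\<omega> k x) - S Q u' k x * u' k (\<omega> k x)))"
      by (simp only: \<Phi>_def add_diff_add)
    also have "\<dots> \<le> (\<theta> * c + 0 * a) + N * (e * c) + (N * (e * 2) * c + N * (e * c) * a)"
      by (intro norm_triangle_mono norm_mult_diff_le r ua S1 S3 u P Q) auto
    also have "\<dots> \<le> (\<theta> * c + 0 * a) + N * (e * c) + (N * (e * 2) * c + N * (e * c) * 1)"
      using e N a c by (intro add_left_mono mult_left_mono) auto
    also have "\<dots> = (\<theta> + 4 * N * e) * c" by (simp add: algebra_simps)
    also have "4 * N * e \<le> (1 - \<theta>) / 2"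
    proof -
      have "N * e * 8 \<le> N * e * (4 * l + 4)" using N e l by (intro mult_left_mono) auto
      also have "\<dots> \<le> (1 - \<theta> * l) / 2" by (rule small)
      also have "\<dots> \<le> (1 - \<theta>) / 2" using \<theta> l mult_left_mono[of 1 l \<theta>] by simp
      finally have "N * e * 8 \<le> (1 - \<theta>) / 2" .
      moreover have "0 \<le> N * e" using N e by simp
      ultimately show ?thesis by linarith
    qed
    then have "(\<theta> + 4 * N * e) * c \<le> q * c"
      using c unfolding q_def by (intro mult_right_mono) (auto simp: field_simps)
    finally show ?thesis .
  qed
  define U where "U n = (\<Phi> ^^ n) (\<lambda>_ _. 0)" for n
  have U: "D (U n)" for n
    by (induction n) (use a dd in \<open>auto simp: U_def intro: step\<close>, simp add: D_def)
  have inc: "norm (U (Suc n) k x - U n k x) \<le> a * q ^ n" for n k x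
  proof (induction n arbitrary: k x)
    case 0
    show ?case using U[of 1] by (simp add: U_def D_def)
  next
    case (Suc n)
    from contr[OF U U Suc] show ?case by (simp add: U_def mult_ac)
  qed
  \<comment> \<open>Convergence is taken pointwise: both the bounds in \<open>D\<close> and the
    equation pass to pointwise limits, so no complete space of functions has to be set up.\<close>
  have "\<exists>v. (\<lambda>n. U n k x) \<longlonglongrightarrow> v" for k x
    using geometric_increments_convergent[of "\<lambda>n. U n k x", OF inc q] .
  then obtain u where lim: "\<And>k x. (\<lambda>n. U n k x) \<longlonglongrightarrow> u k x" by metis
  have "norm (u k x) \<le> a" for k x
    by (rule LIMSEQ_le_const2[OF tendsto_norm[OF lim]]) (use U in \<open>auto simp: D_def\<close>)
  moreover have "norm (u k x - u k y) \<le> dd x y" for k x y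
    by (rule LIMSEQ_le_const2[OF tendsto_norm[OF tendsto_diff[OF lim lim]]]) (use U in \<open>auto simp: D_def\<close>)
  moreover have "u k x = \<Phi> u k x" for k x
  proof (rule LIMSEQ_unique)
    show "(\<lambda>n. U (Suc n) k x) \<longlonglongrightarrow> u k x" using lim by (rule LIMSEQ_Suc)
    have "(\<lambda>n. \<Phi> (U n) k x) \<longlonglongrightarrow> \<Phi> u k x"
      unfolding \<Phi>_def S_def by (intro tendsto_intros lim)
    then show "(\<lambda>n. U (Suc n) k x) \<longlonglongrightarrow> \<Phi> u k x" by (simp add: U_def)
  qed
  ultimately show ?thesis unfolding \<Phi>_def S_def by blast
qed

text \<open>In applications \<open>dd\<close> is a power of the torus distance; as it vanishes on equivalent points,
  the estimate then contains periodicity.\<close>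

definition lip_bounded :: "('x \<Rightarrow> 'x \<Rightarrow> real) \<Rightarrow> real \<Rightarrow> ('x \<Rightarrow> 'b::real_normed_vector) \<Rightarrow> bool" where
  "lip_bounded dd K f \<longleftrightarrow> (\<forall>x. norm (f x) \<le> K) \<and> (\<forall>x y. norm (f x - f y) \<le> K * dd x y)"

lemma lip_boundedD: "lip_bounded dd K f \<Longrightarrow> norm (f x) \<le> K" "lip_bounded dd K f \<Longrightarrow> norm (f x - f y) \<le> K * dd x y"
  by (auto simp: lip_bounded_def)

lemma lip_bounded_nonneg: "lip_bounded dd K f \<Longrightarrow> 0 \<le> K"
  unfolding lip_bounded_def using norm_ge_zero order_trans by blast

lemma lip_bounded_eq: "lip_bounded dd K f \<Longrightarrow> dd x y = 0 \<Longrightarrow> f x = f y"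
  using lip_boundedD(2)[of dd K f x y] by simp

lemma lip_bounded_mono:
  assumes "lip_bounded dd K f" "K \<le> L" "\<And>x y. 0 \<le> dd x y"
  shows "lip_bounded dd L f"
  using assms unfolding lip_bounded_def by (meson mult_right_mono order_trans)

lemma lip_bounded_const:
  assumes "\<And>x y. 0 \<le> dd x y"
  shows "lip_bounded dd (norm c) (\<lambda>_. c)"
  using assms by (simp add: lip_bounded_def)

lemma lip_bounded_add:
  assumes "lip_bounded dd K f" "lip_bounded dd L g"
  shows "lip_bounded dd (K + L) (\<lambda>x. f x + g x)"
  unfolding lip_bounded_def add_diff_add distrib_right
  using assms by (auto intro!: norm_triangle_mono dest: lip_boundedD)

lemma lip_bounded_bounded_linear:
  assumes "lip_bounded dd K f" "bounded_linear h" "\<And>x. norm (h x) \<le> C * norm x" "0 \<le> C"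
  shows "lip_bounded dd (C * K) (\<lambda>x. h (f x))"
  unfolding lip_bounded_def linear_diff[OF bounded_linear.linear[OF assms(2)], symmetric]
proof safe
  fix x y
  show "norm (h (f x)) \<le> C * K"
    by (rule order_trans[OF assms(3)]) (intro mult_left_mono lip_boundedD[OF assms(1)] assms)
  show "norm (h (f x - f y)) \<le> C * K * dd x y"
    unfolding mult.assoc by (rule order_trans[OF assms(3)]) (intro mult_left_mono lip_boundedD[OF assms(1)] assms)
qed

lemma lip_bounded_minus: "lip_bounded dd K f \<Longrightarrow> lip_bounded dd K (\<lambda>x. - f x)"
  by (simp add: lip_bounded_def norm_minus_commute flip: minus_diff_minus)

text \<open>The product rule has two terms of size K L, and one constant serves both the bound and
  the variation; hence the factor 2.\<close>

lemma lip_bounded_mult: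
  fixes f g :: "'x \<Rightarrow> 'w::real_normed_algebra"
  assumes "lip_bounded dd K f" "lip_bounded dd L g"
  shows "lip_bounded dd (2 * K * L) (\<lambda>x. f x * g x)"
  unfolding lip_bounded_def
proof safe
  fix x y
  have "norm (f x * g x) \<le> K * L"
    using lip_bounded_nonneg[OF assms(1)] lip_boundedD(1)[OF assms(1)] lip_boundedD(1)[OF assms(2)]
    by (intro order_trans[OF norm_mult_ineq] mult_mono) auto
  also have "\<dots> \<le> 2 * K * L" using mult_nonneg_nonneg[OF assms[THEN lip_bounded_nonneg]] by simp
  finally show "norm (f x * g x) \<le> 2 * K * L" .
  have "norm (f x * g x - f y * g y) \<le> K * (L * dd x y) + (K * dd x y) * L"
    by (intro norm_mult_diff_le lip_boundedD[OF assms(1)] lip_boundedD[OF assms(2)])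
  then show "norm (f x * g x - f y * g y) \<le> 2 * K * L * dd x y" by (simp add: algebra_simps)
qed

lemma lip_bounded_scaleR:
  fixes f :: "'x \<Rightarrow> real" and g :: "'x \<Rightarrow> 'w::real_normed_vector"
  assumes "lip_bounded dd K f" "lip_bounded dd L g"
  shows "lip_bounded dd (2 * K * L) (\<lambda>x. f x *\<^sub>R g x)"
  unfolding lip_bounded_def
proof safe
  fix x y
  have f: "\<bar>f x\<bar> \<le> K" for x using lip_boundedD(1)[OF assms(1), of x] by simp
  have f2: "\<bar>f x - f y\<bar> \<le> K * dd x y" using lip_boundedD(2)[OF assms(1), of x y] by simp
  have "norm (f x *\<^sub>R g x) \<le> K * L"
    using lip_bounded_nonneg[OF assms(1)] lip_boundedD(1)[OF assms(2)] f by (auto intro!: mult_mono)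
  also have "\<dots> \<le> 2 * K * L" using mult_nonneg_nonneg[OF assms[THEN lip_bounded_nonneg]] by simp
  finally show "norm (f x *\<^sub>R g x) \<le> 2 * K * L" .
  have "f x *\<^sub>R g x - f y *\<^sub>R g y = f x *\<^sub>R (g x - g y) + (f x - f y) *\<^sub>R g y"
    by (simp add: algebra_simps)
  also have "norm \<dots> \<le> K * (L * dd x y) + (K * dd x y) * L"
    unfolding norm_scaleR
    using f f2 lip_bounded_nonneg[OF assms(1)] lip_boundedD[OF assms(2)] order_trans[OF abs_ge_zero f2]
    by (intro norm_triangle_mono) (auto intro!: mult_mono)
  finally show "norm (f x *\<^sub>R g x - f y *\<^sub>R g y) \<le> 2 * K * L * dd x y" by (simp add: algebra_simps)
qed

lemma lip_bounded_compose:
  assumes "lip_bounded dd K f" "\<And>x y. dd (\<tau> x) (\<tau> y) \<le> l * dd x y" "1 \<le> l"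
  shows "lip_bounded dd (K * l) (\<lambda>x. f (\<tau> x))"
  unfolding lip_bounded_def
proof safe
  fix x y
  have K: "0 \<le> K" using assms(1) by (rule lip_bounded_nonneg)
  have "norm (f (\<tau> x)) \<le> K * 1" using lip_boundedD(1)[OF assms(1)] by simp
  also have "\<dots> \<le> K * l" using K assms(3) by (rule mult_left_mono[rotated])
  finally show "norm (f (\<tau> x)) \<le> K * l" .
  have "norm (f (\<tau> x) - f (\<tau> y)) \<le> K * dd (\<tau> x) (\<tau> y)" by (rule lip_boundedD(2)[OF assms(1)])
  also have "\<dots> \<le> K * (l * dd x y)" by (intro mult_left_mono assms K)
  finally show "norm (f (\<tau> x) - f (\<tau> y)) \<le> K * l * dd x y" by (simp add: mult.assoc)
qed

lemma lip_bounded_of_real: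
  assumes "lip_bounded dd K f"
  shows "lip_bounded dd K (\<lambda>x. of_real (f x) :: 'w::real_normed_algebra_1)"
  using assms unfolding lip_bounded_def norm_of_real of_real_diff[symmetric] by simp

text \<open>The \<open>k\<close>-th coordinate equation is solved for \<open>u k (A x)\<close> if \<open>lam k\<close> is dominated by \<open>lam i\<close>, and for
  \<open>u k x\<close> otherwise; either way the factor in front of the unknown is at most \<open>\<theta>\<close>.\<close>

lemma perturbed_invariant_line:
  fixes lam :: "'k::finite \<Rightarrow> 'x \<Rightarrow> real" and A B :: "'x \<Rightarrow> 'x" and i :: 'k
  assumes dd: "\<And>x y. 0 \<le> dd x y" and l: "1 \<le> l"
    and A: "\<And>x y. dd (A x) (A y) \<le> l * dd x y" and B: "\<And>x y. dd (B x) (B y) \<le> l * dd x y"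
    and AB: "\<And>x. dd (A (B x)) x = 0" and BA: "\<And>x. dd (B (A x)) x = 0"
    and lam: "\<And>k. lip_bounded dd R (lam k)" "\<And>k. lip_bounded dd R (\<lambda>x. inverse (lam k x))" "\<And>k x. lam k x \<noteq> 0"
    and \<theta>: "0 \<le> \<theta>" "\<theta> * l < 1"
    and dom: "\<And>k. k \<noteq> i \<Longrightarrow> (\<forall>x. \<bar>lam k x\<bar> \<le> \<theta> * \<bar>lam i x\<bar>) \<or> (\<forall>x. \<bar>lam i x\<bar> \<le> \<theta> * \<bar>lam k x\<bar>)"
    and a0: "0 < a0"
  shows "\<exists>e>0. \<forall>E :: 'k \<Rightarrow> 'k \<Rightarrow> 'x \<Rightarrow> 'w::{real_normed_algebra_1, banach}.
    (\<forall>k j. lip_bounded dd e (E k j)) \<longrightarrow> (\<exists>u. u i = (\<lambda>_. 1) \<and> (\<forall>k x. k \<noteq> i \<longrightarrow> norm (u k x) \<le> a0) \<and>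
      (\<forall>k x y. norm (u k x - u k y) \<le> dd x y) \<and>
      (\<forall>k x. lam k x *\<^sub>R u k x + (\<Sum>j\<in>UNIV. E k j x * u j x)
          = (of_real (lam i x) + (\<Sum>j\<in>UNIV. E i j x * u j x)) * u k (A x)))"
proof -
  define N where "N = real CARD('k)"
  have N: "1 \<le> N" by (simp add: N_def Suc_le_eq)
  have R0: "0 \<le> R" using lam(1) by (rule lip_bounded_nonneg)
  have \<theta>1: "\<theta> < 1" using \<theta> l mult_left_mono[of 1 l \<theta>] by simp
  \<comment> \<open>Bounds the quotients of two \<open>lam\<close>, possibly composed with
    \<open>B\<close>: the constants of \<open>lip_bounded_compose\<close> and
    \<open>lip_bounded_mult\<close> combined.\<close>
  define R' where "R' = 2 * (R * l) * (R * l)"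
  have R': "0 \<le> R'" using R0 l by (simp add: R'_def)
  define a where "a = min (min a0 1) ((1 - \<theta> * l) / (2 * (R' + 1)))"
  have a: "0 < a" "a \<le> 1" "a \<le> a0" using a0 \<theta> R' by (auto simp: a_def)
  have a3: "R' * a \<le> (1 - \<theta> * l) / 2"
  proof -
    have "R' * a \<le> R' * ((1 - \<theta> * l) / (2 * (R' + 1)))" using R' by (intro mult_left_mono) (auto simp: a_def)
    also have "\<dots> = (R' / (R' + 1)) * ((1 - \<theta> * l) / 2)" by (simp add: field_simps)
    also have "\<dots> \<le> 1 * ((1 - \<theta> * l) / 2)" using R' \<theta> by (intro mult_right_mono) (auto simp: field_simps)
    finally show ?thesis by simp
  qed
  \<comment> \<open>The two entries are the two smallness conditions of
    \<open>quadratic_graph_transform\<close>, solved for \<open>e\<close>.\<close>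
  define e where "e = min ((1 - \<theta>) * a / (4 * N)) ((1 - \<theta> * l) / (2 * N * (4 * l + 4)))"
  have e: "0 < e" using \<theta> \<theta>1 a N l by (auto simp: e_def)
  have e1: "4 * N * e \<le> (1 - \<theta>) * a"
    using N mult_left_mono[of e "(1 - \<theta>) * a / (4 * N)" "4 * N"] by (simp add: e_def)
  have e2: "N * e * (4 * l + 4) \<le> (1 - \<theta> * l) / 2"
  proof -
    have "e * (2 * N * (4 * l + 4)) \<le> 1 - \<theta> * l"
      using N l by (subst pos_le_divide_eq[symmetric]) (auto simp: e_def)
    then show ?thesis by (simp add: algebra_simps)
  qed
  \<comment> \<open>Multiplication by an inverse of \<open>lam\<close> and composition with
    \<open>B\<close> raise the bound e' of the matrix entries to at most e; the summand 1 keeps the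
    denominator positive.\<close>
  define e' where "e' = e / (2 * (R * l) * l + 1)"
  have den: "0 < 2 * (R * l) * l + 1" using R0 l by (simp add: add_nonneg_pos)
  have e': "0 < e'" using e den by (simp add: e'_def)
  have e'le: "2 * (R * l) * (e' * l) \<le> e"
  proof -
    have "2 * (R * l) * (e' * l) \<le> (2 * (R * l) * l + 1) * e'" using e' by (simp add: algebra_simps)
    also have "\<dots> = e" using den by (simp add: e'_def)
    finally show ?thesis .
  qed
  show ?thesis
  proof (intro exI[of _ e'] conjI e' allI impI)
    fix E :: "'k \<Rightarrow> 'k \<Rightarrow> 'x \<Rightarrow> 'w" assume "\<forall>k j. lip_bounded dd e' (E k j)"
    then have E: "lip_bounded dd e' (E k j)" for k j by blast
    define K1 where "K1 k \<longleftrightarrow> (\<forall>x. \<bar>lam k x\<bar> \<le> \<theta> * \<bar>lam i x\<bar>)" for k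
    \<comment> \<open>If \<open>K1 k\<close>, the equation is taken at \<open>B x\<close> and
      divided by \<open>lam i\<close>, so the linear terms are read at \<open>B x\<close> and the
      unknown in the quadratic term at x. Otherwise it is taken at x and divided by
      \<open>lam k\<close>, and the unknown on the right is read at \<open>A x\<close>.\<close>
    define \<sigma> where "\<sigma> k = (if K1 k then B else (\<lambda>x. x))" for k
    define \<tau> where "\<tau> k = (if K1 k then B else A)" for k
    define \<omega> where "\<omega> k = (if K1 k then (\<lambda>x. x) else A)" for k
    define s where "s k x = (if K1 k then inverse (lam i (B x)) else inverse (lam k x))" for k x
    \<comment> \<open>All coefficients are set to 0 for k = i. This forces \<open>u i = 0\<close>
      and hence the normalised coordinate \<open>w i = 1\<close>.\<close>
    define rr where "rr k x = (if k = i then 0 else s k x * (if K1 k then lam k (B x) else lam i x))" for k x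
    define P where "P k j x = (if k = i then 0 else (if K1 k then s k x else - s k x) *\<^sub>R E k j (\<sigma> k x))" for k j x
    define Q where "Q k j x = (if k = i then 0 else (if K1 k then - s k x else s k x) *\<^sub>R E i j (\<sigma> k x))" for k j x
    have id: "dd x y \<le> l * dd x y" for x y using dd[of x y] l mult_right_mono[of 1 l "dd x y"] by simp
    have maps: "dd (\<sigma> k x) (\<sigma> k y) \<le> l * dd x y" "dd (\<tau> k x) (\<tau> k y) \<le> l * dd x y"
      "dd (\<omega> k x) (\<omega> k y) \<le> l * dd x y" for k x y
      using id A B by (auto simp: \<sigma>_def \<tau>_def \<omega>_def)
    have RRl: "R \<le> R * l" using R0 l mult_left_mono[of 1 l R] by simp
    have s: "lip_bounded dd (R * l) (s k)" for k
    proof (cases "K1 k")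
      case True
      have "lip_bounded dd (R * l) (\<lambda>x. inverse (lam i (B x)))" by (rule lip_bounded_compose[where \<tau> = B, OF lam(2) B l])
      then show ?thesis using True by (simp add: s_def[abs_def])
    next
      case False
      have "lip_bounded dd (R * l) (\<lambda>x. inverse (lam k x))" by (rule lip_bounded_mono[OF lam(2) RRl dd])
      then show ?thesis using False by (simp add: s_def[abs_def])
    qed
    have rr: "lip_bounded dd R' (rr k)" for k
    proof -
      have "lip_bounded dd (R * l) (\<lambda>x. if K1 k then lam k (B x) else lam i x)"
        using lip_bounded_compose[where \<tau> = B, OF lam(1) B l] lip_bounded_mono[OF lam(1) RRl dd] by (cases "K1 k") auto
      from lip_bounded_mult[OF s this, of k] have "lip_bounded dd R' (\<lambda>x. s k x * (if K1 k then lam k (B x) else lam i x))"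
        by (simp add: R'_def)
      moreover have "lip_bounded dd R' (\<lambda>x. 0 :: real)" using lip_bounded_mono[OF lip_bounded_const[of dd "0::real"], of R'] dd R' by simp
      ultimately show ?thesis by (cases "k = i") (simp_all add: rr_def[abs_def])
    qed
    have rr_le: "\<bar>rr k x\<bar> \<le> \<theta>" for k x
    proof (cases "k = i")
      case False
      have "\<bar>inverse c * b\<bar> \<le> \<theta>" if "c \<noteq> 0" "\<bar>b\<bar> \<le> \<theta> * \<bar>c\<bar>" for b c :: real
        using that by (simp add: abs_mult field_simps)
      then show ?thesis using dom[OF False] False lam(3) by (auto simp: rr_def s_def K1_def)
    qed (simp add: rr_def \<theta>)
    have sE: "lip_bounded dd e (\<lambda>x. s k x *\<^sub>R E k' j (\<sigma> k x))" for k k' j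
    proof -
      have "lip_bounded dd (e' * l) (\<lambda>x. E k' j (\<sigma> k x))" by (rule lip_bounded_compose[where \<tau> = "\<sigma> k", OF E maps(1) l])
      from lip_bounded_scaleR[OF s[of k] this] show ?thesis by (rule lip_bounded_mono[OF _ e'le dd])
    qed
    have z: "lip_bounded dd e (\<lambda>x. 0 :: 'w)" using lip_bounded_mono[OF lip_bounded_const[of dd "0::'w"], of e] dd e by simp
    have P: "lip_bounded dd e (P k j)" and Q: "lip_bounded dd e (Q k j)" for k j
      using sE[of k k j] sE[of k i j] lip_bounded_minus[OF sE[of k k j]] lip_bounded_minus[OF sE[of k i j]] z
      by (cases "k = i"; cases "K1 k"; simp add: P_def[abs_def] Q_def[abs_def])+
    let ?\<delta> = "\<lambda>j. if j = i then 1 else 0 :: 'w"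
    have \<delta>1: "norm (?\<delta> j) \<le> 1" for j by simp
    have r1: "norm (of_real (rr k x) :: 'w) \<le> \<theta>" for k x using rr_le by simp
    have r2: "norm (of_real (rr k x) - of_real (rr k y) :: 'w) \<le> R' * dd x y" for k x y
      using lip_boundedD(2)[OF lip_bounded_of_real[OF rr]] .
    have "\<exists>u. (\<forall>k x. norm (u k x) \<le> a) \<and> (\<forall>k x y. norm (u k x - u k y) \<le> dd x y) \<and>
      (\<forall>k x. u k x = of_real (rr k x) * u k (\<tau> k x) + (\<Sum>j\<in>UNIV. P k j x * (?\<delta> j + u j (\<sigma> k x)))
        + (\<Sum>j\<in>UNIV. Q k j x * (?\<delta> j + u j (\<sigma> k x))) * u k (\<omega> k x))"
      by (rule quadratic_graph_transform[where r = "\<lambda>k x. of_real (rr k x)" and P = P and Q = Q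
            and \<tau> = \<tau> and \<sigma> = \<sigma> and \<omega> = \<omega> and dd = dd and l = l and \<theta> = \<theta> and R = R' and e = e and a = a])
        (fact dd l maps \<theta> R' less_imp_le[OF e] r1 r2 lip_boundedD(1)[OF P] lip_boundedD(2)[OF P] lip_boundedD(1)[OF Q] lip_boundedD(2)[OF Q]
          \<delta>1 a(1) a(2) a3 e1[unfolded N_def] e2[unfolded N_def])+
    then obtain u where u0: "\<forall>k x. norm (u k x) \<le> a" "\<forall>k x y. norm (u k x - u k y) \<le> dd x y"
      and eq0: "\<forall>k x. u k x = of_real (rr k x) * u k (\<tau> k x) + (\<Sum>j\<in>UNIV. P k j x * (?\<delta> j + u j (\<sigma> k x)))
        + (\<Sum>j\<in>UNIV. Q k j x * (?\<delta> j + u j (\<sigma> k x))) * u k (\<omega> k x)" by (elim exE conjE)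
    note u = u0[rule_format] and eq = eq0[rule_format]
    define w where "w k x = ?\<delta> k + u k x" for k x
    have ui: "u i x = 0" for x using eq[of i x] by (simp add: rr_def P_def Q_def)
    have cong: "u k x = u k y" if "dd x y = 0" for k x y using u(2)[of k x y] that by simp
    have wcong: "w k x = w k y" if "dd x y = 0" for k x y using cong[OF that] by (simp add: w_def)
    have wk: "w k = u k" if "k \<noteq> i" for k using that by (simp add: w_def fun_eq_iff)
    show "\<exists>u. u i = (\<lambda>_. 1) \<and> (\<forall>k x. k \<noteq> i \<longrightarrow> norm (u k x) \<le> a0) \<and>
      (\<forall>k x y. norm (u k x - u k y) \<le> dd x y) \<and>
      (\<forall>k x. lam k x *\<^sub>R u k x + (\<Sum>j\<in>UNIV. E k j x * u j x)
          = (of_real (lam i x) + (\<Sum>j\<in>UNIV. E i j x * u j x)) * u k (A x))"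
    proof (intro exI[of _ w] conjI allI impI)
      show wi: "w i = (\<lambda>_. 1)" by (simp add: w_def ui fun_eq_iff)
      show "norm (w k x) \<le> a0" if "k \<noteq> i" for k x using u(1)[of k x] a that by (simp add: w_def)
      show "norm (w k x - w k y) \<le> dd x y" for k x y using u(2) by (simp add: w_def)
      fix k x
      define Ek where "Ek k x = (\<Sum>j\<in>UNIV. E k j x * w j x)" for k x
      have "lam k x *\<^sub>R w k x + Ek k x = (of_real (lam i x) + Ek i x) * w k (A x)"
      proof (cases "k = i")
        case True then show ?thesis by (simp add: wi of_real_def)
      next
        case False
        have sums: "(\<Sum>j\<in>UNIV. P k j y * (?\<delta> j + u j (\<sigma> k y))) = (if K1 k then s k y else - s k y) *\<^sub>R Ek k (\<sigma> k y)"
          "(\<Sum>j\<in>UNIV. Q k j y * (?\<delta> j + u j (\<sigma> k y))) = (if K1 k then - s k y else s k y) *\<^sub>R Ek i (\<sigma> k y)" for y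
          using False by (simp_all add: P_def Q_def Ek_def w_def scaleR_sum_right)
        show ?thesis
        proof (cases "K1 k")
          case True
          \<comment> \<open>\<open>B (A x)\<close> agrees with x only up to dd-distance 0; functions
            that are Lipschitz for \<open>dd\<close> do not see the difference.\<close>
          have Ekc: "Ek k' (B (A x)) = Ek k' x" for k'
            unfolding Ek_def by (intro sum.cong refl arg_cong2[of _ _ _ _ "(*)"] lip_bounded_eq[OF E] wcong BA)
          have lc: "lam k' (B (A x)) = lam k' x" for k' by (rule lip_bounded_eq[OF lam(1) BA])
          have "w k (A x) = (inverse (lam i x) * lam k x) *\<^sub>R w k x + inverse (lam i x) *\<^sub>R Ek k x
              + (- inverse (lam i x) *\<^sub>R Ek i x) * w k (A x)"
            using eq[of k "A x", unfolded sums] True False wcong[OF BA, of k x]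
            by (simp add: wk rr_def s_def \<tau>_def \<sigma>_def \<omega>_def Ekc lc mult.commute[of "lam k x"]) (simp add: of_real_def mult.commute)
          then have "lam i x *\<^sub>R w k (A x) = lam i x *\<^sub>R ((inverse (lam i x) * lam k x) *\<^sub>R w k x + inverse (lam i x) *\<^sub>R Ek k x
              + (- inverse (lam i x) *\<^sub>R Ek i x) * w k (A x))" by simp
          also have "\<dots> = lam k x *\<^sub>R w k x + Ek k x - Ek i x * w k (A x)"
            using lam(3)[of i x] by (simp add: scaleR_add_right scaleR_diff_right flip: mult_scaleR_left)
          finally show ?thesis by (simp add: distrib_right of_real_def)
        next
          case K1: False
          have "w k x = (inverse (lam k x) * lam i x) *\<^sub>R w k (A x) + (- inverse (lam k x)) *\<^sub>R Ek k x
              + (inverse (lam k x) *\<^sub>R Ek i x) * w k (A x)"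
            using eq[of k x, unfolded sums] K1 False
            by (simp add: wk rr_def s_def \<tau>_def \<sigma>_def \<omega>_def) (simp add: of_real_def)
          then have "lam k x *\<^sub>R w k x = lam k x *\<^sub>R ((inverse (lam k x) * lam i x) *\<^sub>R w k (A x) + (- inverse (lam k x)) *\<^sub>R Ek k x
              + (inverse (lam k x) *\<^sub>R Ek i x) * w k (A x))" by simp
          also have "\<dots> = lam i x *\<^sub>R w k (A x) - Ek k x + Ek i x * w k (A x)"
            using lam(3)[of k x] by (simp add: scaleR_add_right scaleR_diff_right flip: mult_scaleR_left)
          finally show ?thesis by (simp add: distrib_right of_real_def)
        qed
      qed
      then show "lam k x *\<^sub>R w k x + (\<Sum>j\<in>UNIV. E k j x * w j x)
          = (of_real (lam i x) + (\<Sum>j\<in>UNIV. E i j x * w j x)) * w k (A x)" by (simp add: Ek_def)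
    qed
  qed
qed

text \<open>This identifies the constant terms in \<epsilon>. By domination the size of f at a point
  is at most \<theta> times its size one step forwards or one step backwards on the orbit, so the
  bound \<open>a\<close> improves to \<theta>^n a for every n.\<close>

lemma dominated_cocycle_bounded_solution_0:
  fixes f p q :: "'x \<Rightarrow> real"
  assumes f: "\<And>x. \<bar>f x\<bar> \<le> a" "\<And>x. f (A (B x)) = f x"
    and eq: "\<And>x. p x * f x = q x * f (A x)"
    and nz: "\<And>x. p x \<noteq> 0" "\<And>x. q x \<noteq> 0" and \<theta>: "0 \<le> \<theta>" "\<theta> < 1"
    and dom: "(\<forall>x. \<bar>p x\<bar> \<le> \<theta> * \<bar>q x\<bar>) \<or> (\<forall>x. \<bar>q x\<bar> \<le> \<theta> * \<bar>p x\<bar>)"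
  shows "f x = 0"
proof -
  have red: "\<bar>b\<bar> \<le> \<theta> * \<bar>c\<bar>" if "d * b = d' * c" "\<bar>d'\<bar> \<le> \<theta> * \<bar>d\<bar>" "d \<noteq> 0" for b c d d' :: real
  proof -
    have "\<bar>d\<bar> * \<bar>b\<bar> = \<bar>d'\<bar> * \<bar>c\<bar>" using that(1) by (metis abs_mult)
    also have "\<dots> \<le> (\<theta> * \<bar>d\<bar>) * \<bar>c\<bar>" by (intro mult_right_mono that) auto
    finally have "\<bar>d\<bar> * \<bar>b\<bar> \<le> \<bar>d\<bar> * (\<theta> * \<bar>c\<bar>)" by (simp add: mult_ac)
    then show ?thesis using that(3) by simp
  qed
  have step: "\<exists>z. \<bar>f y\<bar> \<le> \<theta> * \<bar>f z\<bar>" for y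
    using dom
  proof
    assume "\<forall>x. \<bar>p x\<bar> \<le> \<theta> * \<bar>q x\<bar>"
    then have "\<bar>f (A (B y))\<bar> \<le> \<theta> * \<bar>f (B y)\<bar>" 
      by (intro red[OF eq[of "B y", symmetric] _ nz(2)]) blast
    then show ?thesis by (auto simp: f)
  next
    assume "\<forall>x. \<bar>q x\<bar> \<le> \<theta> * \<bar>p x\<bar>"
    then have "\<bar>f y\<bar> \<le> \<theta> * \<bar>f (A y)\<bar>" 
      by (intro red[OF eq[of y] _ nz(1)]) blast
    then show ?thesis by auto
  qed
  have "\<bar>f y\<bar> \<le> \<theta> ^ n * a" for n y
  proof (induction n arbitrary: y)
    case (Suc n)
    obtain z where "\<bar>f y\<bar> \<le> \<theta> * \<bar>f z\<bar>" using step by blast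
    also have "\<dots> \<le> \<theta> * (\<theta> ^ n * a)" by (intro mult_left_mono Suc \<theta>)
    finally show ?case by (simp add: mult.assoc)
  qed (use f in simp)
  moreover have "(\<lambda>n. \<theta> ^ n * a) \<longlonglongrightarrow> 0 * a"
    using \<theta> by (intro tendsto_mult tendsto_const LIMSEQ_realpow_zero)
  ultimately have "\<bar>f x\<bar> \<le> 0" by (intro LIMSEQ_le_const[of _ _ "\<bar>f x\<bar>"]) auto
  then show ?thesis by simp
qed

section \<open>Geometry of the torus\<close>

lemma int_vecs_add: "k \<in> int_vecs \<Longrightarrow> l \<in> int_vecs \<Longrightarrow> k + l \<in> int_vecs"
  and int_vecs_uminus: "k \<in> int_vecs \<Longrightarrow> - k \<in> int_vecs"
  and int_vecs_diff: "k \<in> int_vecs \<Longrightarrow> l \<in> int_vecs \<Longrightarrow> k - l \<in> int_vecs"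
  and int_vecs_0: "0 \<in> int_vecs"
  by (simp_all add: int_vecs_def)

lemma closed_int_vecs: "closed (int_vecs :: (real^'d) set)"
proof -
  have "closed {k :: real^'d. k $ i \<in> \<int>}" for i
    using continuous_closed_vimage[OF closed_Ints, of "\<lambda>k :: real^'d. k $ i"] by (simp add: vimage_def)
  then have "closed (\<Inter>i. {k :: real^'d. k $ i \<in> \<int>})" by (intro closed_INT) auto
  moreover have "(\<Inter>i. {k :: real^'d. k $ i \<in> \<int>}) = int_vecs" by (auto simp: int_vecs_def)
  ultimately show ?thesis by simp
qed

lemma tor_eq_iff: "tor_eq x y \<longleftrightarrow> (\<exists>k\<in>int_vecs. x = y + (2 * pi) *\<^sub>R k)"
proof
  assume "tor_eq x y"
  then obtain n where n: "\<And>i. x $ i - y $ i = 2 * pi * of_int (n i)" unfolding tor_eq_def by metis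
  show "\<exists>k\<in>int_vecs. x = y + (2 * pi) *\<^sub>R k"
    by (rule bexI[of _ "\<chi> i. of_int (n i)"]) (simp_all add: int_vecs_def vec_eq_iff flip: n)
next
  assume "\<exists>k\<in>int_vecs. x = y + (2 * pi) *\<^sub>R k"
  then show "tor_eq x y" by (fastforce simp: tor_eq_def int_vecs_def elim: Ints_cases)
qed

lemma tor_eq_add: "k \<in> int_vecs \<Longrightarrow> tor_eq (x + (2 * pi) *\<^sub>R k) x"
  by (auto simp: tor_eq_iff)

lemma tor_eq_refl [simp]: "tor_eq x x"
  using tor_eq_add[OF int_vecs_0, of x] by simp

lemma tor_eq_sym: "tor_eq x y \<Longrightarrow> tor_eq y x"
  unfolding tor_eq_iff by (elim bexE) (rule_tac x = "- k" in bexI, auto simp: int_vecs_uminus)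

lemma tdist_le:
  assumes "k \<in> int_vecs"
  shows "tdist x y \<le> norm (x - y + (2 * pi) *\<^sub>R k)"
  unfolding tdist_def by (rule cInf_lower) (use assms in \<open>auto intro: bdd_belowI[of _ 0]\<close>)

text \<open>The integer vectors form a closed set, and the infimum is 2 \<pi> times the distance of
  a point from it, hence a minimum. The later estimates of \<open>tdist\<close> work with such a
  minimiser.\<close>

lemma tdist_attained: "\<exists>k\<in>int_vecs. tdist x y = norm (x - y + (2 * pi) *\<^sub>R k)"
proof -
  let ?a = "(1 / (2 * pi)) *\<^sub>R (y - x)"
  obtain k where k: "k \<in> int_vecs" "\<And>l. l \<in> int_vecs \<Longrightarrow> dist ?a k \<le> dist ?a l"
    using distance_attains_inf[OF closed_int_vecs, of ?a] int_vecs_0 by blast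
  have eq: "norm (x - y + (2 * pi) *\<^sub>R l) = 2 * pi * dist ?a l" for l
  proof -
    have "x - y + (2 * pi) *\<^sub>R l = (2 * pi) *\<^sub>R (l - ?a)" by (simp add: scaleR_diff_right)
    also have "norm \<dots> = 2 * pi * dist ?a l" by (simp only: norm_scaleR dist_norm norm_minus_commute) simp
    finally show ?thesis .
  qed
  have "tdist x y = norm (x - y + (2 * pi) *\<^sub>R k)"
    unfolding tdist_def by (rule cInf_eq_minimum) (use k in \<open>auto simp: eq\<close>)
  then show ?thesis using k(1) by blast
qed

lemma tdist_nonneg [simp]: "0 \<le> tdist x y"
  using tdist_attained[of x y] by auto

lemma tdist_eq_0_iff: "tdist x y = 0 \<longleftrightarrow> tor_eq x y"
proof
  assume "tdist x y = 0"
  then obtain k where "k \<in> int_vecs" "x - y + (2 * pi) *\<^sub>R k = 0" using tdist_attained[of x y] by auto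
  then have "x = y + (2 * pi) *\<^sub>R (- k)" by (simp add: algebra_simps eq_neg_iff_add_eq_0)
  then show "tor_eq x y" using \<open>k \<in> int_vecs\<close> int_vecs_uminus unfolding tor_eq_iff by blast
next
  assume "tor_eq x y"
  then obtain k where "k \<in> int_vecs" "x = y + (2 * pi) *\<^sub>R k" by (auto simp: tor_eq_iff)
  then have "tdist x y \<le> 0" using tdist_le[OF int_vecs_uminus, of k x y] by simp
  then show "tdist x y = 0" using tdist_nonneg[of x y] by linarith
qed

lemma tdist_le_norm: "tdist x y \<le> norm (x - y)"
  using tdist_le[OF int_vecs_0, of x y] by simp

text \<open>A triangle inequality mixing the two metrics: moving either argument in the covering
  space costs at most the Euclidean displacement. Continuity of the torus distance follows from
  it.\<close>

lemma tdist_le_norms: "tdist x y \<le> norm (x - x') + tdist x' y' + norm (y - y')"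
proof -
  obtain k where k: "k \<in> int_vecs" "tdist x' y' = norm (x' - y' + (2 * pi) *\<^sub>R k)"
    using tdist_attained by blast
  have "tdist x y \<le> norm ((x - x') + (x' - y' + (2 * pi) *\<^sub>R k) - (y - y'))"
    using tdist_le[OF k(1), of x y] by (simp add: algebra_simps)
  also have "\<dots> \<le> norm (x - x') + tdist x' y' + norm (y - y')"
    unfolding k(2) by (rule order_trans[OF norm_triangle_ineq4 add_right_mono[OF norm_triangle_ineq]])
  finally show ?thesis .
qed

lemma tdist_cong_le:
  assumes "tor_eq x x'" "tor_eq y y'"
  shows "tdist x y \<le> tdist x' y'"
proof -
  obtain k l m where k: "k \<in> int_vecs" "x = x' + (2 * pi) *\<^sub>R k" and l: "l \<in> int_vecs" "y = y' + (2 * pi) *\<^sub>R l"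
    and m: "m \<in> int_vecs" "tdist x' y' = norm (x' - y' + (2 * pi) *\<^sub>R m)"
    using assms tdist_attained[of x' y'] by (auto simp: tor_eq_iff)
  show ?thesis
    using tdist_le[of "m - k + l" x y] k l m by (simp add: int_vecs_add int_vecs_diff algebra_simps)
qed

lemma tdist_cong: "tor_eq x x' \<Longrightarrow> tor_eq y y' \<Longrightarrow> tdist x y = tdist x' y'"
  by (intro antisym tdist_cong_le) (auto intro: tor_eq_sym)

section \<open>A compact set of representatives\<close>

definition torus_box :: "(real^'d) set" where "torus_box = cbox 0 (\<chi> i. 2 * pi)"

lemma compact_torus_box: "compact torus_box"
  by (simp add: torus_box_def)

lemma torus_box_rep: "\<exists>z\<in>torus_box. tor_eq z x"
proof -
  let ?n = "\<lambda>i. \<lfloor>x $ i / (2 * pi)\<rfloor>"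
  let ?z = "x + (2 * pi) *\<^sub>R (\<chi> i. - of_int (?n i))"
  have z: "?z $ i = x $ i - 2 * pi * ?n i" for i by simp
  have "0 \<le> x $ i - 2 * pi * ?n i \<and> x $ i - 2 * pi * ?n i \<le> 2 * pi" for i
  proof -
    have "?n i \<le> x $ i / (2 * pi)" "x $ i / (2 * pi) \<le> ?n i + 1" by linarith+
    then have "?n i * (2 * pi) \<le> x $ i" "x $ i \<le> (?n i + 1) * (2 * pi)"
      by (simp_all only: pos_le_divide_eq pos_divide_le_eq pi_gt_zero zero_less_mult_iff zero_less_numeral simp_thms)
    then show ?thesis by (simp add: algebra_simps)
  qed
  then have "?z \<in> torus_box" unfolding torus_box_def mem_box_cart z by simp
  moreover have "tor_eq ?z x" by (rule tor_eq_add) (simp add: int_vecs_def)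
  ultimately show ?thesis by blast
qed

text \<open>Lifts a pair so that its torus distance becomes Euclidean. Only the first point is kept
  in the box; the second is its nearest lift and may lie outside.\<close>

lemma tdist_reps:
  obtains x' y' where "x' \<in> torus_box" "tor_eq x x'" "tor_eq y y'" "norm (x' - y') = tdist x y"
proof -
  obtain x' where x': "x' \<in> torus_box" "tor_eq x' x" using torus_box_rep by blast
  obtain k where k: "k \<in> int_vecs" "tdist x' y = norm (x' - y + (2 * pi) *\<^sub>R k)" using tdist_attained by blast
  show thesis
  proof (rule that[OF x'(1)])
    show "tor_eq x x'" by (rule tor_eq_sym) fact
    show "tor_eq y (y + (2 * pi) *\<^sub>R (- k))" by (intro tor_eq_sym[OF tor_eq_add] int_vecs_uminus k)
    show "norm (x' - (y + (2 * pi) *\<^sub>R (- k))) = tdist x y"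
      using k(2) tdist_cong[OF x'(2) tor_eq_refl, of y] by (simp add: algebra_simps)
  qed
qed

lemma tdist_lipschitz:
  assumes "torus_map g" "\<And>x y. norm (g x - g y) \<le> L * norm (x - y)"
  shows "tdist (g x) (g y) \<le> L * tdist x y"
proof -
  obtain x' y' where r: "tor_eq x x'" "tor_eq y y'" "norm (x' - y') = tdist x y"
    using tdist_reps by metis
  have "tdist (g x) (g y) = tdist (g x') (g y')"
    using assms(1) r by (intro tdist_cong) (auto simp: torus_map_def)
  also have "\<dots> \<le> L * tdist x y" using tdist_le_norm assms(2) r(3) order_trans by metis
  finally show ?thesis .
qed

text \<open>A nonzero period moves some coordinate by at least 2 \<pi>, so the shifted difference
  still has norm at least \<pi>.\<close>

lemma tdist_eq_norm:
  assumes "norm (x - y) \<le> pi"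
  shows "tdist x y = norm (x - y)"
proof -
  obtain k where k: "k \<in> int_vecs" "tdist x y = norm (x - y + (2 * pi) *\<^sub>R k)" using tdist_attained by blast
  have "norm (x - y) \<le> norm (x - y + (2 * pi) *\<^sub>R k)"
  proof (cases "k = 0")
    case False
    then obtain i where i: "k $ i \<noteq> 0" by (auto simp: vec_eq_iff)
    have "k $ i \<in> \<int>" using k(1) by (simp add: int_vecs_def)
    then have "1 \<le> \<bar>k $ i\<bar>" using i Ints_nonzero_abs_ge1 by blast
    then have "2 * pi \<le> 2 * pi * \<bar>k $ i\<bar>" by simp
    also have "\<dots> = \<bar>(x - y + (2 * pi) *\<^sub>R k) $ i - (x - y) $ i\<bar>" by (simp add: abs_mult)
    also have "\<dots> \<le> norm (x - y + (2 * pi) *\<^sub>R k) + norm (x - y)"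
      by (rule order_trans[OF abs_triangle_ineq4 add_mono[OF component_le_norm_cart component_le_norm_cart]])
    finally show ?thesis using assms by simp
  qed simp
  then show ?thesis using tdist_le_norm[of x y] k(2) by simp
qed

lemma continuous_on_tdist:
  assumes "continuous_on S f" "continuous_on S g"
  shows "continuous_on S (\<lambda>x. tdist (f x) (g x))"
  unfolding continuous_on_def
proof
  fix x assume x: "x \<in> S"
  have "((\<lambda>y. norm (f y - f x) + norm (g y - g x)) \<longlongrightarrow> norm (f x - f x) + norm (g x - g x)) (at x within S)"
    using assms x by (intro tendsto_intros) (auto simp: continuous_on_def)
  then have "((\<lambda>y. norm (f y - f x) + norm (g y - g x)) \<longlongrightarrow> 0) (at x within S)" by simp
  then have "((\<lambda>y. tdist (f y) (g y) - tdist (f x) (g x)) \<longlongrightarrow> 0) (at x within S)"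
  proof (rule Lim_null_comparison[rotated], intro always_eventually allI)
    fix y
    show "norm (tdist (f y) (g y) - tdist (f x) (g x)) \<le> norm (f y - f x) + norm (g y - g x)"
      using tdist_le_norms[of "f y" "g y" "f x" "g x"] tdist_le_norms[of "f x" "g x" "f y" "g y"]
      by (simp add: norm_minus_commute abs_le_iff)
  qed
  then show "((\<lambda>y. tdist (f y) (g y)) \<longlongrightarrow> tdist (f x) (g x)) (at x within S)"
    by (rule LIM_zero_cancel)
qed

text \<open>Near pairs are controlled by the local expansion, far pairs by compactness: on pairs in
  the box at distance at least \<open>\<delta>1\<close>, injectivity keeps the distance of the
  images away from 0, while the distance of the points is bounded by the size of the box.\<close>

lemma torus_bij_inverse_lipschitz:
  fixes g :: "real^'d \<Rightarrow> real^'d"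
  assumes g: "torus_bij g" and L: "\<And>x y. norm (g x - g y) \<le> L * norm (x - y)"
    and m: "0 < m" "0 < \<delta>" "\<And>x y. norm (x - y) \<le> \<delta> \<Longrightarrow> m * norm (x - y) \<le> norm (g x - g y)"
  shows "\<exists>C\<ge>0. \<forall>x y. tdist x y \<le> C * tdist (g x) (g y)"
proof -
  have gm: "torus_map g" and inj: "\<And>x y. tor_eq (g x) (g y) \<Longrightarrow> tor_eq x y"
    using g by (auto simp: torus_bij_def)
  \<comment> \<open>The second entry keeps the images of a near pair within \<pi>, so that their
    torus distance is the norm to which the expansion applies.\<close>
  define \<delta>1 where "\<delta>1 = min \<delta> (pi / (\<bar>L\<bar> + 1))"
  have \<delta>1: "0 < \<delta>1" "\<delta>1 \<le> \<delta>" using m by (auto simp: \<delta>1_def)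
  have near: "m * tdist x y \<le> tdist (g x) (g y)" if "tdist x y \<le> \<delta>1" for x y
  proof -
    obtain x' y' where r: "tor_eq x x'" "tor_eq y y'" "norm (x' - y') = tdist x y"
      using tdist_reps by metis
    have eq: "tdist (g x) (g y) = tdist (g x') (g y')"
      using gm r by (intro tdist_cong) (auto simp: torus_map_def)
    have "norm (g x' - g y') \<le> \<bar>L\<bar> * norm (x' - y')"
      by (rule order_trans[OF L mult_right_mono[OF abs_ge_self norm_ge_zero]])
    also have "\<dots> \<le> (\<bar>L\<bar> + 1) * (pi / (\<bar>L\<bar> + 1))"
      using that by (intro mult_mono) (auto simp: r(3) \<delta>1_def)
    also have "\<dots> = pi" by simp
    finally have "tdist (g x') (g y') = norm (g x' - g y')" by (rule tdist_eq_norm)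
    then show ?thesis using m(3)[of x' y'] that \<delta>1 eq r(3) by simp
  qed
  define S where "S = {p \<in> torus_box \<times> torus_box. \<delta>1 \<le> tdist (fst p) (snd p :: real^'d)}"
  have "compact S"
  proof -
    have "continuous_on UNIV (\<lambda>p. tdist (fst p) (snd p :: real^'d))"
      by (intro continuous_on_tdist continuous_intros)
    then have "closed {p. \<delta>1 \<le> tdist (fst p) (snd p :: real^'d)}"
      by (intro closed_Collect_le continuous_intros)
    then have "compact ((torus_box \<times> torus_box) \<inter> {p. \<delta>1 \<le> tdist (fst p) (snd p :: real^'d)})"
      by (intro compact_Int_closed compact_Times compact_torus_box)
    then show ?thesis by (simp add: S_def Int_def)
  qed
  have contg: "continuous_on UNIV g"
    by (rule lipschitz_on_continuous_on[of "\<bar>L\<bar>"])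
      (simp add: lipschitz_on_def dist_norm order_trans[OF L mult_right_mono[OF abs_ge_self norm_ge_zero]])
  have "continuous_on S (\<lambda>p. tdist (g (fst p)) (g (snd p)))"
    by (intro continuous_on_tdist continuous_on_compose2[OF contg]) (auto intro!: continuous_intros)
  then have "\<exists>\<mu>>0. \<forall>p\<in>S. \<mu> \<le> tdist (g (fst p)) (g (snd p))"
  proof (cases "S = {}")
    case False
    assume "continuous_on S (\<lambda>p. tdist (g (fst p)) (g (snd p)))"
    from continuous_attains_inf[OF \<open>compact S\<close> False this] obtain p where p: "p \<in> S"
      "\<And>q. q \<in> S \<Longrightarrow> tdist (g (fst p)) (g (snd p)) \<le> tdist (g (fst q)) (g (snd q))" by blast
    have "\<not> tor_eq (fst p) (snd p)"
      using p(1) \<delta>1 by (auto simp: S_def simp flip: tdist_eq_0_iff)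
    then have "0 < tdist (g (fst p)) (g (snd p))"
      using inj tdist_eq_0_iff tdist_nonneg by (metis less_eq_real_def)
    with p show ?thesis by blast
  qed (auto intro: exI[of _ 1])
  then obtain \<mu> where \<mu>: "0 < \<mu>" "\<And>p. p \<in> S \<Longrightarrow> \<mu> \<le> tdist (g (fst p)) (g (snd p))" by blast
  obtain D where D: "\<And>x :: real^'d. x \<in> torus_box \<Longrightarrow> norm x \<le> D"
    using compact_imp_bounded[OF compact_torus_box] by (auto simp: bounded_iff)
  have far: "tdist x y \<le> (2 * D / \<mu>) * tdist (g x) (g y)" if "\<delta>1 \<le> tdist x y" for x y
  proof -
    obtain x' where x': "x' \<in> torus_box" "tor_eq x' x" using torus_box_rep by blast
    obtain y' where y': "y' \<in> torus_box" "tor_eq y' y" using torus_box_rep by blast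
    have eq: "tdist x' y' = tdist x y" using x' y' by (intro tdist_cong)
    have eqg: "tdist (g x') (g y') = tdist (g x) (g y)"
      using gm x' y' by (intro tdist_cong) (auto simp: torus_map_def)
    have "\<mu> \<le> tdist (g x') (g y')" using \<mu>(2)[of "(x', y')"] x' y' that eq by (simp add: S_def)
    moreover have "tdist x' y' \<le> 2 * D"
      using tdist_le_norm[of x' y'] norm_triangle_ineq4[of x' y'] D[OF x'(1)] D[OF y'(1)] by linarith
    moreover have "0 \<le> D" using D[OF x'(1)] norm_ge_zero order_trans by blast
    ultimately have "tdist x' y' * \<mu> \<le> (2 * D) * tdist (g x') (g y')"
      using \<mu> by (intro mult_mono) auto
    then show ?thesis using \<mu> by (simp add: eq eqg field_simps)
  qed
  show ?thesis
  proof (intro exI[of _ "max (1 / m) (2 * D / \<mu>)"] conjI allI)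
    show "0 \<le> max (1 / m) (2 * D / \<mu>)" using m by (simp add: le_max_iff_disj)
    fix x y :: "real^'d"
    consider "tdist x y \<le> \<delta>1" | "\<delta>1 \<le> tdist x y" by linarith
    then have "tdist x y \<le> (1 / m) * tdist (g x) (g y) \<or> tdist x y \<le> (2 * D / \<mu>) * tdist (g x) (g y)"
      by cases (use near[of x y] far[of x y] m in \<open>auto simp: field_simps\<close>)
    then show "tdist x y \<le> max (1 / m) (2 * D / \<mu>) * tdist (g x) (g y)"
      by (elim disjE order_trans) (intro mult_right_mono; simp)+
  qed
qed

text \<open>By periodicity, the minimum m of the norm of \<open>g' x w\<close> over box points and
  unit vectors is a lower bound everywhere. On short segments the derivative varies by at most m /
  2, and the mean value inequality leaves the other half as expansion rate.\<close>

lemma torus_local_expansion: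
  fixes g :: "real^'d \<Rightarrow> real^'d"
  assumes g: "\<And>x. (g has_derivative g' x) (at x)" and inj: "\<And>x w. g' x w = 0 \<Longrightarrow> w = 0"
    and K: "\<And>x y w. norm (g' x w - g' y w) \<le> K * norm (x - y) * norm w"
    and per: "on_torus g'"
  shows "\<exists>m>0. \<exists>\<delta>>0. \<forall>x y. norm (x - y) \<le> \<delta> \<longrightarrow> m * norm (x - y) \<le> norm (g x - g y)"
proof -
  have lin: "linear (g' x)" for x using g has_derivative_linear by blast
  have K0: "0 \<le> K"
  proof -
    obtain b :: "real^'d" where b: "norm b = 1" using vector_choose_size[of 1] by auto
    show ?thesis using order_trans[OF norm_ge_zero K[of b b 0]] b by simp
  qed
  let ?S = "(torus_box :: (real^'d) set) \<times> sphere (0 :: real^'d) 1"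
  have S: "compact ?S" by (intro compact_Times compact_torus_box compact_sphere)
  obtain z0 :: "real^'d" where z0: "z0 \<in> torus_box" using torus_box_rep by blast
  obtain b :: "real^'d" where b: "norm b = 1" using vector_choose_size[of 1] by auto
  have "?S \<noteq> {}" using z0 b by auto
  have "continuous_on ?S (\<lambda>p. norm (g' (fst p) (snd p)))"
  proof (rule continuous_on_norm, unfold continuous_on_def, safe)
    fix x w
    have bl: "bounded_linear (g' x)" using g has_derivative_bounded_linear by blast
    have "((\<lambda>p. g' (fst p) (snd p) - g' x (snd p)) \<longlongrightarrow> 0) (at (x, w) within ?S)"
    proof (rule Lim_null_comparison, intro always_eventually allI)
      show "norm (g' (fst p) (snd p) - g' x (snd p)) \<le> K * norm (fst p - x) * norm (snd p)" for p
        by (rule K)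
      have "((\<lambda>p. K * norm (fst p - x) * norm (snd p)) \<longlongrightarrow> K * norm (fst (x, w) - x) * norm (snd (x, w))) (at (x, w) within ?S)"
        by (intro tendsto_intros)
      then show "((\<lambda>p. K * norm (fst p - x) * norm (snd p)) \<longlongrightarrow> 0) (at (x, w) within ?S)" by simp
    qed
    moreover have "((\<lambda>p. g' x (snd p)) \<longlongrightarrow> g' x (snd (x, w))) (at (x, w) within ?S)"
      by (intro bounded_linear.tendsto[OF bl] tendsto_intros)
    ultimately have "((\<lambda>p. g' (fst p) (snd p) - g' x (snd p) + g' x (snd p)) \<longlongrightarrow> 0 + g' x w) (at (x, w) within ?S)"
      by (intro tendsto_add) auto
    then show "((\<lambda>p. g' (fst p) (snd p)) \<longlongrightarrow> g' (fst (x, w)) (snd (x, w))) (at (x, w) within ?S)" by simp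
  qed
  from continuous_attains_inf[OF S \<open>?S \<noteq> {}\<close> this] obtain p where p: "p \<in> ?S"
    "\<And>q. q \<in> ?S \<Longrightarrow> norm (g' (fst p) (snd p)) \<le> norm (g' (fst q) (snd q))" by blast
  define m where "m = norm (g' (fst p) (snd p))"
  have m: "0 < m" using p(1) inj[of "fst p" "snd p"] by (auto simp: m_def)
  have low: "m * norm w \<le> norm (g' x w)" for x w
  proof (cases "w = 0")
    case True then show ?thesis using linear_0[OF lin] by simp
  next
    case False
    obtain x' where x': "x' \<in> torus_box" "tor_eq x' x" using torus_box_rep by blast
    have "m \<le> norm (g' x' ((1 / norm w) *\<^sub>R w))"
      using p(2)[of "(x', (1 / norm w) *\<^sub>R w)"] x' False by (simp add: m_def)
    also have "\<dots> = norm (g' x w) / norm w" using per x'(2) by (simp add: on_torus_def linear_scale[OF lin])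
    finally show ?thesis using False by (simp add: field_simps)
  qed
  \<comment> \<open>Chosen so that (K + 1) \<delta> = m / 2; here K + 1 replaces K to keep the
    denominator positive.\<close>
  define \<delta> where "\<delta> = m / (2 * (K + 1))"
  have \<delta>: "0 < \<delta>" using m K0 by (simp add: \<delta>_def)
  have "(m / 2) * norm (x - y) \<le> norm (g x - g y)" if xy: "norm (x - y) \<le> \<delta>" for x y
  proof -
    have "norm (g x - g y - g' y (x - y)) \<le> norm (x - y) * (K * norm (x - y))"
    proof (rule differentiable_bound_linearization[where S = "closed_segment y x" and f = g and f' = g'])
      show "y + t *\<^sub>R (x - y) \<in> closed_segment y x" if "t \<in> {0..1}" for t
        using that by (auto simp: in_segment algebra_simps intro: exI[of _ t])
      show "(g has_derivative g' z) (at z within closed_segment y x)" for z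
        using g by (rule has_derivative_at_withinI)
      show "onorm (g' z - g' y) \<le> K * norm (x - y)" if z: "z \<in> closed_segment y x" for z
      proof (rule onorm_bound)
        fix w
        have "norm ((g' z - g' y) w) \<le> K * norm (z - y) * norm w" using K[of z w y] by simp
        also have "\<dots> \<le> K * norm (x - y) * norm w"
          using segment_bound(1)[OF z] K0 by (intro mult_right_mono mult_left_mono) auto
        finally show "norm ((g' z - g' y) w) \<le> K * norm (x - y) * norm w" .
      qed (use K0 in simp)
    qed auto
    also have "\<dots> \<le> norm (x - y) * (m / 2)"
    proof (rule mult_left_mono)
      have "K * norm (x - y) \<le> (K + 1) * \<delta>" using xy K0 by (intro mult_mono) auto
      also have "(K + 1) * \<delta> = m / 2" using K0 by (simp add: \<delta>_def field_simps)
      finally show "K * norm (x - y) \<le> m / 2" .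
    qed simp
    finally have "norm (g' y (x - y)) \<le> norm (g x - g y) + norm (x - y) * (m / 2)"
      using norm_triangle_ineq4[of "g x - g y" "g x - g y - g' y (x - y)"] by simp
    with low[of "x - y" y] show ?thesis by (simp add: mult.commute)
  qed
  with m \<delta> show ?thesis by (intro exI[of _ "m / 2"] conjI exI[of _ \<delta>]) auto
qed

section \<open>Derivatives of multivariate power series\<close>

text \<open>Not restricted to real arguments, because the same monomial is evaluated both at points
  of R^d and at tuples of elements of \<open>wiener\<close>.\<close>

definition pmon :: "('d::finite \<Rightarrow> nat) \<Rightarrow> ('d \<Rightarrow> 'w) \<Rightarrow> 'w::comm_monoid_mult" where
  "pmon \<alpha> X = (\<Prod>i\<in>UNIV. X i ^ \<alpha> i)"

definition deg :: "('d::finite \<Rightarrow> nat) \<Rightarrow> nat" where "deg \<alpha> = (\<Sum>i\<in>UNIV. \<alpha> i)"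

text \<open>Exponent that remains after differentiating in direction \<open>l\<close>. At \<alpha> l
  = 0 the truncated subtraction does no harm, as the accompanying factor \<alpha> l
  vanishes.\<close>

definition dec :: "'d \<Rightarrow> ('d \<Rightarrow> nat) \<Rightarrow> 'd \<Rightarrow> nat" where "dec l \<alpha> = \<alpha>(l := \<alpha> l - 1)"

lemma le_deg: "\<alpha> l \<le> deg \<alpha>"
  unfolding deg_def by (rule member_le_sum) auto

lemma deg_dec: "0 < \<alpha> l \<Longrightarrow> Suc (deg (dec l \<alpha>)) = deg \<alpha>"
proof -
  assume a: "0 < \<alpha> l"
  have "deg \<alpha> = \<alpha> l + (\<Sum>i\<in>UNIV - {l}. \<alpha> i)" unfolding deg_def by (rule sum.remove) auto
  moreover have "deg (dec l \<alpha>) = dec l \<alpha> l + (\<Sum>i\<in>UNIV - {l}. dec l \<alpha> i)"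
    unfolding deg_def by (rule sum.remove) auto
  ultimately show ?thesis using a by (simp add: dec_def)
qed

lemma pmon_dec:
  fixes X :: "'d::finite \<Rightarrow> 'w::comm_monoid_mult"
  shows "pmon (dec l \<alpha>) X = X l ^ (\<alpha> l - 1) * (\<Prod>i\<in>UNIV - {l}. X i ^ \<alpha> i)"
proof -
  have "pmon (dec l \<alpha>) X = X l ^ dec l \<alpha> l * (\<Prod>i\<in>UNIV - {l}. X i ^ dec l \<alpha> i)"
    unfolding pmon_def by (rule prod.remove) auto
  also have "(\<Prod>i\<in>UNIV - {l}. X i ^ dec l \<alpha> i) = (\<Prod>i\<in>UNIV - {l}. X i ^ \<alpha> i)"
    by (rule prod.cong) (auto simp: dec_def)
  also have "dec l \<alpha> l = \<alpha> l - 1" by (simp add: dec_def)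
  finally show ?thesis .
qed

lemma pmon_scaleR:
  fixes X :: "'d::finite \<Rightarrow> 'w::{real_algebra_1, comm_ring_1}"
  shows "pmon \<alpha> (\<lambda>i. t *\<^sub>R X i) = t ^ deg \<alpha> *\<^sub>R pmon \<alpha> X"
proof -
  have "(\<Prod>i\<in>I. (t *\<^sub>R X i) ^ \<alpha> i) = t ^ (\<Sum>i\<in>I. \<alpha> i) *\<^sub>R (\<Prod>i\<in>I. X i ^ \<alpha> i)" if "finite I" for I
    using that by induction (simp_all add: power_mult_distrib power_add scaleR_conv_of_real mult_ac)
  then show ?thesis by (simp add: pmon_def deg_def)
qed

lemma norm_pmon_le_1:
  fixes X :: "'d::finite \<Rightarrow> 'w::{real_normed_algebra_1, comm_ring_1}"
  assumes "\<And>i. norm (X i) \<le> 1"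
  shows "norm (pmon \<alpha> X) \<le> 1"
proof -
  have p: "norm (X i ^ n) \<le> 1" for i n
    using assms norm_power_ineq[of "X i" n] power_le_one[of "norm (X i)" n] by (meson norm_ge_zero order_trans)
  have "norm (\<Prod>i\<in>I. X i ^ \<alpha> i) \<le> 1" if "finite I" for I
    using that
  proof induction
    case (insert i I)
    have "norm (X i ^ \<alpha> i * (\<Prod>i\<in>I. X i ^ \<alpha> i)) \<le> 1 * 1"
      using p insert by (intro order_trans[OF norm_mult_ineq] mult_mono) auto
    then show ?case using insert by simp
  qed simp
  then show ?thesis by (simp add: pmon_def)
qed

lemma norm_pmon_diff_le_1:
  fixes X Y :: "'d::finite \<Rightarrow> 'w::{real_normed_algebra_1, comm_ring_1}"
  assumes "\<And>i. norm (X i) \<le> 1" "\<And>i. norm (Y i) \<le> 1"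
  shows "norm (pmon \<alpha> X - pmon \<alpha> Y) \<le> deg \<alpha> * (\<Sum>i\<in>UNIV. norm (X i - Y i))"
proof -
  have p: "norm (Z ^ n) \<le> 1" if "norm Z \<le> 1" for Z :: 'w and n
    using that norm_power_ineq[of Z n] power_le_one[of "norm Z" n] by (meson norm_ge_zero order_trans)
  have "norm (pmon \<alpha> X - pmon \<alpha> Y) \<le> (\<Sum>i\<in>UNIV. norm (X i ^ \<alpha> i - Y i ^ \<alpha> i))"
    unfolding pmon_def by (rule norm_prod_diff) (auto intro: p assms)
  also have "\<dots> \<le> (\<Sum>i\<in>UNIV. deg \<alpha> * norm (X i - Y i))"
  proof (rule sum_mono)
    fix i
    have "norm (X i ^ \<alpha> i - Y i ^ \<alpha> i) \<le> \<alpha> i * norm (X i - Y i)" by (intro norm_power_diff assms)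
    also have "\<dots> \<le> deg \<alpha> * norm (X i - Y i)" by (intro mult_right_mono) (auto simp: le_deg)
    finally show "norm (X i ^ \<alpha> i - Y i ^ \<alpha> i) \<le> deg \<alpha> * norm (X i - Y i)" .
  qed
  finally show ?thesis by (simp add: sum_distrib_left)
qed

text \<open>Differentiation contributes the factor \<alpha> l and the Lipschitz estimate a further
  degree factor. With n the remaining degree, each is at most 2^(n+1), and passing from radius s to
  s / 4 absorbs the product 4^(n+1) up to a constant.\<close>

lemma dec_coeff_bound:
  assumes "0 < s"
  shows "real (\<alpha> l) * (1 + real (deg (dec l \<alpha>))) * (s / 4) ^ deg (dec l \<alpha>) \<le> (4 / s) * s ^ deg \<alpha>"
proof (cases "\<alpha> l = 0")
  case False
  let ?n = "deg (dec l \<alpha>)"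
  have n: "deg \<alpha> = Suc ?n" using deg_dec[of \<alpha> l] False by simp
  have "real (\<alpha> l) \<le> 2 ^ Suc ?n" "1 + real ?n \<le> 2 ^ Suc ?n"
  proof -
    have "\<alpha> l \<le> 2 ^ Suc ?n" using le_deg[of \<alpha> l] less_exp[of "deg \<alpha>"] n by simp
    then show "real (\<alpha> l) \<le> 2 ^ Suc ?n" by (metis of_nat_le_iff of_nat_numeral of_nat_power)
    have "Suc ?n \<le> 2 ^ Suc ?n" using less_exp[of "Suc ?n"] by linarith
    then show "1 + real ?n \<le> 2 ^ Suc ?n" by (metis of_nat_Suc of_nat_le_iff of_nat_numeral of_nat_power)
  qed
  then have "real (\<alpha> l) * (1 + real ?n) \<le> 2 ^ Suc ?n * 2 ^ Suc ?n" by (intro mult_mono) auto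
  also have "\<dots> = 4 ^ Suc ?n" by (simp flip: power_mult_distrib)
  finally have "real (\<alpha> l) * (1 + real ?n) * (s / 4) ^ ?n \<le> 4 ^ Suc ?n * (s / 4) ^ ?n"
    using assms by (intro mult_right_mono) auto
  also have "\<dots> = (4 / s) * s ^ deg \<alpha>" using assms by (simp add: n power_divide)
  finally show ?thesis .
qed (use assms in simp)

text \<open>Summable majorants for the differentiated series and for its variation. Dividing the
  arguments by s / 4 reduces both to monomials on the unit ball.\<close>

lemma dmon_bounds:
  fixes X Y :: "'d::finite \<Rightarrow> 'w::{real_normed_algebra_1, comm_ring_1}" and c :: real
  assumes s: "0 < s" and X: "\<And>i. norm (X i) \<le> s / 4"
  shows "norm ((c * real (\<alpha> l)) *\<^sub>R pmon (dec l \<alpha>) X) \<le> (4 / s) * (\<bar>c\<bar> * s ^ deg \<alpha>)"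
    and "(\<And>i. norm (Y i) \<le> s / 4) \<Longrightarrow>
      norm ((c * real (\<alpha> l)) *\<^sub>R pmon (dec l \<alpha>) X - (c * real (\<alpha> l)) *\<^sub>R pmon (dec l \<alpha>) Y)
        \<le> (4 / s) * (4 / s) * (\<bar>c\<bar> * s ^ deg \<alpha>) * (\<Sum>i\<in>UNIV. norm (X i - Y i))"
proof -
  define t where "t = s / 4"
  have t: "0 < t" using s by (simp add: t_def)
  let ?n = "deg (dec l \<alpha>)"
  have key: "real (\<alpha> l) * (1 + real ?n) * t ^ ?n \<le> (4 / s) * s ^ deg \<alpha>"
    unfolding t_def by (rule dec_coeff_bound[OF s])
  have sc: "pmon (dec l \<alpha>) Z = t ^ ?n *\<^sub>R pmon (dec l \<alpha>) (\<lambda>i. (1 / t) *\<^sub>R Z i)" for Z :: "'d \<Rightarrow> 'w"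
    using t pmon_scaleR[of "dec l \<alpha>" t "\<lambda>i. (1 / t) *\<^sub>R Z i"] by simp
  have le1: "norm ((1 / t) *\<^sub>R Z i) \<le> 1" if "\<And>i. norm (Z i) \<le> s / 4" for Z :: "'d \<Rightarrow> 'w" and i
    using that[of i] t by (simp add: t_def field_simps)
  have "norm ((c * real (\<alpha> l)) *\<^sub>R pmon (dec l \<alpha>) X)
      = \<bar>c\<bar> * (real (\<alpha> l) * t ^ ?n) * norm (pmon (dec l \<alpha>) (\<lambda>i. (1 / t) *\<^sub>R X i))"
    using t by (subst sc) (simp add: abs_mult)
  also have "\<dots> \<le> \<bar>c\<bar> * (real (\<alpha> l) * t ^ ?n) * 1"
    using t by (intro mult_left_mono norm_pmon_le_1 le1 X) auto
  also have "\<dots> \<le> \<bar>c\<bar> * (real (\<alpha> l) * (1 + real ?n) * t ^ ?n)"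
    using t by (simp add: algebra_simps mult_left_mono)
  also have "\<dots> \<le> \<bar>c\<bar> * ((4 / s) * s ^ deg \<alpha>)" by (intro mult_left_mono key) auto
  finally show "norm ((c * real (\<alpha> l)) *\<^sub>R pmon (dec l \<alpha>) X) \<le> (4 / s) * (\<bar>c\<bar> * s ^ deg \<alpha>)"
    by (simp add: mult_ac)
  assume Y: "\<And>i. norm (Y i) \<le> s / 4"
  let ?S = "\<Sum>i\<in>UNIV. norm (X i - Y i)"
  have S: "0 \<le> ?S" by (intro sum_nonneg) auto
  have "norm ((c * real (\<alpha> l)) *\<^sub>R pmon (dec l \<alpha>) X - (c * real (\<alpha> l)) *\<^sub>R pmon (dec l \<alpha>) Y)
      = \<bar>c\<bar> * (real (\<alpha> l) * t ^ ?n) * norm (pmon (dec l \<alpha>) (\<lambda>i. (1 / t) *\<^sub>R X i) - pmon (dec l \<alpha>) (\<lambda>i. (1 / t) *\<^sub>R Y i))"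
    using t unfolding sc[of X] sc[of Y] by (simp add: abs_mult flip: scaleR_diff_right)
  also have "\<dots> \<le> \<bar>c\<bar> * (real (\<alpha> l) * t ^ ?n) * (?n * (\<Sum>i\<in>UNIV. norm ((1 / t) *\<^sub>R X i - (1 / t) *\<^sub>R Y i)))"
    using t by (intro mult_left_mono norm_pmon_diff_le_1 le1 X Y) auto
  also have "(\<Sum>i\<in>UNIV. norm ((1 / t) *\<^sub>R X i - (1 / t) *\<^sub>R Y i)) = (4 / s) * ?S"
    using s by (simp add: t_def sum_distrib_left flip: scaleR_diff_right)
  also have "\<bar>c\<bar> * (real (\<alpha> l) * t ^ ?n) * (?n * ((4 / s) * ?S)) = (\<bar>c\<bar> * ((4 / s) * ?S)) * (real (\<alpha> l) * ?n * t ^ ?n)"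
    by (simp add: mult_ac)
  also have "\<dots> \<le> (\<bar>c\<bar> * ((4 / s) * ?S)) * (real (\<alpha> l) * (1 + real ?n) * t ^ ?n)"
    using t s S by (intro mult_left_mono mult_right_mono) auto
  also have "\<dots> \<le> (\<bar>c\<bar> * ((4 / s) * ?S)) * ((4 / s) * s ^ deg \<alpha>)"
    using s S by (intro mult_left_mono key) auto
  finally show "norm ((c * real (\<alpha> l)) *\<^sub>R pmon (dec l \<alpha>) X - (c * real (\<alpha> l)) *\<^sub>R pmon (dec l \<alpha>) Y)
        \<le> (4 / s) * (4 / s) * (\<bar>c\<bar> * s ^ deg \<alpha>) * ?S" by (simp add: mult_ac)
qed

lemma has_derivative_pmon:
  fixes x0 :: "real^'d"
  shows "((\<lambda>y. pmon \<alpha> (\<lambda>i. y $ i - x0 $ i)) has_derivative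
    (\<lambda>h. \<Sum>l\<in>UNIV. h $ l * (real (\<alpha> l) * pmon (dec l \<alpha>) (\<lambda>i. y $ i - x0 $ i)))) (at y within S)"
proof -
  have "((\<lambda>y. y $ i - x0 $ i) has_derivative (\<lambda>h. h $ i)) (at y within S)" for i
    by (rule derivative_eq_intros bounded_linear_imp_has_derivative bounded_linear_vec_nth | simp)+
  then have "((\<lambda>y. (y $ i - x0 $ i) ^ n) has_derivative (\<lambda>h. real n * (h $ i * (y $ i - x0 $ i) ^ (n - 1)))) (at y within S)" for i n
    by (rule has_derivative_eq_rhs[OF has_derivative_power]) (auto simp: fun_eq_iff)
  then have "((\<lambda>y. \<Prod>i\<in>UNIV. (y $ i - x0 $ i) ^ \<alpha> i) has_derivative
    (\<lambda>h. \<Sum>i\<in>UNIV. (real (\<alpha> i) * (h $ i * (y $ i - x0 $ i) ^ (\<alpha> i - 1))) * (\<Prod>j\<in>UNIV - {i}. (y $ j - x0 $ j) ^ \<alpha> j))) (at y within S)"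
    by (rule has_derivative_prod)
  then show ?thesis by (simp add: pmon_def[of \<alpha>] pmon_dec mult_ac)
qed

text \<open>\<open>has_sum\<close> is a limit along finite sets, whereas
  \<open>has_derivative_sequence\<close> asks for a sequence of functions; an enumeration of the
  multi-indices supplies finite sets exhausting them.\<close>

lemma filterlim_to_nat_less:
  "filterlim (\<lambda>n. {a :: 'a::countable. to_nat a < n}) (finite_subsets_at_top UNIV) sequentially"
  unfolding filterlim_finite_subsets_at_top
proof safe
  fix X :: "'a set" assume X: "finite X"
  have fin: "finite {a :: 'a. to_nat a < n}" for n
    using finite_vimageI[OF finite_lessThan[of n] inj_to_nat] by (simp add: vimage_def)
  have "X \<subseteq> {a. to_nat a < n}" if "Suc (Max (insert 0 (to_nat ` X))) \<le> n" for n
  proof safe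
    fix a assume "a \<in> X"
    then have "to_nat a \<le> Max (insert 0 (to_nat ` X))" using X by (intro Max_ge) auto
    with that show "to_nat a < n" by linarith
  qed
  then show "\<forall>\<^sub>F n in sequentially. finite {a :: 'a. to_nat a < n} \<and> X \<subseteq> {a. to_nat a < n} \<and> {a. to_nat a < n} \<subseteq> UNIV"
    unfolding eventually_sequentially using fin by blast
qed

text \<open>Termwise differentiation: the differentiated series converges uniformly by the majorants
  of \<open>dmon_bounds\<close>.\<close>

lemma has_derivative_power_series:
  fixes f :: "real^'d \<Rightarrow> real" and c :: "('d \<Rightarrow> nat) \<Rightarrow> real"
  assumes s: "0 < s" and summ: "(\<lambda>\<alpha>. \<bar>c \<alpha>\<bar> * s ^ deg \<alpha>) summable_on UNIV"
    and f: "\<And>y. (\<And>i. \<bar>y $ i - x0 $ i\<bar> < s / 4) \<Longrightarrow>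
      ((\<lambda>\<alpha>. c \<alpha> * pmon \<alpha> (\<lambda>i. y $ i - x0 $ i)) has_sum f y) UNIV"
    and x: "\<And>i. \<bar>x $ i - x0 $ i\<bar> < s / 4"
  shows "(f has_derivative (\<lambda>h. \<Sum>l\<in>UNIV. h $ l *
    (\<Sum>\<^sub>\<infinity>\<alpha>. (c \<alpha> * real (\<alpha> l)) *\<^sub>R pmon (dec l \<alpha>) (\<lambda>i. x $ i - x0 $ i)))) (at x)"
proof -
  \<comment> \<open>The hypotheses are coordinatewise, so the domain is a cube: convex for
    \<open>has_derivative_sequence\<close>, and open so that the derivative within it is the
    derivative at \<open>x\<close>.\<close>
  define S where "S = {y :: real^'d. \<forall>i. \<bar>y $ i - x0 $ i\<bar> < s / 4}"
  define T where "T l \<alpha> y = (c \<alpha> * real (\<alpha> l)) *\<^sub>R pmon (dec l \<alpha>) (\<lambda>i. y $ i - x0 $ i)" for l \<alpha> and y :: "real^'d"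
  define Fn where "Fn n = {\<alpha> :: 'd \<Rightarrow> nat. to_nat \<alpha> < n}" for n
  have Fn: "filterlim Fn (finite_subsets_at_top UNIV) sequentially"
    unfolding Fn_def[abs_def] by (rule filterlim_to_nat_less)
  have S_eq: "S = box (\<chi> i. x0 $ i - s / 4) (\<chi> i. x0 $ i + s / 4)"
  proof -
    have "\<bar>u - v\<bar> < s / 4 \<longleftrightarrow> v - s / 4 < u \<and> u < v + s / 4" for u v :: real by linarith
    then show ?thesis unfolding S_def by (simp add: set_eq_iff mem_box_cart)
  qed
  have S: "convex S" "open S" unfolding S_eq by (auto intro: convex_box open_box)
  have unif: "uniform_limit S (\<lambda>A y. \<Sum>\<alpha>\<in>A. T l \<alpha> y) (\<lambda>y. \<Sum>\<^sub>\<infinity>\<alpha>. T l \<alpha> y) (finite_subsets_at_top UNIV)" for l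
  proof (rule Weierstrass_m_test_general)
    show "norm (T l \<alpha> y) \<le> (4 / s) * (\<bar>c \<alpha>\<bar> * s ^ deg \<alpha>)" if "y \<in> S" for \<alpha> y
      unfolding T_def using that by (intro dmon_bounds(1)[OF s]) (auto simp: S_def less_imp_le)
    show "(\<lambda>\<alpha>. (4 / s) * (\<bar>c \<alpha>\<bar> * s ^ deg \<alpha>)) summable_on UNIV"
      by (rule summable_on_cmult_right[OF summ])
  qed
  have "\<exists>g. \<forall>x\<in>S. (\<lambda>n. \<Sum>\<alpha>\<in>Fn n. c \<alpha> * pmon \<alpha> (\<lambda>i. x $ i - x0 $ i)) \<longlonglongrightarrow> g x \<and>
    (g has_derivative (\<lambda>h. \<Sum>l\<in>UNIV. h $ l * (\<Sum>\<^sub>\<infinity>\<alpha>. T l \<alpha> x))) (at x within S)"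
  proof (rule has_derivative_sequence[OF S(1)])
    fix n and y :: "real^'d" assume "y \<in> S"
    have "((\<lambda>y. \<Sum>\<alpha>\<in>Fn n. c \<alpha> * pmon \<alpha> (\<lambda>i. y $ i - x0 $ i)) has_derivative
      (\<lambda>h. \<Sum>\<alpha>\<in>Fn n. c \<alpha> * (\<Sum>l\<in>UNIV. h $ l * (real (\<alpha> l) * pmon (dec l \<alpha>) (\<lambda>i. y $ i - x0 $ i))))) (at y within S)"
      by (intro has_derivative_sum has_derivative_mult_right has_derivative_pmon)
    moreover have "(\<Sum>\<alpha>\<in>Fn n. c \<alpha> * (\<Sum>l\<in>UNIV. h $ l * (real (\<alpha> l) * pmon (dec l \<alpha>) (\<lambda>i. y $ i - x0 $ i))))
      = (\<Sum>l\<in>UNIV. h $ l * (\<Sum>\<alpha>\<in>Fn n. T l \<alpha> y))" for h :: "real^'d"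
      unfolding sum_distrib_left by (subst sum.swap) (simp add: T_def mult_ac)
    ultimately show "((\<lambda>y. \<Sum>\<alpha>\<in>Fn n. c \<alpha> * pmon \<alpha> (\<lambda>i. y $ i - x0 $ i)) has_derivative
      (\<lambda>h. \<Sum>l\<in>UNIV. h $ l * (\<Sum>\<alpha>\<in>Fn n. T l \<alpha> y))) (at y within S)" by simp
  next
    fix e :: real assume e: "e > 0"
    \<comment> \<open>Each component of a direction h is at most its norm, so every one of the
      CARD('d) partial derivatives gets an equal share of e.\<close>
    let ?e = "e / real CARD('d)"
    have "\<forall>\<^sub>F n in sequentially. \<forall>y\<in>S. dist (\<Sum>\<alpha>\<in>Fn n. T l \<alpha> y) (\<Sum>\<^sub>\<infinity>\<alpha>. T l \<alpha> y) < ?e" for l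
      using filterlim_compose[OF unif Fn, THEN uniform_limitD, of ?e l] e by (simp add: o_def)
    then have "\<forall>\<^sub>F n in sequentially. \<forall>l\<in>UNIV. \<forall>y\<in>S. dist (\<Sum>\<alpha>\<in>Fn n. T l \<alpha> y) (\<Sum>\<^sub>\<infinity>\<alpha>. T l \<alpha> y) < ?e"
      by (intro eventually_ball_finite) auto
    then show "\<forall>\<^sub>F n in sequentially. \<forall>x\<in>S. \<forall>h. norm ((\<Sum>l\<in>UNIV. h $ l * (\<Sum>\<alpha>\<in>Fn n. T l \<alpha> x))
      - (\<Sum>l\<in>UNIV. h $ l * (\<Sum>\<^sub>\<infinity>\<alpha>. T l \<alpha> x))) \<le> e * norm h"
    proof (rule eventually_mono, safe)
      fix n y and h :: "real^'d"
      assume *: "\<forall>l\<in>UNIV. \<forall>y\<in>S. dist (\<Sum>\<alpha>\<in>Fn n. T l \<alpha> y) (\<Sum>\<^sub>\<infinity>\<alpha>. T l \<alpha> y) < ?e" and y: "y \<in> S"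
      have "norm (\<Sum>l\<in>UNIV. h $ l * ((\<Sum>\<alpha>\<in>Fn n. T l \<alpha> y) - (\<Sum>\<^sub>\<infinity>\<alpha>. T l \<alpha> y))) \<le> real CARD('d) * (norm h * ?e)"
        unfolding norm_mult by (intro norm_sum_UNIV_le order_trans[OF norm_mult_ineq] mult_mono)
          (use * y component_le_norm_cart[of h] in \<open>auto simp: dist_real_def less_imp_le\<close>)
      then show "norm ((\<Sum>l\<in>UNIV. h $ l * (\<Sum>\<alpha>\<in>Fn n. T l \<alpha> y)) - (\<Sum>l\<in>UNIV. h $ l * (\<Sum>\<^sub>\<infinity>\<alpha>. T l \<alpha> y))) \<le> e * norm h"
        by (simp add: right_diff_distrib sum_subtractf mult.commute)
    qed
  next
    show "x \<in> S" using x by (simp add: S_def)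
    show "(\<lambda>n. \<Sum>\<alpha>\<in>Fn n. c \<alpha> * pmon \<alpha> (\<lambda>i. x $ i - x0 $ i)) \<longlonglongrightarrow> f x"
      using filterlim_compose[OF f[OF x, unfolded has_sum_def] Fn] by (simp add: o_def)
  qed
  then obtain g where g: "\<And>y. y \<in> S \<Longrightarrow> (\<lambda>n. \<Sum>\<alpha>\<in>Fn n. c \<alpha> * pmon \<alpha> (\<lambda>i. y $ i - x0 $ i)) \<longlonglongrightarrow> g y"
    "\<And>y. y \<in> S \<Longrightarrow> (g has_derivative (\<lambda>h. \<Sum>l\<in>UNIV. h $ l * (\<Sum>\<^sub>\<infinity>\<alpha>. T l \<alpha> y))) (at y within S)" by blast
  \<comment> \<open>\<open>has_derivative_sequence\<close> only yields some limit function;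
    uniqueness of limits identifies it with f on S.\<close>
  have gf: "g y = f y" if "y \<in> S" for y
  proof (rule LIMSEQ_unique[OF g(1)[OF that]])
    have "((\<lambda>\<alpha>. c \<alpha> * pmon \<alpha> (\<lambda>i. y $ i - x0 $ i)) has_sum f y) UNIV" using that by (intro f) (simp add: S_def)
    from filterlim_compose[OF this[unfolded has_sum_def] Fn]
    show "(\<lambda>n. \<Sum>\<alpha>\<in>Fn n. c \<alpha> * pmon \<alpha> (\<lambda>i. y $ i - x0 $ i)) \<longlonglongrightarrow> f y" by (simp add: o_def)
  qed
  have xS: "x \<in> S" using x by (simp add: S_def)
  have "(g has_derivative (\<lambda>h. \<Sum>l\<in>UNIV. h $ l * (\<Sum>\<^sub>\<infinity>\<alpha>. T l \<alpha> x))) (at x)"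
    using g(2)[OF xS] at_within_open[OF xS S(2)] by simp
  then have "(f has_derivative (\<lambda>h. \<Sum>l\<in>UNIV. h $ l * (\<Sum>\<^sub>\<infinity>\<alpha>. T l \<alpha> x))) (at x)"
    by (rule has_derivative_transform_within_open[OF _ S(2) xS gf])
  then show ?thesis by (simp add: T_def)
qed

section \<open>Substituting series into analytic maps\<close>

text \<open>\<open>G l\<close> is the series of the l-th partial derivative with elements of W in
  place of the coordinates. Evaluation at u is a bounded linear functional and multiplicative, so it
  commutes with the infinite sum and gives the partial derivative at the evaluated point.\<close>

lemma power_series_substitution:
  fixes f :: "real^'d \<Rightarrow> real" and c :: "('d \<Rightarrow> nat) \<Rightarrow> real"
  assumes r: "0 < r" and f: "\<And>x. x \<in> ball x0 r \<Longrightarrow>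
    ((\<lambda>\<alpha>. c \<alpha> * pmon \<alpha> (\<lambda>i. x $ i - x0 $ i)) has_sum f x) UNIV"
  shows "\<exists>t K. \<exists>G :: 'd \<Rightarrow> ('d \<Rightarrow> wiener) \<Rightarrow> wiener. 0 < t \<and> 0 \<le> K \<and>
    (\<forall>l X. (\<forall>i. norm (X i) \<le> t) \<longrightarrow> norm (G l X) \<le> K) \<and>
    (\<forall>l X Y. (\<forall>i. norm (X i) \<le> t) \<longrightarrow> (\<forall>i. norm (Y i) \<le> t) \<longrightarrow>
      norm (G l X - G l Y) \<le> K * (\<Sum>i\<in>UNIV. norm (X i - Y i))) \<and>
    (\<forall>X u. (\<forall>i. norm (X i) \<le> t) \<longrightarrow> \<bar>u\<bar> < 1 \<longrightarrow>
      (f has_derivative (\<lambda>h. \<Sum>l\<in>UNIV. h $ l * wev u (G l X))) (at (\<chi> i. x0 $ i + wev u (X i))))"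
proof -
  \<comment> \<open>By the l1 bound on the norm, the closed cube of half side s lies inside the
    ball, including its corner with all offsets equal to s.\<close>
  define s where "s = r / (2 * real CARD('d))"
  have s: "0 < s" using r by (simp add: s_def)
  have near: "x \<in> ball x0 r" if "\<And>i. \<bar>x $ i - x0 $ i\<bar> \<le> s" for x
  proof -
    have "norm (x - x0) \<le> (\<Sum>i\<in>UNIV. \<bar>(x - x0) $ i\<bar>)" by (rule norm_le_l1_cart)
    also have "\<dots> \<le> (\<Sum>i\<in>(UNIV :: 'd set). s)" by (rule sum_mono) (use that in simp)
    also have "\<dots> < r" using r by (simp add: s_def)
    finally show ?thesis by (simp add: dist_norm norm_minus_commute)
  qed
  have pm: "pmon \<alpha> (\<lambda>i. s) = s ^ deg \<alpha>" for \<alpha> :: "'d \<Rightarrow> nat"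
    using pmon_scaleR[of \<alpha> s "\<lambda>_. 1 :: real"] by (simp add: pmon_def)
  \<comment> \<open>At this corner all monomials are positive, so the unconditional convergence
    there is absolute convergence of the series at radius s.\<close>
  have "((\<lambda>\<alpha>. c \<alpha> * pmon \<alpha> (\<lambda>i. s)) has_sum f (x0 + (\<chi> i. s))) UNIV"
    using f[OF near, of "x0 + (\<chi> i. s)"] s by simp
  then have "(\<lambda>\<alpha>. c \<alpha> * s ^ deg \<alpha>) summable_on UNIV" unfolding pm by (auto simp: summable_on_def)
  then have summ: "(\<lambda>\<alpha>. \<bar>c \<alpha>\<bar> * s ^ deg \<alpha>) summable_on UNIV"
    using s by (simp add: summable_on_iff_abs_summable_on_real[of "\<lambda>\<alpha>. c \<alpha> * s ^ deg \<alpha>"] abs_mult)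
  define b where "b \<alpha> = \<bar>c \<alpha>\<bar> * s ^ deg \<alpha>" for \<alpha>
  define B where "B = infsum b UNIV"
  have hsb: "(b has_sum B) UNIV" using summ by (simp add: B_def b_def[abs_def])
  have B: "0 \<le> B" unfolding B_def by (rule infsum_nonneg) (use s in \<open>simp add: b_def\<close>)
  define T where "T l \<alpha> X = (c \<alpha> * real (\<alpha> l)) *\<^sub>R pmon (dec l \<alpha>) X" for l \<alpha> and X :: "'d \<Rightarrow> wiener"
  define G where "G l X = infsum (\<lambda>\<alpha>. T l \<alpha> X) UNIV" for l X
  have hs: "((\<lambda>\<alpha>. T l \<alpha> X) has_sum G l X) UNIV" if "\<And>i. norm (X i) \<le> s / 4" for l X
  proof -
    have "(\<lambda>\<alpha>. T l \<alpha> X) abs_summable_on UNIV"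
    proof (rule Infinite_Sum.abs_summable_on_comparison_test')
      show "(\<lambda>\<alpha>. (4 / s) * b \<alpha>) summable_on UNIV"
        unfolding b_def by (rule summable_on_cmult_right[OF summ])
      show "norm (T l \<alpha> X) \<le> (4 / s) * b \<alpha>" for \<alpha>
        unfolding T_def b_def by (rule dmon_bounds(1)[OF s that])
    qed
    then have "(\<lambda>\<alpha>. T l \<alpha> X) summable_on UNIV" by (rule abs_summable_summable)
    then show ?thesis unfolding G_def by (rule has_sum_infsum)
  qed
  have G1: "norm (G l X) \<le> (4 / s) * B" if X: "\<And>i. norm (X i) \<le> s / 4" for l X
  proof (rule norm_infsum_le[OF hs[OF X] has_sum_cmult_right[OF hsb]])
    show "norm (T l \<alpha> X) \<le> (4 / s) * b \<alpha>" for \<alpha>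
      unfolding T_def b_def by (rule dmon_bounds(1)[OF s X])
  qed
  have G2: "norm (G l X - G l Y) \<le> (4 / s) * (4 / s) * B * (\<Sum>i\<in>UNIV. norm (X i - Y i))"
    if X: "\<And>i. norm (X i) \<le> s / 4" and Y: "\<And>i. norm (Y i) \<le> s / 4" for l X Y
  proof (rule norm_infsum_le)
    show "((\<lambda>\<alpha>. T l \<alpha> X - T l \<alpha> Y) has_sum (G l X - G l Y)) UNIV"
      using has_sum_add[OF hs[OF X, of l] has_sum_bounded_linear[OF bounded_linear_minus[OF bounded_linear_ident] hs[OF Y, of l]]]
      by simp
    show "((\<lambda>\<alpha>. (4 / s) * (4 / s) * b \<alpha> * (\<Sum>i\<in>UNIV. norm (X i - Y i)))
      has_sum ((4 / s) * (4 / s) * B * (\<Sum>i\<in>UNIV. norm (X i - Y i)))) UNIV"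
      by (intro has_sum_cmult_left has_sum_cmult_right hsb)
    show "norm (T l \<alpha> X - T l \<alpha> Y) \<le> (4 / s) * (4 / s) * b \<alpha> * (\<Sum>i\<in>UNIV. norm (X i - Y i))" for \<alpha>
      unfolding T_def b_def by (rule dmon_bounds(2)[OF s X Y])
  qed
  define K where "K = max ((4 / s) * B) ((4 / s) * (4 / s) * B)"
  show ?thesis
  \<comment> \<open>With s / 8 instead of s / 4, the evaluated point satisfies the strict
    inequalities that \<open>has_derivative_power_series\<close> requires.\<close>
  proof (rule exI[of _ "s / 8"], rule exI[of _ K], rule exI[of _ G], intro conjI allI impI)
    show "0 < s / 8" using s by simp
    show "0 \<le> K" using s B by (simp add: K_def le_max_iff_disj)
    have up: "(\<forall>i. norm (X i) \<le> s / 8) \<Longrightarrow> norm (X i) \<le> s / 4" for X :: "'d \<Rightarrow> wiener" and i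
      using s by (elim allE[of _ i]) simp
    fix l and X :: "'d \<Rightarrow> wiener"
    assume X: "\<forall>i. norm (X i) \<le> s / 8"
    show "norm (G l X) \<le> K" using G1[OF up[OF X]] by (simp add: K_def le_max_iff_disj)
    show "norm (G l X - G l Y) \<le> K * (\<Sum>i\<in>UNIV. norm (X i - Y i))" if Y: "\<forall>i. norm (Y i) \<le> s / 8" for Y
    proof (rule order_trans[OF G2[OF up[OF X] up[OF Y]]], rule mult_right_mono)
      show "(4 / s) * (4 / s) * B \<le> K" by (simp add: K_def)
    qed (intro sum_nonneg norm_ge_zero)
    fix u :: real assume u: "\<bar>u\<bar> < 1"
    let ?x = "\<chi> i. x0 $ i + wev u (X i)"
    have ev: "\<bar>wev u (X i)\<bar> < s / 4" for i
    proof -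
      have "\<bar>wev u (X i)\<bar> \<le> norm (X i)" using u by (intro abs_wev_le) simp
      also have "\<dots> \<le> s / 8" using X by simp
      also have "\<dots> < s / 4" using s by simp
      finally show ?thesis .
    qed
    have "(f has_derivative (\<lambda>h. \<Sum>l\<in>UNIV. h $ l *
      (\<Sum>\<^sub>\<infinity>\<alpha>. (c \<alpha> * real (\<alpha> l)) *\<^sub>R pmon (dec l \<alpha>) (\<lambda>i. ?x $ i - x0 $ i)))) (at ?x)"
    proof (rule has_derivative_power_series[OF s summ])
      show "((\<lambda>\<alpha>. c \<alpha> * pmon \<alpha> (\<lambda>i. y $ i - x0 $ i)) has_sum f y) UNIV"
        if "\<And>i. \<bar>y $ i - x0 $ i\<bar> < s / 4" for y
      proof (intro f near)
        show "\<bar>y $ i - x0 $ i\<bar> \<le> s" for i using that[of i] s by simp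
      qed
    qed (use ev in simp)
    moreover have "(\<Sum>\<^sub>\<infinity>\<alpha>. (c \<alpha> * real (\<alpha> l)) *\<^sub>R pmon (dec l \<alpha>) (\<lambda>i. ?x $ i - x0 $ i)) = wev u (G l X)" for l
    proof (rule infsumI)
      have h: "((\<lambda>\<alpha>. T l \<alpha> X) has_sum G l X) UNIV" by (rule hs[OF up[OF X]])
      have "wev u (T l \<alpha> X) = (c \<alpha> * real (\<alpha> l)) *\<^sub>R pmon (dec l \<alpha>) (\<lambda>i. ?x $ i - x0 $ i)" for \<alpha>
        using u by (simp add: T_def wev_scaleR pmon_def wev_prod wev_power)
      then show "((\<lambda>\<alpha>. (c \<alpha> * real (\<alpha> l)) *\<^sub>R pmon (dec l \<alpha>) (\<lambda>i. ?x $ i - x0 $ i)) has_sum wev u (G l X)) UNIV"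
        using has_sum_bounded_linear[OF bounded_linear_wev h, of u] u by simp
    qed
    ultimately show "(f has_derivative (\<lambda>h. \<Sum>l\<in>UNIV. h $ l * wev u (G l X))) (at ?x)" by simp
  qed
qed

lemma has_derivative_vecI:
  fixes f :: "'a::real_normed_vector \<Rightarrow> real^'m"
  assumes "\<And>k. ((\<lambda>x. f x $ k) has_derivative (\<lambda>h. f' h $ k)) (at x)"
  shows "(f has_derivative f') (at x)"
  unfolding has_derivative_componentwise_within[of f f' x UNIV]
  by (use assms in \<open>auto simp: Basis_vec_def inner_axis\<close>)

text \<open>Packs one local extension of the Jacobian of f: a real point near \<open>c\<close> is
  replaced by \<open>c + X\<close> with entries of X in W, in such a way that evaluation at u
  commutes with the extension.\<close>

definition subst_chart ::
  "(real^'d \<Rightarrow> real^'m) \<Rightarrow> real^'d \<Rightarrow> real \<Rightarrow> real \<Rightarrow> ('m \<Rightarrow> 'd \<Rightarrow> ('d \<Rightarrow> wiener) \<Rightarrow> wiener) \<Rightarrow> bool" where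
  "subst_chart f c t K G \<longleftrightarrow> 0 < t \<and> 0 \<le> K \<and>
    (\<forall>k l X. (\<forall>i. norm (X i) \<le> t) \<longrightarrow> norm (G k l X) \<le> K) \<and>
    (\<forall>k l X Y. (\<forall>i. norm (X i) \<le> t) \<longrightarrow> (\<forall>i. norm (Y i) \<le> t) \<longrightarrow>
      norm (G k l X - G k l Y) \<le> K * (\<Sum>i\<in>UNIV. norm (X i - Y i))) \<and>
    (\<forall>X u. (\<forall>i. norm (X i) \<le> t) \<longrightarrow> \<bar>u\<bar> < 1 \<longrightarrow>
      (f has_derivative (\<lambda>h. \<chi> k. \<Sum>l\<in>UNIV. h $ l * wev u (G k l X))) (at (\<chi> i. c $ i + wev u (X i))))"

lemma real_analytic_at_substitution:
  fixes f :: "real^'d \<Rightarrow> real^'m"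
  assumes "real_analytic_at f x0"
  shows "\<exists>t K G. subst_chart f x0 t K G"
proof -
  obtain r c where r: "0 < r" and c: "\<And>x. x \<in> ball x0 r \<Longrightarrow>
    ((\<lambda>\<alpha>. (\<Prod>i\<in>UNIV. (x$i - x0$i) ^ (\<alpha> i)) *\<^sub>R c \<alpha>) has_sum f x) UNIV"
    using assms unfolding real_analytic_at_def by blast
  have "((\<lambda>\<alpha>. c \<alpha> $ k * pmon \<alpha> (\<lambda>i. x $ i - x0 $ i)) has_sum f x $ k) UNIV" if "x \<in> ball x0 r" for x k
    using has_sum_bounded_linear[OF bounded_linear_vec_nth c[OF that], of k]
    by (simp add: pmon_def mult.commute)
  note sub = power_series_substitution[OF r this]
  have "\<forall>k. \<exists>t K G. 0 < t \<and> 0 \<le> K \<and>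
    (\<forall>l X. (\<forall>i. norm (X i) \<le> t) \<longrightarrow> norm (G l X) \<le> K) \<and>
    (\<forall>l X Y. (\<forall>i. norm (X i) \<le> t) \<longrightarrow> (\<forall>i. norm (Y i) \<le> t) \<longrightarrow>
      norm (G l X - G l Y :: wiener) \<le> K * (\<Sum>i\<in>UNIV. norm (X i - Y i))) \<and>
    (\<forall>X u. (\<forall>i. norm (X i) \<le> t) \<longrightarrow> \<bar>u\<bar> < 1 \<longrightarrow>
      ((\<lambda>x. f x $ k) has_derivative (\<lambda>h. \<Sum>l\<in>UNIV. h $ l * wev u (G l X))) (at (\<chi> i. x0 $ i + wev u (X i))))"
    using sub by (intro allI)
  then obtain t K G where t: "\<And>k. 0 < t k" and K: "\<And>k. 0 \<le> K k"
    and G1: "\<And>k l X. (\<forall>i. norm (X i) \<le> t k) \<Longrightarrow> norm (G k l X) \<le> K k"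
    and G2: "\<And>k l X Y. (\<forall>i. norm (X i) \<le> t k) \<Longrightarrow> (\<forall>i. norm (Y i) \<le> t k) \<Longrightarrow>
      norm (G k l X - G k l Y :: wiener) \<le> K k * (\<Sum>i\<in>UNIV. norm (X i - Y i))"
    and G3: "\<And>k X u. (\<forall>i. norm (X i) \<le> t k) \<Longrightarrow> \<bar>u\<bar> < 1 \<Longrightarrow>
      ((\<lambda>x. f x $ k) has_derivative (\<lambda>h. \<Sum>l\<in>UNIV. h $ l * wev u (G k l X))) (at (\<chi> i. x0 $ i + wev u (X i)))"
    unfolding choice_iff by blast
  define t' where "t' = Min (range t)"
  have t': "0 < t'" "\<And>k. t' \<le> t k" using t by (auto simp: t'_def)
  define K' where "K' = (\<Sum>k\<in>UNIV. K k)"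
  have K': "0 \<le> K'" "\<And>k. K k \<le> K'" using K by (auto simp: K'_def intro: sum_nonneg member_le_sum)
  have up: "(\<forall>i. norm (X i) \<le> t') \<Longrightarrow> \<forall>i. norm (X i) \<le> t k" for X :: "'d \<Rightarrow> wiener" and k
    using t' order_trans by blast
  show ?thesis
    unfolding subst_chart_def
  proof (rule exI[of _ t'], rule exI[of _ K'], rule exI[of _ G], intro conjI allI impI t'(1) K'(1))
    fix k l and X :: "'d \<Rightarrow> wiener"
    assume X: "\<forall>i. norm (X i) \<le> t'"
    show "norm (G k l X) \<le> K'" using G1[OF up[OF X]] K'(2) order_trans by blast
    show "norm (G k l X - G k l Y) \<le> K' * (\<Sum>i\<in>UNIV. norm (X i - Y i))" if Y: "\<forall>i. norm (Y i) \<le> t'" for Y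
      by (rule order_trans[OF G2[OF up[OF X] up[OF Y]] mult_right_mono[OF K'(2)]]) (intro sum_nonneg norm_ge_zero)
    show "(f has_derivative (\<lambda>h. \<chi> k. \<Sum>l\<in>UNIV. h $ l * wev u (G k l X))) (at (\<chi> i. x0 $ i + wev u (X i)))"
      if "\<bar>u\<bar> < 1" for u
      by (rule has_derivative_vecI) (use G3[OF up[OF X] that] in simp)
  qed
qed

definition partial :: "(real^'d \<Rightarrow> real^'m) \<Rightarrow> real^'d \<Rightarrow> 'm \<Rightarrow> 'd \<Rightarrow> real" where
  "partial f x k l = frechet_derivative f (at x) (axis l 1) $ k"

lemma partial_eq:
  fixes f :: "real^'d \<Rightarrow> real^'m"
  assumes "(f has_derivative (\<lambda>h. \<chi> k. \<Sum>l\<in>UNIV. h $ l * g k l)) (at x)"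
  shows "partial f x k l = g k l"
  unfolding partial_def frechet_derivative_at[OF assms, symmetric]
  by (simp add: axis_def if_distrib if_distribR cong: if_cong)

text \<open>The chart centred at x, with 0 substituted, already contains the derivative at
  x.\<close>

lemma real_analytic_at_differentiable:
  fixes f :: "real^'d \<Rightarrow> real^'m"
  assumes "real_analytic_at f x"
  shows "f differentiable (at x)"
proof -
  obtain t K G where tKG: "subst_chart f x t K G"
    using real_analytic_at_substitution[OF assms] by blast
  have "wev 0 0 = 0" using wev_scaleR[of 0 0 0] by simp
  moreover have "(f has_derivative (\<lambda>h. \<chi> k. \<Sum>l\<in>UNIV. h $ l * wev 0 (G k l (\<lambda>_. 0)))) (at (\<chi> i. x $ i + wev 0 0))"
    using tKG by (simp add: subst_chart_def)
  ultimately show ?thesis by (auto simp: differentiable_def)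
qed

lemma frechet_derivative_eq_partial:
  assumes "f differentiable (at x)"
  shows "frechet_derivative f (at x) h $ k = (\<Sum>l\<in>UNIV. h $ l * partial f x k l)"
proof -
  interpret linear "frechet_derivative f (at x)"
    using assms by (rule linear_frechet_derivative)
  have "h = (\<Sum>l\<in>UNIV. h $ l *\<^sub>R axis l 1)" by (simp add: basis_expansion flip: scalar_mult_eq_scaleR)
  then have "frechet_derivative f (at x) h = frechet_derivative f (at x) (\<Sum>l\<in>UNIV. h $ l *\<^sub>R axis l 1)" by simp
  then show ?thesis by (simp add: sum scale partial_def)
qed

lemma powr_le_of_le_1:
  fixes x :: real
  assumes "0 \<le> x" "x \<le> 1" "0 < \<beta>" "\<beta> \<le> 1"
  shows "x \<le> x powr \<beta>"
  using assms powr_mono'[of \<beta> 1 x] by simp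

text \<open>An element of the algebra is determined by its values at \<open>\<bar>u\<bar> < 1\<close>, so the local substitutions
  agree on overlaps and are compatible with translation by periods.\<close>

lemma real_analytic_substitution:
  fixes f :: "real^'d \<Rightarrow> real^'m" and \<eta> :: "'d \<Rightarrow> real^'d \<Rightarrow> wiener"
  defines "dd \<equiv> \<lambda>\<beta> x y :: real^'d. tdist x y powr \<beta>"
  assumes f: "real_analytic f" and per: "on_torus (\<lambda>x. frechet_derivative f (at x))"
    and \<beta>: "0 < \<beta>" "\<beta> \<le> 1" and \<eta>: "\<And>j. lip_bounded (dd \<beta>) N (\<eta> j)" "\<And>j x. wcoef 0 (\<eta> j x) = 0"
  shows "\<exists>\<sigma>>0. \<sigma> \<le> 1 \<and> (\<exists>G K. (\<forall>k l. lip_bounded (dd \<beta>) K (G k l)) \<and>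
    (\<forall>k l x u. \<bar>u\<bar> < 1 \<longrightarrow> wev u (G k l x) = partial f (x + (\<chi> j. wev (\<sigma> * u) (\<eta> j x))) k l))"
proof -
  have N: "0 \<le> N" using \<eta>(1) by (rule lip_bounded_nonneg)
  have "\<exists>t K G. subst_chart f c t K G" for c
    using f by (intro real_analytic_at_substitution) (simp add: real_analytic_def)
  then obtain t K G where ch: "\<And>c. subst_chart f c (t c) (K c) (G c)" by metis
  have t: "0 < t c" and K: "0 \<le> K c" for c using ch[of c] by (simp_all add: subst_chart_def)
  have G1: "norm (G c k l X) \<le> K c" if "\<forall>i. norm (X i) \<le> t c" for c k l X
    using ch[of c] that by (simp add: subst_chart_def)
  have G2: "norm (G c k l X - G c k l Y) \<le> K c * (\<Sum>i\<in>UNIV. norm (X i - Y i))"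
    if "\<forall>i. norm (X i) \<le> t c" "\<forall>i. norm (Y i) \<le> t c" for c k l X Y
    using ch[of c] that by (simp add: subst_chart_def)
  have G3: "(f has_derivative (\<lambda>h. \<chi> k. \<Sum>l\<in>UNIV. h $ l * wev u (G c k l X))) (at (\<chi> i. c $ i + wev u (X i)))"
    if "\<forall>i. norm (X i) \<le> t c" "\<bar>u\<bar> < 1" for c X u
    using ch[of c] that by (simp add: subst_chart_def)
  obtain C where C: "finite C" "torus_box \<subseteq> (\<Union>c\<in>C. ball c (t c / 2))"
  proof (rule compactE_image[OF compact_torus_box, of UNIV "\<lambda>c. ball c (t c / 2)"])
    show "torus_box \<subseteq> (\<Union>c\<in>UNIV. ball c (t c / 2))" using t by (auto intro!: UN_I centre_in_ball[THEN iffD2])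
  qed auto
  have "open B" if "B \<in> (\<lambda>c. ball c (t c / 2)) ` C" for B using that by auto
  \<comment> \<open>A Lebesgue number of the cover: points closer than it share a chart, whose
    Lipschitz estimate then compares them.\<close>
  from Heine_Borel_lemma[OF compact_torus_box C(2) this]
  obtain \<delta>0 where \<delta>0: "0 < \<delta>0" "\<And>x. x \<in> torus_box \<Longrightarrow> \<exists>B\<in>(\<lambda>c. ball c (t c / 2)) ` C. ball x \<delta>0 \<subseteq> B"
    by metis
  \<comment> \<open>The cap 1 ensures d \<le> d^\<beta> for distances d below \<delta>, so the
    offsets from a chart centre vary in a Hoelder way.\<close>
  define \<delta> where "\<delta> = min \<delta>0 1"
  have \<delta>: "0 < \<delta>" "\<delta> \<le> 1" using \<delta>0(1) by (auto simp: \<delta>_def)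
  have \<delta>C: "\<exists>c\<in>C. ball x \<delta> \<subseteq> ball c (t c / 2)" if x: "x \<in> torus_box" for x
  proof -
    obtain c where "c \<in> C" "ball x \<delta>0 \<subseteq> ball c (t c / 2)" using \<delta>0(2)[OF x] by auto
    moreover have "ball x \<delta> \<subseteq> ball x \<delta>0" by (rule subset_ball) (simp add: \<delta>_def)
    ultimately show ?thesis by blast
  qed
  have Cne: "C \<noteq> {}" using \<delta>C torus_box_rep by blast
  define tm where "tm = Min (t ` C)"
  have tm: "0 < tm" "\<And>c. c \<in> C \<Longrightarrow> tm \<le> t c" using C(1) Cne t by (auto simp: tm_def)
  define Km where "Km = (\<Sum>c\<in>C. K c)"
  have Km: "0 \<le> Km" "\<And>c. c \<in> C \<Longrightarrow> K c \<le> Km"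
    using C(1) K by (auto simp: Km_def intro: sum_nonneg member_le_sum)
  \<comment> \<open>Half of a chart radius is reserved for the offset of the base point from the
    centre, the other half for the displacement, which the rescaling of its variable makes that
    small.\<close>
  define \<sigma> where "\<sigma> = min 1 (tm / (2 * (N + 1)))"
  have \<sigma>: "0 < \<sigma>" "\<sigma> \<le> 1" using tm N by (auto simp: \<sigma>_def)
  have \<sigma>N: "\<sigma> * N \<le> tm / 2"
  proof -
    have "\<sigma> * N \<le> (tm / (2 * (N + 1))) * (N + 1)" using N tm \<sigma> by (intro mult_mono) (auto simp: \<sigma>_def)
    also have "\<dots> = tm / 2" using N by (simp add: field_simps)
    finally show ?thesis .
  qed
  define X where "X c z j = of_real (z $ j - c $ j) + wscale \<sigma> (\<eta> j z)" for c z j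
  define P where "P k l x u = partial f (x + (\<chi> j. wev (\<sigma> * u) (\<eta> j x))) k l" for k l x u
  have \<eta>_cong: "\<eta> j x = \<eta> j y" if "tor_eq x y" for j x y
    by (rule lip_bounded_eq[OF \<eta>(1)]) (use that \<beta> in \<open>simp add: dd_def flip: tdist_eq_0_iff\<close>)
  have X_le: "norm (X c z j) \<le> t c" if "c \<in> C" "z \<in> ball c (t c / 2)" for c z j
  proof -
    have "norm (of_real (z $ j - c $ j) :: wiener) \<le> t c / 2"
      using that(2) component_le_norm_cart[of "z - c" j]
      by (simp add: dist_norm norm_minus_commute del: of_real_diff)
    moreover have "norm (wscale \<sigma> (\<eta> j z)) \<le> t c / 2"
    proof -
      have "norm (wscale \<sigma> (\<eta> j z)) \<le> \<sigma> * norm (\<eta> j z)"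
        using norm_wscale_le_mult[of \<sigma> "\<eta> j z"] \<sigma> \<eta>(2) by simp
      also have "\<dots> \<le> \<sigma> * N" using \<sigma> lip_boundedD(1)[OF \<eta>(1)] by (intro mult_left_mono) auto
      also have "\<dots> \<le> t c / 2" using \<sigma>N tm(2)[OF that(1)] by simp
      finally show ?thesis .
    qed
    ultimately show ?thesis unfolding X_def by (intro norm_triangle_le) simp
  qed
  have ev: "wev u (G c k l (X c z)) = P k l x u"
    if "c \<in> C" "z \<in> ball c (t c / 2)" "tor_eq x z" "\<bar>u\<bar> < 1" for c z x k l u
  proof -
    note hyps = that
    have "(\<chi> i. c $ i + wev u (X c z i)) = z + (\<chi> j. wev (\<sigma> * u) (\<eta> j z))"
      using that(4) \<sigma> by (simp add: vec_eq_iff X_def wev_add wev_wscale del: of_real_diff)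
    then have *: "wev u (G c k l (X c z)) = partial f (z + (\<chi> j. wev (\<sigma> * u) (\<eta> j z))) k l"
      using partial_eq[OF G3[of "X c z" c u], of k l] X_le[OF that(1,2)] that(4) by simp
    obtain n where n: "n \<in> int_vecs" "x = z + (2 * pi) *\<^sub>R n" using hyps(3) by (auto simp: tor_eq_iff)
    let ?v = "\<chi> j. wev (\<sigma> * u) (\<eta> j z)"
    have "tor_eq (x + ?v) (z + ?v)"
      using tor_eq_add[OF n(1), of "z + ?v"] n(2) by (simp add: algebra_simps)
    then show ?thesis
      using per[unfolded on_torus_def, rule_format, of "x + ?v" "z + ?v"] * \<eta>_cong[OF that(3)] by (simp add: P_def partial_def)
  qed
  \<comment> \<open>Chart and representative are not unique, but by \<open>wev_eqD\<close> there is
    only one series with these values, so the local expressions glue.\<close>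
  define GG where "GG k l x = (THE g. \<forall>u. \<bar>u\<bar> < 1 \<longrightarrow> wev u g = P k l x u)" for k l x
  have GG: "GG k l x = G c k l (X c z)" if "c \<in> C" "z \<in> ball c (t c / 2)" "tor_eq x z" for c z x k l
    unfolding GG_def
  proof (rule the_equality)
    show "\<forall>u. \<bar>u\<bar> < 1 \<longrightarrow> wev u (G c k l (X c z)) = P k l x u" using ev[OF that] by blast
    fix g assume "\<forall>u. \<bar>u\<bar> < 1 \<longrightarrow> wev u g = P k l x u"
    then show "g = G c k l (X c z)" using ev[OF that] by (intro wev_eqD) auto
  qed
  have chart: "\<exists>c\<in>C. \<exists>z\<in>ball c (t c / 2). tor_eq x z" for x
  proof -
    obtain z where "z \<in> torus_box" "tor_eq z x" using torus_box_rep by blast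
    with C(2) show ?thesis by (blast intro: tor_eq_sym)
  qed
  have b1: "norm (GG k l x) \<le> Km" for k l x
  proof -
    obtain c z where c: "c \<in> C" "z \<in> ball c (t c / 2)" "tor_eq x z" using chart by blast
    show ?thesis using GG[OF c, of k l] G1[of "X c z" c k l] X_le[OF c(1,2)] Km(2)[OF c(1)] by (simp add: order_trans)
  qed
  define D where "D = real CARD('d) * (1 + N)"
  \<comment> \<open>The summands are the sup bound, the variation inside a common chart, and the
    trivial variation 2 Km of pairs at distance at least \<delta>.\<close>
  define L where "L = Km + Km * D + 2 * Km / \<delta> powr \<beta>"
  have D: "0 \<le> D" using N by (simp add: D_def)
  have b2: "norm (GG k l x - GG k l y) \<le> L * dd \<beta> x y" for k l x y
  proof -
    obtain z w where z: "z \<in> torus_box" "tor_eq x z" "tor_eq y w" "norm (z - w) = tdist x y" by (rule tdist_reps)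
    have dd0: "0 \<le> dd \<beta> x y" by (simp add: dd_def)
    show ?thesis
    proof (cases "tdist x y < \<delta>")
      case True
      obtain c where c: "c \<in> C" "ball z \<delta> \<subseteq> ball c (t c / 2)" using \<delta>C[OF z(1)] by blast
      have zc: "z \<in> ball c (t c / 2)" using c(2) \<delta>(1) centre_in_ball[of z \<delta>] by blast
      have wc: "w \<in> ball c (t c / 2)"
        using c(2) True z(4) by (auto simp: dist_norm subset_iff)
      have xd: "tdist x y \<le> dd \<beta> x y"
        unfolding dd_def using True \<delta> \<beta> by (intro powr_le_of_le_1) auto
      have ddzw: "dd \<beta> z w = dd \<beta> x y" using tdist_cong[OF z(2,3)] by (simp add: dd_def)
      have Xd: "norm (X c z j - X c w j) \<le> (1 + N) * dd \<beta> x y" for j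
      proof -
        have "X c z j - X c w j = of_real ((z - w) $ j) + wscale \<sigma> (\<eta> j z - \<eta> j w)"
          using \<sigma> by (simp add: X_def wscale_diff)
        also have "norm \<dots> \<le> norm (z - w) + norm (\<eta> j z - \<eta> j w)"
          using \<sigma> component_le_norm_cart[of "z - w" j]
          by (intro norm_triangle_mono norm_wscale_le) (auto simp del: of_real_diff)
        also have "\<dots> \<le> dd \<beta> x y + N * dd \<beta> x y"
          using xd z(4) lip_boundedD(2)[OF \<eta>(1), of j z w] ddzw by simp
        finally show ?thesis by (simp add: algebra_simps)
      qed
      have "norm (GG k l x - GG k l y) = norm (G c k l (X c z) - G c k l (X c w))"
        using GG[OF c(1) zc z(2)] GG[OF c(1) wc z(3)] by simp
      also have "\<dots> \<le> K c * (\<Sum>i\<in>UNIV. norm (X c z i - X c w i))"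
        using X_le[OF c(1) zc] X_le[OF c(1) wc] by (intro G2) auto
      also have "\<dots> \<le> Km * (real CARD('d) * ((1 + N) * dd \<beta> x y))"
        using Km c(1) Xd sum_bounded_above[of UNIV "\<lambda>i. norm (X c z i - X c w i)" "(1 + N) * dd \<beta> x y"]
        by (intro mult_mono) (auto intro: sum_nonneg)
      also have "\<dots> = (Km * D) * dd \<beta> x y" by (simp add: D_def)
      also have "\<dots> \<le> L * dd \<beta> x y"
        using Km D \<delta> dd0 by (intro mult_right_mono) (auto simp: L_def)
      finally show ?thesis .
    next
      case False
      have "norm (GG k l x - GG k l y) \<le> 2 * Km"
        using norm_triangle_ineq4[of "GG k l x" "GG k l y"] b1[of k l x] b1[of k l y] by linarith
      also have "\<dots> = (2 * Km / \<delta> powr \<beta>) * \<delta> powr \<beta>" using \<delta> by simp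
      also have "\<dots> \<le> (2 * Km / \<delta> powr \<beta>) * dd \<beta> x y"
        unfolding dd_def using False \<delta> \<beta> Km by (intro mult_left_mono powr_mono2) auto
      also have "\<dots> \<le> L * dd \<beta> x y"
        using Km D \<delta> dd0 by (intro mult_right_mono) (auto simp: L_def)
      finally show ?thesis .
    qed
  qed
  have "Km \<le> L" using Km D \<delta> by (simp add: L_def)
  then have "lip_bounded (dd \<beta>) L (GG k l)" for k l
    using b1 b2 unfolding lip_bounded_def by (meson order_trans)
  moreover have "wev u (GG k l x) = P k l x u" if "\<bar>u\<bar> < 1" for k l x u
  proof -
    obtain c z where c: "c \<in> C" "z \<in> ball c (t c / 2)" "tor_eq x z" using chart by blast
    show ?thesis using GG[OF c] ev[OF c that] by simp
  qed
  ultimately show ?thesis using \<sigma> unfolding P_def by blast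
qed

section \<open>Torus diffeomorphisms\<close>

lemma frechet_derivative_shift:
  assumes d: "g differentiable (at y)" "g differentiable (at (y + v))"
    and ev: "\<forall>\<^sub>F z in nhds y. g (z + v) = g z + c"
  shows "frechet_derivative g (at (y + v)) = frechet_derivative g (at y)"
proof -
  have "(g has_derivative frechet_derivative g (at (y + v))) (at (y + v))"
    using d(2) frechet_derivative_works by blast
  then have "((\<lambda>z. g (z + v)) has_derivative frechet_derivative g (at (y + v))) (at y)"
    by (rule has_derivative_compose[where f = "\<lambda>z. z + v" and f' = "\<lambda>h. h", rotated]) (auto intro!: derivative_eq_intros)
  moreover have "((\<lambda>z. g z + c) has_derivative frechet_derivative g (at y)) (at y)"
    using d(1) frechet_derivative_works has_derivative_add_const by blast
  then have "((\<lambda>z. g (z + v)) has_derivative frechet_derivative g (at y)) (at y)"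
    by (rule has_derivative_transform_eventually)
      (use ev in \<open>auto simp: eventually_at_filter elim: eventually_mono dest: eventually_nhds_x_imp_x\<close>)
  ultimately show ?thesis by (rule has_derivative_unique)
qed

text \<open>For a period v, the difference g (z + v) - g z is continuous and takes values in the
  lattice of periods, whose distinct points are at least 2 \<pi> apart. It is therefore locally
  constant, and differentiation removes it.\<close>

lemma torus_map_frechet_periodic:
  fixes g :: "real^'d \<Rightarrow> real^'d"
  assumes g: "torus_map g" "\<And>x. g differentiable (at x)"
  shows "on_torus (\<lambda>x. frechet_derivative g (at x))"
  unfolding on_torus_def
proof safe
  fix x y :: "real^'d" assume xy: "tor_eq x y"
  obtain k where k: "k \<in> int_vecs" "x = y + (2 * pi) *\<^sub>R k" using xy by (auto simp: tor_eq_iff)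
  define v where "v = (2 * pi) *\<^sub>R k"
  define \<phi> where "\<phi> z = g (z + v) - g z" for z
  have cont: "continuous (at z) g" for z using g(2) differentiable_imp_continuous_within by blast
  have "isCont \<phi> y" unfolding \<phi>_def
    by (intro continuous_intros continuous_within_compose3[OF cont])
  then have "\<forall>\<^sub>F z in nhds y. dist (\<phi> z) (\<phi> y) < 2 * pi"
    unfolding isCont_def tendsto_at_iff_tendsto_nhds by (rule tendstoD) simp
  then have "\<forall>\<^sub>F z in nhds y. g (z + v) = g z + \<phi> y"
  proof (rule eventually_mono)
    fix z assume z: "dist (\<phi> z) (\<phi> y) < 2 * pi"
    have "tor_eq (g (w + v)) (g w)" for w
      using g(1) tor_eq_add[OF k(1)] by (auto simp: torus_map_def v_def)
    then have "\<exists>m\<in>int_vecs. \<phi> w = (2 * pi) *\<^sub>R m" for w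
      unfolding \<phi>_def tor_eq_iff by (metis add_diff_cancel_left')
    then obtain m n where m: "m \<in> int_vecs" "n \<in> int_vecs" "\<phi> z = (2 * pi) *\<^sub>R m" "\<phi> y = (2 * pi) *\<^sub>R n" by metis
    have "(m - n) $ i = 0" for i
    proof (rule ccontr)
      assume "(m - n) $ i \<noteq> 0"
      moreover have "(m - n) $ i \<in> \<int>" using m by (auto simp: int_vecs_def)
      ultimately have "1 \<le> \<bar>(m - n) $ i\<bar>" using Ints_nonzero_abs_ge1 by blast
      also have "\<dots> \<le> norm (m - n)" by (rule component_le_norm_cart)
      finally have "2 * pi \<le> norm ((2 * pi) *\<^sub>R (m - n))" by simp
      then show False using z m by (simp add: dist_norm scaleR_diff_right)
    qed
    then have "m = n" by (simp add: vec_eq_iff)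
    then have "\<phi> z = \<phi> y" using m by simp
    then show "g (z + v) = g z + \<phi> y" by (simp add: \<phi>_def algebra_simps)
  qed
  from frechet_derivative_shift[OF g(2) g(2) this]
  show "frechet_derivative g (at x) = frechet_derivative g (at y)" by (simp add: k(2) v_def)
qed

lemma on_torus_frechet_periodic:
  fixes g :: "real^'d \<Rightarrow> 'b::real_normed_vector"
  assumes g: "on_torus g" "\<And>x. g differentiable (at x)"
  shows "on_torus (\<lambda>x. frechet_derivative g (at x))"
  unfolding on_torus_def
proof safe
  fix x y :: "real^'d" assume xy: "tor_eq x y"
  obtain k where k: "k \<in> int_vecs" "x = y + (2 * pi) *\<^sub>R k" using xy by (auto simp: tor_eq_iff)
  have "g (z + (2 * pi) *\<^sub>R k) = g z + 0" for z
    using g(1) tor_eq_add[OF k(1)] by (auto simp: on_torus_def)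
  then show "frechet_derivative g (at x) = frechet_derivative g (at y)"
    unfolding k(2) by (intro frechet_derivative_shift[OF g(2) g(2), of _ 0]) (intro always_eventually allI)
qed

text \<open>The case of zero displacement and exponent 1 of
  \<open>real_analytic_substitution\<close>; evaluation at 0 recovers the real partial
  derivatives.\<close>

lemma real_analytic_partial_bl:
  fixes f :: "real^'d \<Rightarrow> real^'m"
  assumes f: "real_analytic f" and per: "on_torus (\<lambda>x. frechet_derivative f (at x))"
  shows "\<exists>K. \<forall>k l. lip_bounded tdist K (\<lambda>x. partial f x k l)"
proof -
  have z: "wcoef n 0 = 0" for n by (simp add: wcoef_def zero_wiener.rep_eq)
  have "lip_bounded (\<lambda>x y :: real^'d. tdist x y powr 1) 0 (\<lambda>x :: real^'d. 0 :: wiener)" by (simp add: lip_bounded_def)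
  from real_analytic_substitution[OF f per, of 1 0 "\<lambda>_ _. 0", OF _ _ this] z
  obtain \<sigma> G K where \<sigma>: "0 < \<sigma>" and G: "\<And>k l. lip_bounded (\<lambda>x y. tdist x y powr 1) K (G k l)"
    and ev: "\<And>k l x u. \<bar>u\<bar> < 1 \<Longrightarrow> wev u (G k l x) = partial f (x + (\<chi> j. wev (\<sigma> * u) 0)) k l"
    by auto
  have "(\<chi> j. wev (\<sigma> * 0) 0) = (0 :: real^'d)" by (simp add: vec_eq_iff wev_0_eq_wcoef z)
  then have eq: "wev 0 (G k l x) = partial f x k l" for k l x using ev[of 0] by simp
  have "lip_bounded (\<lambda>x y. tdist x y powr 1) (1 * K) (\<lambda>x. wev 0 (G k l x))" for k l
    by (rule lip_bounded_bounded_linear[OF G bounded_linear_wev]) (auto intro: abs_wev_le)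
  then have "lip_bounded tdist K (\<lambda>x. partial f x k l)" for k l by (simp add: eq lip_bounded_def)
  then show ?thesis by blast
qed

lemma norm_le_of_matrix_entries:
  fixes z :: "real^'m" and w :: "real^'d"
  assumes "\<And>k. z $ k = (\<Sum>l\<in>UNIV. w $ l * a k l)" "\<And>k l. \<bar>a k l\<bar> \<le> c"
  shows "norm z \<le> real CARD('m) * real CARD('d) * c * norm w"
proof -
  have "\<bar>z $ k\<bar> \<le> real CARD('d) * (norm w * c)" for k
    using norm_sum_UNIV_le[of "\<lambda>l. w $ l * a k l" "norm w * c"] assms component_le_norm_cart[of w]
    by (simp add: abs_mult mult_mono)
  then have "(\<Sum>k\<in>UNIV. \<bar>z $ k\<bar>) \<le> real CARD('m) * (real CARD('d) * (norm w * c))"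
    using sum_bounded_above[of UNIV "\<lambda>k. \<bar>z $ k\<bar>" "real CARD('d) * (norm w * c)"] by simp
  then show ?thesis using norm_le_l1_cart[of z] by (simp add: mult_ac)
qed

text \<open>The second inequality makes the inverse on the torus Lipschitz as well, as required for
  the coordinates that are transported forwards by composition with it.\<close>

lemma torus_diffeo_bilipschitz:
  fixes g :: "real^'d \<Rightarrow> real^'d"
  assumes g: "real_analytic g" "torus_bij g" "\<And>x. inj (frechet_derivative g (at x))"
  shows "\<exists>l\<ge>1. \<forall>x y. tdist (g x) (g y) \<le> l * tdist x y \<and> tdist x y \<le> l * tdist (g x) (g y)"
proof -
  have diff: "g differentiable (at x)" for x
    using g(1) real_analytic_at_differentiable by (auto simp: real_analytic_def)
  have tm: "torus_map g" using g(2) by (simp add: torus_bij_def)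
  note per = torus_map_frechet_periodic[OF tm diff]
  let ?D = "\<lambda>x. frechet_derivative g (at x)"
  have D: "(g has_derivative ?D x) (at x)" for x using diff frechet_derivative_works by blast
  obtain K where K: "\<And>k l. lip_bounded tdist K (\<lambda>x. partial g x k l)"
    using real_analytic_partial_bl[OF g(1) per] by blast
  have K0: "0 \<le> K" using K by (rule lip_bounded_nonneg)
  define c where "c = real CARD('d) * real CARD('d) * K"
  have le: "norm (?D x w) \<le> c * norm w" for x w
    unfolding c_def by (rule norm_le_of_matrix_entries[OF frechet_derivative_eq_partial[OF diff]])
      (use lip_boundedD(1)[OF K] in simp)
  have lip: "norm (?D x w - ?D y w) \<le> c * norm (x - y) * norm w" for x y w
  proof -
    have "norm (?D x w - ?D y w) \<le> real CARD('d) * real CARD('d) * (K * norm (x - y)) * norm w"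
    proof (rule norm_le_of_matrix_entries)
      show "(?D x w - ?D y w) $ k = (\<Sum>l\<in>UNIV. w $ l * (partial g x k l - partial g y k l))" for k
        by (simp add: frechet_derivative_eq_partial[OF diff] right_diff_distrib sum_subtractf)
      show "\<bar>partial g x k l - partial g y k l\<bar> \<le> K * norm (x - y)" for k l
        using lip_boundedD(2)[OF K, of x k l y] mult_left_mono[OF tdist_le_norm K0, of x y] by simp
    qed
    then show ?thesis by (simp add: c_def mult_ac)
  qed
  have glip: "norm (g x - g y) \<le> c * norm (x - y)" for x y
    by (rule differentiable_bound[of UNIV g ?D]) (use D le K0 in \<open>auto intro!: onorm_bound simp: c_def\<close>)
  have inj0: "w = 0" if "?D x w = 0" for x w
    using g(3)[of x] that linear_0[OF linear_frechet_derivative[OF diff]] by (metis injD)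
  have "\<exists>m>0. \<exists>\<delta>>0. \<forall>x y. norm (x - y) \<le> \<delta> \<longrightarrow> m * norm (x - y) \<le> norm (g x - g y)"
    by (rule torus_local_expansion[where g' = "?D" and K = c]) (fact D inj0 lip per)+
  then obtain m \<delta> where "0 < m" "0 < \<delta>" "\<And>x y. norm (x - y) \<le> \<delta> \<Longrightarrow> m * norm (x - y) \<le> norm (g x - g y)" by blast
  from torus_bij_inverse_lipschitz[OF g(2) glip this]
  obtain C where C: "\<And>x y. tdist x y \<le> C * tdist (g x) (g y)" by blast
  have up: "a * b \<le> max 1 (max c C) * b" if "a = c \<or> a = C" "0 \<le> b" for a b
    using that by (intro mult_right_mono) auto
  show ?thesis
    using order_trans[OF tdist_lipschitz[OF tm glip] up[OF disjI1[OF refl] tdist_nonneg]]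
      order_trans[OF C up[OF disjI2[OF refl] tdist_nonneg]]
    by (intro exI[of _ "max 1 (max c C)"]) auto
qed

section \<open>Hoelder calculus: sums, exponential, logarithm, inverse, change of exponent\<close>

lemma lip_bounded_sum:
  assumes "\<And>i. i \<in> I \<Longrightarrow> lip_bounded dd (K i) (f i)" "\<And>x y. 0 \<le> dd x y"
  shows "lip_bounded dd (\<Sum>i\<in>I. K i) (\<lambda>x. \<Sum>i\<in>I. f i x)"
proof (cases "finite I")
  case True
  then show ?thesis using assms(1)
    by induction (use lip_bounded_const[of dd 0] assms(2) in \<open>auto intro: lip_bounded_add\<close>)
qed (use lip_bounded_const[of dd 0] assms(2) in simp)

lemma lip_bounded_lipschitz_on:
  fixes g :: "real \<Rightarrow> real"
  assumes f: "lip_bounded dd K f" and g: "\<And>x. \<bar>g (f x)\<bar> \<le> C" "\<And>x y. \<bar>g (f x) - g (f y)\<bar> \<le> L * \<bar>f x - f y\<bar>" "0 \<le> L"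
    and dd: "\<And>x y. 0 \<le> dd x y"
  shows "lip_bounded dd (max C (L * K)) (\<lambda>x. g (f x))"
  unfolding lip_bounded_def
proof safe
  fix x y
  show "norm (g (f x)) \<le> max C (L * K)" using g(1)[of x] by simp
  have "\<bar>g (f x) - g (f y)\<bar> \<le> L * (K * dd x y)"
    using lip_boundedD(2)[OF f, of x y] g(3) by (intro order_trans[OF g(2) mult_left_mono]) simp_all
  also have "\<dots> \<le> max C (L * K) * dd x y" using dd[of x y] by (simp add: mult_right_mono flip: mult.assoc)
  finally show "norm (g (f x) - g (f y)) \<le> max C (L * K) * dd x y" by simp
qed

lemma abs_exp_diff_le:
  fixes a b :: real
  assumes "a \<le> K" "b \<le> K"
  shows "\<bar>exp a - exp b\<bar> \<le> exp K * \<bar>a - b\<bar>"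
proof -
  have *: "exp s - exp t \<le> exp K * (s - t)" if "t \<le> s" "s \<le> K" for s t :: real
  proof -
    have "1 - exp (t - s) \<le> s - t" using exp_ge_add_one_self[of "t - s"] by linarith
    then have "exp s * (1 - exp (t - s)) \<le> exp s * (s - t)" by simp
    also have "\<dots> \<le> exp K * (s - t)" using that by (intro mult_right_mono) auto
    finally show ?thesis by (simp add: algebra_simps flip: exp_add)
  qed
  show ?thesis using *[of a b] *[of b a] assms by (cases "a \<le> b") (auto simp: abs_if)
qed

lemma abs_ln_diff_le:
  fixes a b m :: real
  assumes "0 < m" "m \<le> a" "m \<le> b"
  shows "\<bar>ln a - ln b\<bar> \<le> (1 / m) * \<bar>a - b\<bar>"
proof -
  have *: "ln s - ln t \<le> (1 / m) * (s - t)" if "t \<le> s" "m \<le> t" for s t :: real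
  proof -
    have "ln s - ln t = ln (s / t)" using that assms by (simp add: ln_div)
    also have "\<dots> \<le> s / t - 1" using that assms by (intro ln_le_minus_one) simp
    also have "\<dots> = (1 / t) * (s - t)" using that assms by (simp add: field_simps)
    also have "\<dots> \<le> (1 / m) * (s - t)" using that assms by (intro mult_right_mono frac_le) auto
    finally show ?thesis .
  qed
  show ?thesis using *[of a b] *[of b a] assms by (cases "a \<le> b") (auto simp: abs_if)
qed

lemma lip_bounded_exp:
  assumes f: "lip_bounded dd K f" and dd: "\<And>x y. 0 \<le> dd x y"
  shows "lip_bounded dd (max (exp K) (exp K * K)) (\<lambda>x. exp (f x :: real))"
proof (rule lip_bounded_lipschitz_on[OF f _ _ _ dd])
  have le: "f x \<le> K" for x using lip_boundedD(1)[OF f, of x] by simp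
  show "\<bar>exp (f x)\<bar> \<le> exp K" for x using le by simp
  show "\<bar>exp (f x) - exp (f y)\<bar> \<le> exp K * \<bar>f x - f y\<bar>" for x y using le by (intro abs_exp_diff_le)
qed simp

lemma lip_bounded_inverse:
  fixes f :: "'x \<Rightarrow> real"
  assumes f: "lip_bounded dd K f" and m: "0 < m" "\<And>x. m \<le> \<bar>f x\<bar>" and dd: "\<And>x y. 0 \<le> dd x y"
  shows "lip_bounded dd (max (1 / m) (1 / m * (1 / m) * K)) (\<lambda>x. inverse (f x))"
proof (rule lip_bounded_lipschitz_on[OF f _ _ _ dd])
  have inv: "\<bar>inverse (f x)\<bar> \<le> 1 / m" for x using m(2)[of x] m(1) by (simp add: field_simps)
  then show "\<bar>inverse (f x)\<bar> \<le> 1 / m" for x .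
  show "\<bar>inverse (f x) - inverse (f y)\<bar> \<le> 1 / m * (1 / m) * \<bar>f x - f y\<bar>" for x y
  proof -
    have "f x \<noteq> 0" "f y \<noteq> 0" using m(2)[of x] m(2)[of y] m(1) by auto
    then have "\<bar>inverse (f x) - inverse (f y)\<bar> = \<bar>inverse (f x)\<bar> * \<bar>inverse (f y)\<bar> * \<bar>f x - f y\<bar>"
      by (simp add: inverse_diff_inverse abs_mult abs_minus_commute mult_ac)
    also have "\<dots> \<le> 1 / m * (1 / m) * \<bar>f x - f y\<bar>" using inv m(1) by (intro mult_mono) auto
    finally show ?thesis .
  qed
qed (use m in simp)

lemma lip_bounded_ln_abs:
  fixes f :: "'x \<Rightarrow> real"
  assumes f: "lip_bounded dd K f" and m: "0 < m" "\<And>x. m \<le> \<bar>f x\<bar>" and dd: "\<And>x y. 0 \<le> dd x y"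
  shows "lip_bounded dd (max (\<bar>ln m\<bar> + \<bar>ln K\<bar>) (1 / m * K)) (\<lambda>x. ln \<bar>f x\<bar>)"
proof (rule lip_bounded_lipschitz_on[OF f, of "\<lambda>t. ln \<bar>t\<bar>", OF _ _ _ dd])
  show "\<bar>ln \<bar>f x\<bar>\<bar> \<le> \<bar>ln m\<bar> + \<bar>ln K\<bar>" for x
  proof -
    have "ln m \<le> ln \<bar>f x\<bar>" "ln \<bar>f x\<bar> \<le> ln K"
      using m(2)[of x] m(1) lip_boundedD(1)[OF f, of x] by simp_all
    then show ?thesis by linarith
  qed
  show "\<bar>ln \<bar>f x\<bar> - ln \<bar>f y\<bar>\<bar> \<le> 1 / m * \<bar>f x - f y\<bar>" for x y
  proof -
    have "\<bar>ln \<bar>f x\<bar> - ln \<bar>f y\<bar>\<bar> \<le> 1 / m * \<bar>\<bar>f x\<bar> - \<bar>f y\<bar>\<bar>" using m by (intro abs_ln_diff_le)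
    also have "\<dots> \<le> 1 / m * \<bar>f x - f y\<bar>" using m(1) abs_triangle_ineq3 by (intro mult_left_mono) auto
    finally show ?thesis .
  qed
qed (use m in simp)

lemma lip_bounded_powr_continuous:
  fixes f :: "real^'d \<Rightarrow> 'b::real_normed_vector"
  assumes f: "lip_bounded (\<lambda>x y. tdist x y powr \<beta>) K f" and \<beta>: "0 < \<beta>"
  shows "continuous_on UNIV f"
  unfolding continuous_on_def
proof
  fix x :: "real^'d"
  have "((\<lambda>y. K * norm (y - x) powr \<beta>) \<longlongrightarrow> K * norm (x - x) powr \<beta>) (at x)"
    by (intro tendsto_intros tendsto_powr') (use \<beta> in auto)
  then have lim: "((\<lambda>y. K * norm (y - x) powr \<beta>) \<longlongrightarrow> 0) (at x)" by simp
  have "((\<lambda>y. f y - f x) \<longlongrightarrow> 0) (at x)"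
  proof (rule Lim_null_comparison[OF _ lim], intro always_eventually allI)
    fix y :: "real^'d"
    have "norm (f y - f x) \<le> K * tdist y x powr \<beta>" by (rule lip_boundedD(2)[OF f])
    also have "\<dots> \<le> K * norm (y - x) powr \<beta>"
      using lip_bounded_nonneg[OF f] tdist_le_norm \<beta> by (intro mult_left_mono powr_mono2) auto
    finally show "norm (f y - f x) \<le> K * norm (y - x) powr \<beta>" .
  qed
  then show "(f \<longlongrightarrow> f x) (at x within UNIV)" by (simp add: LIM_zero_cancel)
qed

lemma lip_bounded_powr_cong:
  assumes "lip_bounded (\<lambda>x y. tdist x y powr \<beta>) K f" "tor_eq x y"
  shows "f x = f y"
  by (rule lip_bounded_eq[OF assms(1)]) (use assms(2) in \<open>simp flip: tdist_eq_0_iff\<close>)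

lemma lip_bounded_powr_bounded_below:
  fixes f :: "real^'d \<Rightarrow> real"
  assumes f: "lip_bounded (\<lambda>x y. tdist x y powr \<beta>) K f" and \<beta>: "0 < \<beta>" and nz: "\<And>x. f x \<noteq> 0"
  shows "\<exists>m>0. \<forall>x. m \<le> \<bar>f x\<bar>"
proof -
  have "torus_box \<noteq> ({} :: (real^'d) set)" using torus_box_rep by blast
  moreover have "continuous_on (torus_box :: (real^'d) set) (\<lambda>x. \<bar>f x\<bar>)"
    using continuous_on_subset[OF lip_bounded_powr_continuous[OF f \<beta>]] by (intro continuous_on_rabs) auto
  ultimately obtain z where z: "\<And>x. x \<in> torus_box \<Longrightarrow> \<bar>f z\<bar> \<le> \<bar>f x\<bar>"
    using continuous_attains_inf[OF compact_torus_box] by metis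
  have "\<bar>f z\<bar> \<le> \<bar>f x\<bar>" for x
  proof -
    obtain x' where "x' \<in> torus_box" "tor_eq x' x" using torus_box_rep by blast
    then show ?thesis using z[of x'] lip_bounded_powr_cong[OF f, of x' x] by simp
  qed
  then show ?thesis using nz by (intro exI[of _ "\<bar>f z\<bar>"]) auto
qed

text \<open>Up to distance 1 the smaller exponent gives the larger power; beyond it the variation is
  at most 2 K, which is the origin of the factor 2.\<close>

lemma lip_bounded_powr_mono:
  fixes f :: "real^'d \<Rightarrow> 'b::real_normed_vector"
  assumes f: "lip_bounded (\<lambda>x y. tdist x y powr \<gamma>) K f" and \<beta>: "0 < \<beta>" "\<beta> \<le> \<gamma>"
  shows "lip_bounded (\<lambda>x y. tdist x y powr \<beta>) (2 * K) f"
  unfolding lip_bounded_def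
proof safe
  fix x y :: "real^'d"
  have K: "0 \<le> K" using f by (rule lip_bounded_nonneg)
  show "norm (f x) \<le> 2 * K" using lip_boundedD(1)[OF f, of x] K by simp
  show "norm (f x - f y) \<le> 2 * K * tdist x y powr \<beta>"
  proof (cases "tdist x y \<le> 1")
    case True
    have "norm (f x - f y) \<le> K * tdist x y powr \<gamma>" by (rule lip_boundedD(2)[OF f])
    also have "\<dots> \<le> K * tdist x y powr \<beta>" using True \<beta> K by (intro mult_left_mono powr_mono') auto
    also have "\<dots> \<le> 2 * K * tdist x y powr \<beta>" using K by (intro mult_right_mono) auto
    finally show ?thesis .
  next
    case False
    have "norm (f x - f y) \<le> K + K"
      by (rule order_trans[OF norm_triangle_ineq4 add_mono[OF lip_boundedD(1)[OF f] lip_boundedD(1)[OF f]]])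
    also have "\<dots> \<le> 2 * K * tdist x y powr \<beta>"
      using False \<beta> K mult_left_mono[of 1 "tdist x y powr \<beta>" "2 * K"] by (simp add: ge_one_powr_ge_zero)
    finally show ?thesis .
  qed
qed

section \<open>Adapted and dual frames\<close>

lemma ln_abs_prod:
  fixes f :: "'a \<Rightarrow> real"
  assumes "finite I" "\<And>i. i \<in> I \<Longrightarrow> f i \<noteq> 0"
  shows "ln \<bar>\<Prod>i\<in>I. f i\<bar> = (\<Sum>i\<in>I. ln \<bar>f i\<bar>)"
  using assms by induction (auto simp: abs_mult ln_mult)

text \<open>The domination compares values at independent points, so all intermediate indices can be
  evaluated at \<open>y\<close>. One factor Q is kept and the others are bounded by 1.\<close>

lemma consecutive_domination_chain:
  fixes p :: "nat \<Rightarrow> 'x \<Rightarrow> real"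
  assumes Q: "0 \<le> Q" "Q \<le> 1" and step: "\<And>i x y. 1 \<le> i \<Longrightarrow> Suc i \<le> D \<Longrightarrow> \<bar>p i x\<bar> \<le> Q * \<bar>p (Suc i) y\<bar>"
    and ik: "1 \<le> i" "i < k" "k \<le> D"
  shows "\<bar>p i x\<bar> \<le> Q * \<bar>p k y\<bar>"
  using ik(2,3)
proof (induction k arbitrary: y)
  case (Suc k)
  show ?case
  proof (cases "i = k")
    case True then show ?thesis using step[of i] ik Suc.prems by simp
  next
    case False
    then have "\<bar>p i x\<bar> \<le> Q * \<bar>p k y\<bar>" using Suc by simp
    also have "\<dots> \<le> 1 * \<bar>p k y\<bar>" using Q by (intro mult_right_mono) auto
    also have "\<dots> \<le> Q * \<bar>p (Suc k) y\<bar>" using step[of k y y] ik Suc.prems False by simp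
    finally show ?thesis .
  qed
qed simp

text \<open>The factor \<open>q i\<close> is chosen so that \<open>\<bar>q i x * \<Lambda> i x / q i (A x)\<bar>\<close> is the geometric mean of
  \<open>\<bar>\<Lambda> i\<bar>\<close> along the orbit segment of length \<open>N\<close>.\<close>

lemma adapted_rescaling:
  fixes \<Lambda> :: "nat \<Rightarrow> real^'d \<Rightarrow> real" and A :: "real^'d \<Rightarrow> real^'d" and \<gamma> :: real
  defines "dd \<equiv> \<lambda>x y :: real^'d. tdist x y powr \<gamma>"
  assumes \<gamma>: "0 < \<gamma>" and A: "\<And>x y. dd (A x) (A y) \<le> l * dd x y" and l: "1 \<le> l"
    and \<Lambda>: "\<And>i. i \<in> {1..D} \<Longrightarrow> lip_bounded dd (K i) (\<Lambda> i)" "\<And>i x. i \<in> {1..D} \<Longrightarrow> \<Lambda> i x \<noteq> 0"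
    and N: "0 < N" and Q: "0 < Q" "Q < 1"
    and dom: "\<And>i x y. 1 \<le> i \<Longrightarrow> Suc i \<le> D \<Longrightarrow>
      \<bar>\<Prod>j<N. \<Lambda> i ((A ^^ j) x)\<bar> \<le> Q * \<bar>\<Prod>j<N. \<Lambda> (Suc i) ((A ^^ j) y)\<bar>"
  shows "\<exists>\<theta> q. 0 < \<theta> \<and> \<theta> < 1 \<and>
    (\<forall>i\<in>{1..D}. (\<exists>K. lip_bounded dd K (q i)) \<and> (\<exists>K. lip_bounded dd K (\<lambda>x. inverse (q i x))) \<and> (\<forall>x. 0 < q i x)) \<and>
    (\<forall>i\<in>{1..D}. \<forall>k\<in>{1..D}. i < k \<longrightarrow>
      (\<forall>x. \<bar>q i x * \<Lambda> i x / q i (A x)\<bar> \<le> \<theta> * \<bar>q k x * \<Lambda> k x / q k (A x)\<bar>))"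
proof -
  have dd: "0 \<le> dd x y" for x y by (simp add: dd_def)
  define L where "L i j x = ln \<bar>\<Lambda> i ((A ^^ j) x)\<bar>" for i j x
  \<comment> \<open>The weights rise linearly from 1 / N - 1 to 0, so shifting the orbit by one step
    changes each of them by 1 / N. Hence S x + L 0 x - S (A x) is the mean of the L j x over j <
    N.\<close>
  define S where "S i x = (\<Sum>j<N. (real (Suc j) / real N - 1) * L i j x)" for i x
  define q where "q i x = exp (S i x)" for i x
  have Ablj: "\<exists>K. lip_bounded dd K (\<lambda>x. f ((A ^^ j) x))" if "lip_bounded dd K f" for f :: "real^'d \<Rightarrow> real" and K j
    using that
  proof (induction j arbitrary: f K)
    case (Suc j)
    from lip_bounded_compose[where \<tau> = A, OF Suc.prems A l] have "lip_bounded dd (K * l) (\<lambda>x. f (A x))" .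
    from Suc.IH[OF this] show ?case by simp
  qed auto
  have Lbl: "\<exists>K. lip_bounded dd K (L i j)" if i: "i \<in> {1..D}" for i j
  proof -
    obtain m where m: "0 < m" "\<And>x. m \<le> \<bar>\<Lambda> i x\<bar>"
      using lip_bounded_powr_bounded_below[OF \<Lambda>(1)[OF i, unfolded dd_def] \<gamma>] \<Lambda>(2)[OF i] by blast
    from Ablj[OF lip_bounded_ln_abs[OF \<Lambda>(1)[OF i] m dd]] show ?thesis by (simp add: L_def[abs_def])
  qed
  have Sbl: "\<exists>K. lip_bounded dd K (S i)" if i: "i \<in> {1..D}" for i
  proof -
    obtain K where K: "\<And>j. lip_bounded dd (K j) (L i j)" using Lbl[OF i] by metis
    have "lip_bounded dd (\<Sum>j<N. \<bar>real (Suc j) / real N - 1\<bar> * K j) (S i)"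
      unfolding S_def[abs_def]
      by (intro lip_bounded_sum lip_bounded_bounded_linear[OF K bounded_linear_mult_right] dd) (auto simp: abs_mult)
    then show ?thesis by blast
  qed
  have qbl: "(\<exists>K. lip_bounded dd K (q i)) \<and> (\<exists>K. lip_bounded dd K (\<lambda>x. inverse (q i x))) \<and> (\<forall>x. 0 < q i x)"
    if i: "i \<in> {1..D}" for i
  proof -
    obtain K where "lip_bounded dd K (S i)" using Sbl[OF i] by blast
    from lip_bounded_exp[OF this dd] lip_bounded_exp[OF lip_bounded_minus[OF this] dd] show ?thesis
      by (auto simp: q_def[abs_def] exp_minus)
  qed
  have key: "\<bar>q i x * \<Lambda> i x / q i (A x)\<bar> = exp ((1 / real N) * ln \<bar>\<Prod>j<N. \<Lambda> i ((A ^^ j) x)\<bar>)"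
    if i: "i \<in> {1..D}" for i x
  proof -
    have LA: "L i j (A x) = L i (Suc j) x" for j by (simp add: L_def funpow_swap1)
    have "S i (A x) = (\<Sum>j<N. (real (Suc j) / real N - 1) * L i (Suc j) x)" by (simp add: S_def LA)
    also have "\<dots> = (\<Sum>j<Suc N. (real j / real N - 1) * L i j x) + L i 0 x"
      by (subst sum.lessThan_Suc_shift) simp
    \<comment> \<open>The term j = N has weight N / N - 1 = 0, so the shift does not leave the orbit
      segment.\<close>
    also have "(\<Sum>j<Suc N. (real j / real N - 1) * L i j x) = (\<Sum>j<N. (real j / real N - 1) * L i j x)"
      using N by simp
    finally have SA: "S i (A x) = (\<Sum>j<N. (real j / real N - 1) * L i j x) + L i 0 x" .
    have "S i x + L i 0 x - S i (A x) = (\<Sum>j<N. (1 / real N) * L i j x)"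
    proof -
      have "S i x + L i 0 x - S i (A x) = (\<Sum>j<N. (real (Suc j) / real N - 1) * L i j x - (real j / real N - 1) * L i j x)"
        unfolding SA unfolding S_def sum_subtractf by simp
      also have "\<dots> = (\<Sum>j<N. (1 / real N) * L i j x)"
        by (intro sum.cong refl) (use N in \<open>simp add: field_simps\<close>)
      finally show ?thesis .
    qed
    also have "\<dots> = (1 / real N) * ln \<bar>\<Prod>j<N. \<Lambda> i ((A ^^ j) x)\<bar>"
      unfolding L_def by (subst ln_abs_prod) (use \<Lambda>(2)[OF i] in \<open>auto simp: sum_distrib_left\<close>)
    finally have *: "S i x + L i 0 x - S i (A x) = \<dots>" .
    have "\<bar>q i x * \<Lambda> i x / q i (A x)\<bar> = exp (S i x + L i 0 x - S i (A x))"
      using \<Lambda>(2)[OF i, of x] by (simp add: q_def L_def exp_add exp_diff abs_mult)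
    then show ?thesis unfolding * .
  qed
  \<comment> \<open>The N-th root of Q, since each rescaled multiplier is a geometric mean over N
    steps.\<close>
  define \<theta> where "\<theta> = exp ((1 / real N) * ln Q)"
  have \<theta>: "0 < \<theta>" "\<theta> < 1" using N Q by (auto simp: \<theta>_def ln_less_zero mult_pos_neg divide_neg_pos)
  have "\<bar>q i x * \<Lambda> i x / q i (A x)\<bar> \<le> \<theta> * \<bar>q k x * \<Lambda> k x / q k (A x)\<bar>"
    if ik: "i \<in> {1..D}" "k \<in> {1..D}" "i < k" for i k x
  proof -
    let ?p = "\<lambda>i. \<Prod>j<N. \<Lambda> i ((A ^^ j) x)"
    have nz: "?p i \<noteq> 0" "?p k \<noteq> 0" using \<Lambda>(2) ik by auto
    have "\<bar>?p i\<bar> \<le> Q * \<bar>?p k\<bar>"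
      using consecutive_domination_chain[of Q D "\<lambda>i x. \<Prod>j<N. \<Lambda> i ((A ^^ j) x)" i k x x] dom Q ik by auto
    then have "ln \<bar>?p i\<bar> \<le> ln (Q * \<bar>?p k\<bar>)" using nz by (subst ln_le_cancel_iff) (use Q in auto)
    also have "\<dots> = ln Q + ln \<bar>?p k\<bar>" using Q nz by (simp add: ln_mult)
    finally have "(1 / real N) * ln \<bar>?p i\<bar> \<le> (1 / real N) * (ln Q + ln \<bar>?p k\<bar>)"
      by (intro mult_left_mono) auto
    then show ?thesis unfolding key[OF ik(1)] key[OF ik(2)] \<theta>_def exp_add[symmetric]
      by (simp add: algebra_simps)
  qed
  with \<theta> qbl show ?thesis by (intro exI[of _ \<theta>] exI[of _ q]) auto
qed

text \<open>No inverse matrix is computed. Compactness gives a lower bound m for the norm of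
  \<open>V c x\<close> over unit vectors c, and from it come both the bound 1 / m of the dual
  coordinates and their Hoelder estimate.\<close>

lemma dual_frame:
  fixes v :: "'d \<Rightarrow> real^'d \<Rightarrow> real^'d"
  defines "dd \<equiv> \<lambda>\<beta> x y :: real^'d. tdist x y powr \<beta>"
  assumes \<beta>: "0 < \<beta>" and v: "\<And>k. lip_bounded (dd \<beta>) K (v k)"
    and ind: "\<forall>x c. (\<Sum>k\<in>UNIV. c k *\<^sub>R v k x) = 0 \<longrightarrow> (\<forall>k. c k = 0)"
    and span: "\<And>x w. \<exists>c. w = (\<Sum>k\<in>UNIV. c k *\<^sub>R v k x)"
  shows "\<exists>C K'. (\<forall>k l. lip_bounded (dd \<beta>) K' (C k l)) \<and>
    (\<forall>x w. w = (\<Sum>k\<in>UNIV. (\<Sum>l\<in>UNIV. C k l x * w $ l) *\<^sub>R v k x)) \<and>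
    (\<forall>x c k. (\<Sum>l\<in>UNIV. C k l x * (\<Sum>j\<in>UNIV. c j *\<^sub>R v j x) $ l) = c k)"
proof -
  define V where "V c x = (\<Sum>k\<in>UNIV. c $ k *\<^sub>R v k x)" for c :: "real^'d" and x
  have Vlin: "linear (\<lambda>c. V c x)" for x
    by (rule linearI) (simp_all add: V_def scaleR_add_left sum.distrib scaleR_sum_right)
  have V0: "c = 0" if "V c x = 0" for c x
    using ind[rule_format, of "\<lambda>k. c $ k" x] that by (simp add: V_def vec_eq_iff)
  have K: "0 \<le> K" using v by (rule lip_bounded_nonneg)
  let ?S = "(torus_box :: (real^'d) set) \<times> sphere (0 :: real^'d) 1"
  have S: "compact ?S" by (intro compact_Times compact_torus_box compact_sphere)
  obtain z0 :: "real^'d" where z0: "z0 \<in> torus_box" using torus_box_rep by blast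
  obtain b :: "real^'d" where b: "norm b = 1" using vector_choose_size[of 1] by auto
  have "?S \<noteq> {}" using z0 b by auto
  have cv: "continuous_on UNIV (v k)" for k
    by (rule lip_bounded_powr_continuous[OF v[unfolded dd_def] \<beta>])
  have "continuous_on ?S (\<lambda>p. norm (V (snd p) (fst p)))"
    unfolding V_def by (intro continuous_intros continuous_on_compose2[OF cv]) auto
  from continuous_attains_inf[OF S \<open>?S \<noteq> {}\<close> this] obtain p where p: "p \<in> ?S"
    "\<And>q. q \<in> ?S \<Longrightarrow> norm (V (snd p) (fst p)) \<le> norm (V (snd q) (fst q))" by blast
  define m where "m = norm (V (snd p) (fst p))"
  have m: "0 < m" using p(1) V0[of "snd p" "fst p"] by (auto simp: m_def)
  have low: "m * norm c \<le> norm (V c x)" for x c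
  proof (cases "c = 0")
    case True then show ?thesis by simp
  next
    case False
    obtain x' where x': "x' \<in> torus_box" "tor_eq x' x" using torus_box_rep by blast
    have "m \<le> norm (V ((1 / norm c) *\<^sub>R c) x')"
      using p(2)[of "(x', (1 / norm c) *\<^sub>R c)"] x' False by (simp add: m_def)
    also have "\<dots> = norm (V c x) / norm c"
      using lip_bounded_powr_cong[OF v[unfolded dd_def] x'(2)] by (simp add: linear_scale[OF Vlin]) (simp add: V_def)
    finally show ?thesis using False by (simp add: field_simps)
  qed
  have ex: "\<exists>c. V c x = w" for x w
  proof -
    obtain c where "w = (\<Sum>k\<in>UNIV. c k *\<^sub>R v k x)" using span by blast
    then have "V (\<chi> k. c k) x = w" by (simp add: V_def)
    then show ?thesis by blast
  qed
  define z where "z l x = (SOME c. V c x = axis l 1)" for l x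
  have z: "V (z l x) x = axis l 1" for l x unfolding z_def by (rule someI_ex[OF ex])
  define C where "C k l x = z l x $ k" for k l x
  have zle: "norm (z l x) \<le> 1 / m" for l x
    using low[of "z l x" x] m by (simp add: z field_simps)
  define K' where "K' = max (1 / m) ((1 / m) * (real CARD('d) * (1 / m * K)))"
  have zd: "norm (z l x - z l y) \<le> (1 / m) * (real CARD('d) * (1 / m * (K * dd \<beta> x y)))" for l x y
  proof -
    \<comment> \<open>\<open>V (z l x) x\<close> and \<open>V (z l y) y\<close> are the same axis
      vector, so the difference of the coordinates is measured by the variation of the frame
      alone.\<close>
    have "V (z l x - z l y) x = V (z l y) y - V (z l y) x"
      using linear_diff[OF Vlin, of "z l x" "z l y" x] by (simp add: z)
    also have "\<dots> = (\<Sum>k\<in>UNIV. z l y $ k *\<^sub>R (v k y - v k x))"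
      by (simp add: V_def scaleR_diff_right sum_subtractf)
    also have "norm \<dots> \<le> real CARD('d) * (1 / m * (K * dd \<beta> x y))"
    proof (rule norm_sum_UNIV_le)
      fix k
      have "\<bar>z l y $ k\<bar> \<le> 1 / m" using component_le_norm_cart[of "z l y" k] zle[of l y] by simp
      moreover have "norm (v k y - v k x) \<le> K * dd \<beta> x y"
        using lip_boundedD(2)[OF v, of k x y] by (simp add: norm_minus_commute)
      ultimately show "norm (z l y $ k *\<^sub>R (v k y - v k x)) \<le> 1 / m * (K * dd \<beta> x y)"
        unfolding norm_scaleR using m by (intro mult_mono) auto
    qed
    finally have "m * norm (z l x - z l y) \<le> real CARD('d) * (1 / m * (K * dd \<beta> x y))"
      using low[of "z l x - z l y" x] by simp
    then show ?thesis using m by (simp add: field_simps)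
  qed
  have "lip_bounded (dd \<beta>) K' (C k l)" for k l
    unfolding lip_bounded_def
  proof safe
    fix x y
    show "norm (C k l x) \<le> K'"
      using component_le_norm_cart[of "z l x" k] zle[of l x] by (simp add: C_def K'_def le_max_iff_disj)
    have "norm (C k l x - C k l y) \<le> norm (z l x - z l y)"
      using component_le_norm_cart[of "z l x - z l y" k] by (simp add: C_def)
    also have "\<dots> \<le> ((1 / m) * (real CARD('d) * (1 / m * K))) * dd \<beta> x y"
      using zd[of l x y] by (simp add: mult_ac)
    also have "\<dots> \<le> K' * dd \<beta> x y" by (intro mult_right_mono) (auto simp: K'_def dd_def)
    finally show "norm (C k l x - C k l y) \<le> K' * dd \<beta> x y" .
  qed
  moreover have exp: "w = (\<Sum>k\<in>UNIV. (\<Sum>l\<in>UNIV. C k l x * w $ l) *\<^sub>R v k x)" for x w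
  proof -
    have "w = (\<Sum>l\<in>UNIV. w $ l *\<^sub>R axis l 1)" by (simp add: basis_expansion flip: scalar_mult_eq_scaleR)
    also have "\<dots> = V (\<Sum>l\<in>UNIV. w $ l *\<^sub>R z l x) x"
      by (simp add: linear_sum[OF Vlin] linear_scale[OF Vlin] z)
    finally show ?thesis by (simp add: V_def C_def mult.commute)
  qed
  moreover have "(\<Sum>l\<in>UNIV. C k l x * (\<Sum>j\<in>UNIV. c j *\<^sub>R v j x) $ l) = c k" for x c k
  proof -
    define w where "w = (\<Sum>j\<in>UNIV. c j *\<^sub>R v j x)"
    have "(\<Sum>k\<in>UNIV. ((\<Sum>l\<in>UNIV. C k l x * w $ l) - c k) *\<^sub>R v k x) = 0"
      by (simp only: scaleR_diff_left sum_subtractf exp[of w x, symmetric] w_def[symmetric] diff_self)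
    from ind[rule_format, OF this, of k] show ?thesis by (simp add: w_def)
  qed
  ultimately show ?thesis by blast
qed

text \<open>Passage from Hoelder bounds for the single coefficients to a Hoelder bound in W: in the
  l1 norm they simply add up. This turns the estimates of the corrections \<open>h n\<close> into
  one estimate.\<close>

lemma obtain_wiener_family:
  fixes a :: "nat \<Rightarrow> 'x \<Rightarrow> real"
  assumes a: "\<And>n. lip_bounded dd (c n) (a n)" and c: "summable c"
  obtains f where "\<And>n x. wcoef n (f x) = a n x" "lip_bounded dd (suminf c) f"
proof -
  have le: "\<bar>a n x\<bar> \<le> c n" for n x using lip_boundedD(1)[OF a, of n x] by simp
  have "summable (\<lambda>n. \<bar>a n x\<bar>)" for x
    by (rule summable_comparison_test'[OF c, of 0]) (use le in simp)
  then have "\<exists>w. \<forall>n. wcoef n w = a n x" for x using obtain_wiener by metis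
  then obtain f where f: "\<And>x n. wcoef n (f x) = a n x" by metis
  have "lip_bounded dd (suminf c) f"
    unfolding lip_bounded_def
  proof safe
    fix x y
    show "norm (f x) \<le> suminf c"
      unfolding norm_wiener_suminf by (rule suminf_le[OF _ summable_abs_wcoef c]) (simp add: f le)
    have "norm (f x - f y) \<le> (\<Sum>n. c n * dd x y)"
      unfolding norm_wiener_suminf
      by (rule suminf_le[OF _ summable_abs_wcoef summable_mult2[OF c]]) (use lip_boundedD(2)[OF a] in \<open>simp add: f\<close>)
    then show "norm (f x - f y) \<le> suminf c * dd x y" by (simp add: suminf_mult2[OF c])
  qed
  with f show thesis by (rule that)
qed

lemma lip_bounded_wscale: "lip_bounded dd K f \<Longrightarrow> \<bar>s\<bar> \<le> 1 \<Longrightarrow> lip_bounded dd K (\<lambda>x. wscale s (f x))"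
  unfolding lip_bounded_def wscale_diff[symmetric] by (meson norm_wscale_le order_trans)

text \<open>The differences f x - f y have no constant term either, so the gain \<bar>s\<bar>
  extends from the sup bound to the variation.\<close>

lemma lip_bounded_wscale_small:
  assumes f: "lip_bounded dd K f" and s: "\<bar>s\<bar> \<le> 1" and z: "\<And>x. wcoef 0 (f x) = 0" and dd: "\<And>x y. 0 \<le> dd x y"
  shows "lip_bounded dd (\<bar>s\<bar> * K) (\<lambda>x. wscale s (f x))"
  unfolding lip_bounded_def wscale_diff[OF s, symmetric]
proof safe
  fix x y
  show "norm (wscale s (f x)) \<le> \<bar>s\<bar> * K"
    using norm_wscale_le_mult[OF s z, of x] mult_left_mono[OF lip_boundedD(1)[OF f, of x], of "\<bar>s\<bar>"] by simp
  have "norm (wscale s (f x - f y)) \<le> \<bar>s\<bar> * norm (f x - f y)"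
    by (rule norm_wscale_le_mult[OF s]) (simp add: z)
  also have "\<dots> \<le> \<bar>s\<bar> * (K * dd x y)" by (intro mult_left_mono lip_boundedD(2)[OF f]) simp
  finally show "norm (wscale s (f x - f y)) \<le> \<bar>s\<bar> * K * dd x y" by (simp add: mult.assoc)
qed

lemma wev_sum: "\<bar>t\<bar> \<le> 1 \<Longrightarrow> wev t (\<Sum>i\<in>I. f i) = (\<Sum>i\<in>I. wev t (f i))"
  by (rule linear_sum) (rule bounded_linear.linear[OF bounded_linear_wev])

text \<open>In the equation whose index k maximises \<bar>a k\<bar>, the off-diagonal terms amount
  to at most half of \<bar>a k\<bar>, so the maximum is 0.\<close>

lemma diagonally_dominant_injective:
  fixes c :: "'k::finite \<Rightarrow> 'k \<Rightarrow> real"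
  assumes diag: "\<And>i. c i i = 1" and off: "\<And>i k. i \<noteq> k \<Longrightarrow> \<bar>c i k\<bar> \<le> 1 / (2 * real CARD('k))"
    and eq: "\<And>k. (\<Sum>i\<in>UNIV. a i * c i k) = 0"
  shows "a i = 0"
proof -
  define m where "m = Max (range (\<lambda>i. \<bar>a i\<bar>))"
  have m: "\<bar>a i\<bar> \<le> m" for i by (simp add: m_def)
  have "m \<in> range (\<lambda>i. \<bar>a i\<bar>)" unfolding m_def by (rule Max_in) auto
  then obtain k where k: "m = \<bar>a k\<bar>" by blast
  have m0: "0 \<le> m" using k by simp
  have "a k + (\<Sum>i\<in>UNIV - {k}. a i * c i k) = 0"
    using eq[of k] diag[of k] by (simp add: sum.remove[of UNIV k])
  then have "m = \<bar>\<Sum>i\<in>UNIV - {k}. a i * c i k\<bar>" using k by linarith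
  also have "\<dots> \<le> (\<Sum>i\<in>UNIV - {k}. \<bar>a i * c i k\<bar>)" by (rule sum_abs)
  also have "\<dots> \<le> (\<Sum>i\<in>UNIV - {k}. m * (1 / (2 * real CARD('k))))"
    unfolding abs_mult by (intro sum_mono mult_mono m off) (use m0 in auto)
  also have "\<dots> \<le> (\<Sum>i\<in>(UNIV :: 'k set). m * (1 / (2 * real CARD('k))))"
    using m0 by (intro sum_mono2) auto
  also have "\<dots> = m / 2" by simp
  finally have "m = 0" using m0 by simp
  then show ?thesis using m[of i] by simp
qed

section \<open>The perturbed derivative cocycle\<close>

lemma vec_sums:
  fixes f :: "nat \<Rightarrow> real^'m"
  assumes "\<And>j. (\<lambda>n. f n $ j) sums (s $ j)"
  shows "f sums s"
  unfolding sums_def by (rule vec_tendstoI) (use assms in \<open>simp add: sums_def\<close>)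

text \<open>All corrections of the conjugacy become one W-valued displacement, with \<epsilon> = r
  s. It has no constant term because the series starts at n = 1, and this is what later allows it to
  be shrunk.\<close>

lemma displacement_series:
  fixes h :: "nat \<Rightarrow> 'x \<Rightarrow> real^'m"
  assumes h: "\<And>n. 1 \<le> n \<Longrightarrow> lip_bounded dd (c ^ n) (h n)" and c: "0 \<le> c" and dd: "\<And>x y. 0 \<le> dd x y"
  shows "\<exists>r>0. \<exists>\<eta>. (\<forall>j. lip_bounded dd 2 (\<eta> j)) \<and> (\<forall>j x. wcoef 0 (\<eta> j x) = 0) \<and>
    (\<forall>x s. \<bar>s\<bar> \<le> 1 \<longrightarrow> (\<chi> j. wev s (\<eta> j x)) = (\<Sum>n. (r * s) ^ Suc n *\<^sub>R h (Suc n) x))"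
proof -
  \<comment> \<open>Makes r c \<le> 1 / 2, so the rescaled coefficients are bounded by 2^(-n), with
    sum 2; the summand 1 covers c = 0.\<close>
  define r where "r = 1 / (2 * (c + 1))"
  have r: "0 < r" "r * c \<le> 1 / 2" using c by (auto simp: r_def field_simps)
  define a where "a j n x = (if n = 0 then 0 else r ^ n * h n x $ j)" for j n x
  have a: "lip_bounded dd ((1 / 2) ^ n) (a j n)" for j n
  proof (cases "n = 0")
    case True
    then show ?thesis using dd by (simp add: a_def lip_bounded_def)
  next
    case False
    have "lip_bounded dd (r ^ n * c ^ n) (\<lambda>x. r ^ n * h n x $ j)"
    proof (rule lip_bounded_bounded_linear[where h = "\<lambda>w. r ^ n * w $ j"])
      show "lip_bounded dd (c ^ n) (h n)" using h False by simp
      show "bounded_linear (\<lambda>w :: real^'m. r ^ n * w $ j)"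
        by (rule bounded_linear_compose[OF bounded_linear_mult_right bounded_linear_vec_nth])
      show "norm (r ^ n * x $ j) \<le> r ^ n * norm x" for x :: "real^'m"
        using r component_le_norm_cart[of x j] by (simp add: abs_mult mult_left_mono)
    qed (use r in simp)
    moreover have "r ^ n * c ^ n \<le> (1 / 2) ^ n"
      unfolding power_mult_distrib[symmetric] using r c by (intro power_mono) auto
    ultimately have "lip_bounded dd ((1 / 2) ^ n) (\<lambda>x. r ^ n * h n x $ j)" using dd by (rule lip_bounded_mono)
    then show ?thesis using False by (simp add: a_def[abs_def])
  qed
  have "\<exists>f. (\<forall>n x. wcoef n (f x) = a j n x) \<and> lip_bounded dd 2 f" for j
  proof -
    have "summable (\<lambda>n. (1 / 2 :: real) ^ n)" by (rule summable_geometric) simp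
    then obtain f where "\<And>n x. wcoef n (f x) = a j n x" "lip_bounded dd (\<Sum>n. (1 / 2) ^ n) f"
      using obtain_wiener_family[where a = "a j", OF a] by metis
    moreover have "(\<Sum>n. (1 / 2 :: real) ^ n) = 2" by (subst suminf_geometric) auto
    ultimately show ?thesis by auto
  qed
  then obtain \<eta> where \<eta>: "\<And>j n x. wcoef n (\<eta> j x) = a j n x" "\<And>j. lip_bounded dd 2 (\<eta> j)" by metis
  have "(\<chi> j. wev s (\<eta> j x)) = (\<Sum>n. (r * s) ^ Suc n *\<^sub>R h (Suc n) x)" if s: "\<bar>s\<bar> \<le> 1" for x s
  proof -
    have "(\<lambda>n. (r * s) ^ Suc n *\<^sub>R h (Suc n) x) sums (\<chi> j. wev s (\<eta> j x))"
    proof (rule vec_sums)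
      fix j
      have "(\<lambda>n. wcoef n (\<eta> j x) * s ^ n) sums wev s (\<eta> j x)"
        unfolding wev_suminf by (rule summable_sums[OF summable_rabs_cancel[OF summable_wev[OF s]]])
      then have "(\<lambda>n. a j n x * s ^ n) sums wev s (\<eta> j x)" by (simp add: \<eta>)
      then have "(\<lambda>n. a j (Suc n) x * s ^ Suc n) sums wev s (\<eta> j x)"
        by (subst sums_Suc_iff) (simp add: a_def)
      then show "(\<lambda>n. ((r * s) ^ Suc n *\<^sub>R h (Suc n) x) $ j) sums ((\<chi> j. wev s (\<eta> j x)) $ j)"
        by (simp add: a_def power_mult_distrib mult_ac)
    qed
    then show ?thesis by (simp add: sums_iff)
  qed
  with r \<eta> show ?thesis by (intro exI[of _ r] conjI exI[of _ \<eta>]) (auto simp: a_def)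
qed

lemma frechet_derivative_add_scaleR:
  assumes "f differentiable (at x)" "g differentiable (at x)"
  shows "frechet_derivative (\<lambda>x. f x + c *\<^sub>R g x) (at x) w
    = frechet_derivative f (at x) w + c *\<^sub>R frechet_derivative g (at x) w"
proof -
  have "((\<lambda>x. f x + c *\<^sub>R g x) has_derivative
    (\<lambda>w. frechet_derivative f (at x) w + c *\<^sub>R frechet_derivative g (at x) w)) (at x)"
    using assms by (intro has_derivative_add has_derivative_scaleR_right) (simp_all add: frechet_derivative_works[symmetric])
  from frechet_derivative_at[OF this] show ?thesis by metis
qed

lemma lip_bounded_Ex_mult:
  fixes f g :: "'x \<Rightarrow> 'w::real_normed_algebra"
  shows "(\<exists>K. lip_bounded dd K f) \<Longrightarrow> (\<exists>K. lip_bounded dd K g) \<Longrightarrow> \<exists>K. lip_bounded dd K (\<lambda>x. f x * g x)"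
  using lip_bounded_mult by blast

lemma lip_bounded_Ex_sum:
  fixes f :: "'i::finite \<Rightarrow> 'x \<Rightarrow> 'w::real_normed_vector"
  assumes "\<And>i. \<exists>K. lip_bounded dd K (f i)" "\<And>x y. 0 \<le> dd x y"
  shows "\<exists>K. lip_bounded dd K (\<lambda>x. \<Sum>i\<in>UNIV. f i x)"
proof -
  obtain K where "\<And>i. lip_bounded dd (K i) (f i)" using assms(1) by metis
  then have "lip_bounded dd (\<Sum>i\<in>UNIV. K i) (\<lambda>x. \<Sum>i\<in>UNIV. f i x)" by (intro lip_bounded_sum assms(2))
  then show ?thesis by blast
qed

lemma lip_bounded_Ex_uniform:
  fixes f :: "'i::finite \<Rightarrow> 'x \<Rightarrow> 'w::real_normed_vector"
  assumes "\<And>i. \<exists>K. lip_bounded dd K (f i)" "\<And>x y. 0 \<le> dd x y"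
  shows "\<exists>K. \<forall>i. lip_bounded dd K (f i)"
proof -
  obtain K where K: "\<And>i. lip_bounded dd (K i) (f i)" using assms(1) by metis
  have "lip_bounded dd (\<Sum>i\<in>UNIV. K i) (f i)" for i
    by (rule lip_bounded_mono[OF K _ assms(2)]) (intro member_le_sum, auto intro: lip_bounded_nonneg[OF K])
  then show ?thesis by blast
qed

text \<open>W-valued Jacobian of A_0 + \<epsilon> F along the conjugacy, with \<epsilon> = \<rho> u.
  The displacement is substituted into the derivatives of A_0 and of F separately, and the factor
  \<epsilon> becomes an element of W too.\<close>

lemma perturbed_derivative_cocycle:
  fixes A0 F :: "real^'d \<Rightarrow> real^'m" and h :: "nat \<Rightarrow> real^'d \<Rightarrow> real^'d"
  defines "dd \<equiv> \<lambda>\<beta> x y :: real^'d. tdist x y powr \<beta>"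
  assumes A0: "real_analytic A0" "on_torus (\<lambda>x. frechet_derivative A0 (at x))"
    and F: "real_analytic F" "on_torus (\<lambda>x. frechet_derivative F (at x))"
    and \<beta>: "0 < \<beta>" "\<beta> \<le> 1"
    and h: "\<And>n. 1 \<le> n \<Longrightarrow> lip_bounded (dd \<beta>) (c ^ n) (h n)" "0 \<le> c"
  shows "\<exists>\<rho>>0. \<exists>G K. (\<forall>k l. lip_bounded (dd \<beta>) K (G k l)) \<and> (\<forall>k l x. wcoef 0 (G k l x) = partial A0 x k l) \<and>
    (\<forall>x u w. \<bar>u\<bar> < 1 \<longrightarrow> frechet_derivative (\<lambda>x. A0 x + (\<rho> * u) *\<^sub>R F x)
        (at (x + (\<Sum>n. (\<rho> * u) ^ Suc n *\<^sub>R h (Suc n) x))) w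
      = (\<chi> k. \<Sum>l\<in>UNIV. w $ l * wev u (G k l x)))"
proof -
  have dd: "0 \<le> dd \<beta> x y" for x y by (simp add: dd_def)
  obtain r \<eta> where r: "0 < r" and \<eta>: "\<And>j. lip_bounded (dd \<beta>) 2 (\<eta> j)" "\<And>j x. wcoef 0 (\<eta> j x) = 0"
    and ser: "\<And>x s. \<bar>s\<bar> \<le> 1 \<Longrightarrow> (\<chi> j. wev s (\<eta> j x)) = (\<Sum>n. (r * s) ^ Suc n *\<^sub>R h (Suc n) x)"
    using displacement_series[OF h dd] by blast
  obtain \<sigma>A GA KA where \<sigma>A: "0 < \<sigma>A" "\<sigma>A \<le> 1" and GA: "\<And>k l. lip_bounded (dd \<beta>) KA (GA k l)"
    "\<And>k l x u. \<bar>u\<bar> < 1 \<Longrightarrow> wev u (GA k l x) = partial A0 (x + (\<chi> j. wev (\<sigma>A * u) (\<eta> j x))) k l"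
    using real_analytic_substitution[where \<eta> = \<eta> and N = 2, OF A0 \<beta> \<eta>[unfolded dd_def]] unfolding dd_def by blast
  obtain \<sigma>F GF KF where \<sigma>F: "0 < \<sigma>F" "\<sigma>F \<le> 1" and GF: "\<And>k l. lip_bounded (dd \<beta>) KF (GF k l)"
    "\<And>k l x u. \<bar>u\<bar> < 1 \<Longrightarrow> wev u (GF k l x) = partial F (x + (\<chi> j. wev (\<sigma>F * u) (\<eta> j x))) k l"
    using real_analytic_substitution[where \<eta> = \<eta> and N = 2, OF F \<beta> \<eta>[unfolded dd_def]] unfolding dd_def by blast
  \<comment> \<open>The two substitutions come with their own rescalings of the variable; both are
    brought to the smaller one.\<close>
  define \<sigma> where "\<sigma> = min \<sigma>A \<sigma>F"
  have \<sigma>: "0 < \<sigma>" "\<sigma> \<le> 1" using \<sigma>A \<sigma>F by (auto simp: \<sigma>_def)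
  have sA: "\<bar>\<sigma> / \<sigma>A\<bar> \<le> 1" and sF: "\<bar>\<sigma> / \<sigma>F\<bar> \<le> 1" using \<sigma>A \<sigma>F by (auto simp: \<sigma>_def)
  define \<rho> where "\<rho> = r * \<sigma>"
  have "summable (\<lambda>n. \<bar>if n = 1 then \<rho> else 0 :: real\<bar>)" by (rule summable_finite[of "{1}"]) auto
  \<comment> \<open>\<open>T\<close> is \<epsilon> itself as an element of W, namely the monomial
    \<rho> u.\<close>
  then obtain T where T: "\<And>n. wcoef n T = (if n = 1 then \<rho> else 0)" by (rule obtain_wiener) blast
  have evT: "wev u T = \<rho> * u" for u
  proof -
    have "wev u T = (\<Sum>n. if n = 1 then \<rho> * u else 0)"
      unfolding wev_suminf T by (rule suminf_cong) auto
    also have "\<dots> = \<rho> * u" using sums_single[of 1 "\<lambda>_. \<rho> * u"] by (simp add: sums_iff)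
    finally show ?thesis .
  qed
  define G where "G k l x = wscale (\<sigma> / \<sigma>A) (GA k l x) + T * wscale (\<sigma> / \<sigma>F) (GF k l x)" for k l x
  define P where "P x u = x + (\<Sum>n. (\<rho> * u) ^ Suc n *\<^sub>R h (Suc n) x)" for x u
  have P: "P x u = x + (\<chi> j. wev (\<sigma> * u) (\<eta> j x))" if "\<bar>u\<bar> < 1" for x u
  proof -
    have "\<bar>\<sigma> * u\<bar> \<le> 1" using that \<sigma> by (simp add: abs_mult mult_le_one)
    from ser[OF this, of x] show ?thesis by (simp add: P_def \<rho>_def mult.assoc)
  qed
  have small: "\<bar>s * u\<bar> < 1" if "\<bar>s\<bar> \<le> 1" "\<bar>u\<bar> < 1" for s u :: real
    using that mult_left_le_one_le[of "\<bar>u\<bar>" "\<bar>s\<bar>"] by (simp add: abs_mult)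
  have ev: "wev u (G k l x) = partial A0 (P x u) k l + (\<rho> * u) * partial F (P x u) k l" if u: "\<bar>u\<bar> < 1" for u k l x
  proof -
    have eqs: "\<sigma>A * (\<sigma> / \<sigma>A * u) = \<sigma> * u" "\<sigma>F * (\<sigma> / \<sigma>F * u) = \<sigma> * u" using \<sigma>A \<sigma>F by auto
    have "wev u (wscale (\<sigma> / \<sigma>A) (GA k l x)) = partial A0 (P x u) k l"
      unfolding wev_wscale[OF sA] GA(2)[OF small[OF sA u]] P[OF u] eqs ..
    moreover have "wev u (wscale (\<sigma> / \<sigma>F) (GF k l x)) = partial F (P x u) k l"
      unfolding wev_wscale[OF sF] GF(2)[OF small[OF sF u]] P[OF u] eqs ..
    ultimately show ?thesis using u by (simp add: G_def wev_add wev_mult evT)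
  qed
  have "\<exists>K. \<forall>k l. lip_bounded (dd \<beta>) K (G k l)"
  proof -
    have "lip_bounded (dd \<beta>) (KA + 2 * norm T * KF) (G k l)" for k l
      unfolding G_def[abs_def]
      by (intro lip_bounded_add lip_bounded_mult lip_bounded_wscale[OF GA(1) sA] lip_bounded_wscale[OF GF(1) sF] lip_bounded_const dd)
    then show ?thesis by blast
  qed
  then obtain K where K: "\<And>k l. lip_bounded (dd \<beta>) K (G k l)" by blast
  have diff: "A0 differentiable (at x)" "F differentiable (at x)" for x
    using A0(1) F(1) real_analytic_at_differentiable by (auto simp: real_analytic_def)
  have "wcoef 0 (G k l x) = partial A0 x k l" for k l x
    using ev[of 0 k l x] by (simp add: wev_0_eq_wcoef P_def)
  moreover have "frechet_derivative (\<lambda>x. A0 x + (\<rho> * u) *\<^sub>R F x) (at (P x u)) w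
      = (\<chi> k. \<Sum>l\<in>UNIV. w $ l * wev u (G k l x))" if "\<bar>u\<bar> < 1" for x u w
    by (simp add: vec_eq_iff frechet_derivative_add_scaleR[OF diff] frechet_derivative_eq_partial[OF diff(1)]
        frechet_derivative_eq_partial[OF diff(2)] ev[OF that] distrib_left sum.distrib sum_distrib_left mult_ac)
  moreover have "0 < \<rho>" using r \<sigma> by (simp add: \<rho>_def)
  ultimately show ?thesis using K unfolding P_def by blast
qed

text \<open>Applied to the rescaled frame, for which domination holds in one step. The parameter is
  shrunk twice: by \<rho> for the convergence of the Jacobian and by \<tau> for the smallness of its
  deviation from the diagonal cocycle.\<close>

lemma perturbed_frame:
  fixes A B F :: "real^'d \<Rightarrow> real^'d" and h :: "nat \<Rightarrow> real^'d \<Rightarrow> real^'d"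
    and v :: "'d \<Rightarrow> real^'d \<Rightarrow> real^'d" and lam :: "'d \<Rightarrow> real^'d \<Rightarrow> real" and \<beta> :: real
  defines "dd \<equiv> \<lambda>x y :: real^'d. tdist x y powr \<beta>"
  assumes A: "real_analytic A" "on_torus (\<lambda>x. frechet_derivative A (at x))"
    and F: "real_analytic F" "on_torus (\<lambda>x. frechet_derivative F (at x))"
    and \<beta>: "0 < \<beta>" "\<beta> \<le> 1"
    and h: "\<And>n. 1 \<le> n \<Longrightarrow> lip_bounded dd (c ^ n) (h n)" "0 \<le> c"
    and l: "1 \<le> l" "\<And>x y. dd (A x) (A y) \<le> l * dd x y" "\<And>x y. dd (B x) (B y) \<le> l * dd x y"
    and AB: "\<And>x. dd (A (B x)) x = 0" and BA: "\<And>x. dd (B (A x)) x = 0"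
    and v: "\<And>k. lip_bounded dd K (v k)" "\<And>x c k. (\<Sum>k\<in>UNIV. c k *\<^sub>R v k x) = 0 \<Longrightarrow> c k = 0"
      "\<And>x w. \<exists>c. w = (\<Sum>k\<in>UNIV. c k *\<^sub>R v k x)"
    and lam: "\<And>k. lip_bounded dd R (lam k)" "\<And>k. lip_bounded dd R (\<lambda>x. inverse (lam k x))" "\<And>k x. lam k x \<noteq> 0"
    and cov: "\<And>k x. frechet_derivative A (at x) (v k x) = lam k x *\<^sub>R v k (A x)"
    and \<theta>: "0 \<le> \<theta>" "\<theta> * l < 1"
    and dom: "\<And>i k. k \<noteq> i \<Longrightarrow> (\<forall>x. \<bar>lam k x\<bar> \<le> \<theta> * \<bar>lam i x\<bar>) \<or> (\<forall>x. \<bar>lam i x\<bar> \<le> \<theta> * \<bar>lam k x\<bar>)"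
  shows "\<exists>\<rho>>0. \<exists>V L K'. (\<forall>i m. lip_bounded dd K' (V i m)) \<and> (\<forall>i. lip_bounded dd K' (L i)) \<and>
    (\<forall>i m x. wcoef 0 (V i m x) = v i x $ m) \<and> (\<forall>i x. wcoef 0 (L i x) = lam i x) \<and>
    (\<forall>x u i. \<bar>u\<bar> < 1 \<longrightarrow> frechet_derivative (\<lambda>x. A x + (\<rho> * u) *\<^sub>R F x)
        (at (x + (\<Sum>n. (\<rho> * u) ^ Suc n *\<^sub>R h (Suc n) x))) (\<chi> m. wev u (V i m x))
      = wev u (L i x) *\<^sub>R (\<chi> m. wev u (V i m (A x)))) \<and>
    (\<forall>x u a i. \<bar>u\<bar> < 1 \<longrightarrow> (\<Sum>i\<in>UNIV. a i *\<^sub>R (\<chi> m. wev u (V i m x))) = 0 \<longrightarrow> a i = 0)"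
proof -
  have dd: "0 \<le> dd x y" for x y by (simp add: dd_def)
  obtain \<rho> G KG where \<rho>: "0 < \<rho>" and G: "\<And>k l. lip_bounded dd KG (G k l)" "\<And>k l x. wcoef 0 (G k l x) = partial A x k l"
    and DG: "\<And>x u w. \<bar>u\<bar> < 1 \<Longrightarrow> frechet_derivative (\<lambda>x. A x + (\<rho> * u) *\<^sub>R F x)
        (at (x + (\<Sum>n. (\<rho> * u) ^ Suc n *\<^sub>R h (Suc n) x))) w
      = (\<chi> k. \<Sum>l\<in>UNIV. w $ l * wev u (G k l x))"
    using perturbed_derivative_cocycle[OF A F \<beta> h[unfolded dd_def]] unfolding dd_def by blast
  have ind0: "\<forall>x c. (\<Sum>k\<in>UNIV. c k *\<^sub>R v k x) = 0 \<longrightarrow> (\<forall>k. c k = 0)" using v(2) by blast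
  obtain C KC where C: "\<And>k l. lip_bounded dd KC (C k l)"
    and exp: "\<And>x w. w = (\<Sum>k\<in>UNIV. (\<Sum>l\<in>UNIV. C k l x * w $ l) *\<^sub>R v k x)"
    and coef: "\<And>x c k. (\<Sum>l\<in>UNIV. C k l x * (\<Sum>j\<in>UNIV. c j *\<^sub>R v j x) $ l) = c k"
    using dual_frame[where v = v and K = K, OF \<beta>(1) v(1)[unfolded dd_def] ind0 v(3)] unfolding dd_def by blast
  have Adiff: "A differentiable (at x)" for x
    using A(1) real_analytic_at_differentiable by (auto simp: real_analytic_def)
  \<comment> \<open>Matrix of the perturbed derivative from the frame at x to the frame at A x;
    \<open>C\<close> reads off the target coordinates.\<close>
  define M where "M k j x = (\<Sum>l\<in>UNIV. \<Sum>m\<in>UNIV. of_real (C k l (A x)) * G l m x * of_real (v j x $ m))" for k j x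
  define E0 where "E0 k j x = M k j x - of_real (if k = j then lam k x else 0)" for k j x
  have vm: "lip_bounded dd K (\<lambda>x. v j x $ m)" for j m
    using lip_bounded_bounded_linear[OF v(1)[of j] bounded_linear_vec_nth[of m], where C = 1] by (simp add: component_le_norm_cart)
  have CA: "lip_bounded dd (KC * l) (\<lambda>x. C k j (A x))" for k j
    by (rule lip_bounded_compose[where \<tau> = A, OF C l(2,1)])
  have Mbl: "\<exists>K. lip_bounded dd K (M k j)" for k j
    unfolding M_def[abs_def]
  proof (intro lip_bounded_Ex_sum dd)
    fix l m
    show "\<exists>K. lip_bounded dd K (\<lambda>x. of_real (C k l (A x)) * G l m x * of_real (v j x $ m))"
      using lip_bounded_mult[OF lip_bounded_mult[OF lip_bounded_of_real[OF CA[of k l]] G(1)[of l m]] lip_bounded_of_real[OF vm[of j m]]] by blast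
  qed
  have E0bl: "\<exists>K. lip_bounded dd K (E0 k j)" for k j
  proof -
    have "lip_bounded dd R (\<lambda>x. if k = j then lam k x else 0)"
      using lam(1)[of k] lip_bounded_nonneg[OF lam(1)] dd by (cases "k = j") (auto simp: lip_bounded_def)
    moreover obtain K' where "lip_bounded dd K' (M k j)" using Mbl by blast
    ultimately have "lip_bounded dd (K' + R) (\<lambda>x. M k j x + - of_real (if k = j then lam k x else 0))"
      by (intro lip_bounded_add lip_bounded_minus lip_bounded_of_real)
    then show ?thesis by (auto simp: E0_def[abs_def])
  qed
  have evM: "wev u (M k j x) = (\<Sum>l\<in>UNIV. C k l (A x) * (\<Sum>m\<in>UNIV. v j x $ m * wev u (G l m x)))"
    if "\<bar>u\<bar> < 1" for u k j x
    using that by (simp add: M_def wev_sum wev_mult sum_distrib_left mult_ac)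
  \<comment> \<open>Covariance makes the unperturbed derivative diagonal in the frame. Hence
    \<open>E0\<close> has no constant term and can be made small by rescaling.\<close>
  have M0: "wcoef 0 (M k j x) = (if k = j then lam k x else 0)" for k j x
  proof -
    have "wcoef 0 (M k j x) = (\<Sum>l\<in>UNIV. C k l (A x) * frechet_derivative A (at x) (v j x) $ l)"
      using evM[of 0] by (simp add: wev_0_eq_wcoef G(2) frechet_derivative_eq_partial[OF Adiff])
    also have "\<dots> = (\<Sum>l\<in>UNIV. C k l (A x) * (\<Sum>i\<in>UNIV. (if i = j then lam j x else 0) *\<^sub>R v i (A x)) $ l)"
      by (simp add: cov if_distribR if_distrib[of "\<lambda>c. c *\<^sub>R _"] cong: if_cong)
    also have "\<dots> = (if k = j then lam k x else 0)" unfolding coef by simp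
    finally show ?thesis .
  qed
  have E00: "wcoef 0 (E0 k j x) = 0" for k j x
  proof -
    have "wcoef 0 (of_real r) = r" for r using wev_of_real[of 0 r] unfolding wev_0_eq_wcoef by simp
    then show ?thesis by (simp add: E0_def M0)
  qed
  from lip_bounded_Ex_uniform[where f = "\<lambda>p. E0 (fst p) (snd p)", OF E0bl dd] obtain KE where KE: "\<And>k j. lip_bounded dd KE (E0 k j)" by auto
  have KE0: "0 \<le> KE" using KE by (rule lip_bounded_nonneg)
  \<comment> \<open>The off-diagonal bound required by
    \<open>diagonally_dominant_injective\<close>.\<close>
  define a0 where "a0 = 1 / (2 * real CARD('d))"
  have "1 \<le> real CARD('d)" by (simp add: Suc_le_eq)
  then have "1 \<le> 2 * real CARD('d)" by linarith
  then have a0: "0 < a0" "a0 \<le> 1" unfolding a0_def by (simp, simp only: divide_le_eq_1 simp_thms) simp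
  define good where "good i E u \<longleftrightarrow> u i = (\<lambda>_. 1) \<and> (\<forall>k x. k \<noteq> i \<longrightarrow> norm (u k x) \<le> a0) \<and>
      (\<forall>k x y. norm (u k x - u k y) \<le> dd x y) \<and>
      (\<forall>k x. lam k x *\<^sub>R u k x + (\<Sum>j\<in>UNIV. E k j x * u j x)
          = (of_real (lam i x) + (\<Sum>j\<in>UNIV. E i j x * u j x)) * u k (A x))"
    for i and E :: "'d \<Rightarrow> 'd \<Rightarrow> real^'d \<Rightarrow> wiener" and u
  have "\<exists>e>0. \<forall>E. (\<forall>k j. lip_bounded dd e (E k j)) \<longrightarrow> (\<exists>u. good i E u)" for i
    unfolding good_def
    by (rule perturbed_invariant_line[where A = A and B = B and l = l and R = R and \<theta> = \<theta>])
      (fact dd l AB BA lam \<theta> dom a0(1))+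
  then obtain e where e: "\<And>i. 0 < e i"
    and inv: "\<And>i E. (\<forall>k j. lip_bounded dd (e i) (E k j)) \<Longrightarrow> \<exists>u. good i E u" by metis
  define em where "em = Min (range e)"
  have em: "0 < em" "\<And>i. em \<le> e i" using e by (auto simp: em_def)
  \<comment> \<open>Brings the Hoelder bound of the deviation below the thresholds of all i at
    once.\<close>
  define \<tau> where "\<tau> = min 1 (em / (KE + 1))"
  have \<tau>: "0 < \<tau>" "\<tau> \<le> 1" using em KE0 by (auto simp: \<tau>_def)
  have \<tau>KE: "\<tau> * KE \<le> em"
  proof -
    have "\<tau> * KE \<le> (em / (KE + 1)) * (KE + 1)" using KE0 em \<tau> by (intro mult_mono) (auto simp: \<tau>_def)
    then show ?thesis using KE0 by simp
  qed
  define E where "E k j x = wscale \<tau> (E0 k j x)" for k j x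
  have Ebl: "lip_bounded dd em (E k j)" for k j
  proof -
    have "lip_bounded dd (\<bar>\<tau>\<bar> * KE) (E k j)"
      unfolding E_def[abs_def] by (rule lip_bounded_wscale_small[OF KE _ E00 dd]) (use \<tau> in simp)
    then show ?thesis by (rule lip_bounded_mono[OF _ _ dd]) (use \<tau> \<tau>KE in simp)
  qed
  have "\<forall>k j. lip_bounded dd (e i) (E k j)" for i using lip_bounded_mono[OF Ebl em(2) dd] by blast
  from inv[OF this] obtain U where U: "\<And>i. good i E (U i)" by metis
  have Ui: "U i i = (\<lambda>_. 1)" for i using U[of i] by (simp add: good_def)
  have Ua: "norm (U i k x) \<le> a0" if "k \<noteq> i" for i k x using U[of i] that by (simp add: good_def)
  have Ul: "norm (U i k x - U i k y) \<le> dd x y" for i k x y using U[of i] by (simp add: good_def)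
  have Ue: "lam k x *\<^sub>R U i k x + (\<Sum>j\<in>UNIV. E k j x * U i j x)
          = (of_real (lam i x) + (\<Sum>j\<in>UNIV. E i j x * U i j x)) * U i k (A x)" for i k x
    using U[of i] unfolding good_def by blast
  have Ubl: "lip_bounded dd 1 (U i k)" for i k
    unfolding lip_bounded_def using Ul[of i k] Ua[of k i] a0 by (cases "k = i") (auto simp: Ui intro: order_trans)
  have E_0: "wev 0 (E k j x) = 0" for k j x
    using \<tau> by (simp add: E_def wev_0_eq_wcoef wcoef_wscale E00)
  have U0: "wcoef 0 (U i k x) = (if k = i then 1 else 0)" for i k x
  proof (cases "k = i")
    case True
    then show ?thesis using wev_1[of 0] unfolding wev_0_eq_wcoef by (simp add: Ui)
  next
    case False
    have "wev 0 (U i k x) = 0"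
    proof (rule dominated_cocycle_bounded_solution_0[where A = A and B = B and p = "lam k" and q = "lam i"])
      show "\<bar>wev 0 (U i k x)\<bar> \<le> a0" for x using abs_wev_le[of 0 "U i k x"] Ua[OF False, of x] by simp
      show "wev 0 (U i k (A (B x))) = wev 0 (U i k x)" for x using lip_bounded_eq[OF Ubl AB] by simp
      show "lam k x * wev 0 (U i k x) = lam i x * wev 0 (U i k (A x))" for x
        using arg_cong[OF Ue[of k x i], of "wev 0"] by (simp add: wev_add wev_mult wev_scaleR wev_sum E_0)
      show "\<theta> < 1" using \<theta> l mult_left_mono[of 1 l \<theta>] by simp
    qed (use lam(3) \<theta> dom[OF False] in auto)
    then show ?thesis using False by (simp add: wev_0_eq_wcoef)
  qed
  define V where "V i m x = (\<Sum>k\<in>UNIV. U i k x * of_real (v k x $ m))" for i m x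
  define L where "L i x = of_real (lam i x) + (\<Sum>j\<in>UNIV. E i j x * U i j x)" for i x
  have Vbl: "\<exists>K. lip_bounded dd K (V i m)" for i m
    unfolding V_def[abs_def] by (intro lip_bounded_Ex_sum dd) (use lip_bounded_mult[OF Ubl lip_bounded_of_real[OF vm]] in blast)
  have Lbl: "\<exists>K. lip_bounded dd K (L i)" for i
  proof -
    have "\<exists>K. lip_bounded dd K (\<lambda>x. \<Sum>j\<in>UNIV. E i j x * U i j x)"
      by (intro lip_bounded_Ex_sum dd) (use lip_bounded_mult[OF Ebl Ubl] in blast)
    then show ?thesis unfolding L_def[abs_def] using lip_bounded_add[OF lip_bounded_of_real[OF lam(1)]] by blast
  qed
  from lip_bounded_Ex_uniform[where f = "\<lambda>p. V (fst p) (snd p)", OF Vbl dd] obtain K1 where K1: "\<And>i m. lip_bounded dd K1 (V i m)" by auto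
  from lip_bounded_Ex_uniform[where f = L, OF Lbl dd] obtain K2 where K2: "\<And>i. lip_bounded dd K2 (L i)" by auto
  have evV: "(\<chi> m. wev u (V i m x)) = (\<Sum>k\<in>UNIV. wev u (U i k x) *\<^sub>R v k x)" if "\<bar>u\<bar> < 1" for u i x
    using that by (simp add: vec_eq_iff V_def wev_sum wev_mult)
  have eq: "frechet_derivative (\<lambda>x. A x + (\<rho> * \<tau> * u) *\<^sub>R F x)
        (at (x + (\<Sum>n. (\<rho> * \<tau> * u) ^ Suc n *\<^sub>R h (Suc n) x))) (\<chi> m. wev u (V i m x))
      = wev u (L i x) *\<^sub>R (\<chi> m. wev u (V i m (A x)))" if u: "\<bar>u\<bar> < 1" for x u i
  proof -
    have \<tau>u: "\<bar>\<tau> * u\<bar> < 1" using u \<tau> mult_left_le_one_le[of "\<bar>u\<bar>" "\<bar>\<tau>\<bar>"] by (simp add: abs_mult)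
    let ?V = "\<chi> m. wev u (V i m x)"
    define y where "y = (\<chi> k. \<Sum>l\<in>UNIV. ?V $ l * wev (\<tau> * u) (G k l x))"
    \<comment> \<open>Frame coordinates of the image vector. \<open>M\<close> is evaluated at \<tau>
      u but \<open>U\<close> and \<open>L\<close> at u, because the invariant line was computed for
      the deviation already rescaled by \<tau>.\<close>
    have yk: "(\<Sum>l\<in>UNIV. C k l (A x) * y $ l) = wev u (L i x) * wev u (U i k (A x))" for k
    proof -
      have "(\<Sum>l\<in>UNIV. C k l (A x) * y $ l)
        = (\<Sum>l\<in>UNIV. \<Sum>m\<in>UNIV. \<Sum>j\<in>UNIV. C k l (A x) * (wev u (U i j x) * v j x $ m * wev (\<tau> * u) (G l m x)))"
        by (simp add: y_def evV[OF u] sum_distrib_left sum_distrib_right)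
      also have "\<dots> = (\<Sum>l\<in>UNIV. \<Sum>j\<in>UNIV. \<Sum>m\<in>UNIV. C k l (A x) * (wev u (U i j x) * v j x $ m * wev (\<tau> * u) (G l m x)))"
        by (intro sum.cong refl sum.swap)
      also have "\<dots> = (\<Sum>j\<in>UNIV. \<Sum>l\<in>UNIV. \<Sum>m\<in>UNIV. C k l (A x) * (wev u (U i j x) * v j x $ m * wev (\<tau> * u) (G l m x)))"
        by (rule sum.swap)
      also have "\<dots> = (\<Sum>j\<in>UNIV. wev (\<tau> * u) (M k j x) * wev u (U i j x))"
        unfolding evM[OF \<tau>u] by (simp add: sum_distrib_left sum_distrib_right mult_ac)
      also have "\<dots> = (\<Sum>j\<in>UNIV. ((if k = j then lam k x else 0) + wev u (E k j x)) * wev u (U i j x))"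
      proof (intro sum.cong refl arg_cong2[of _ _ _ _ "(*)"])
        fix j
        have "M k j x = of_real (if k = j then lam k x else 0) + E0 k j x" by (simp add: E0_def)
        then show "wev (\<tau> * u) (M k j x) = (if k = j then lam k x else 0) + wev u (E k j x)"
          using \<tau>u \<tau> by (simp only: wev_add wev_of_real less_imp_le E_def wev_wscale abs_of_pos)
      qed
      also have "\<dots> = lam k x * wev u (U i k x) + (\<Sum>j\<in>UNIV. wev u (E k j x) * wev u (U i j x))"
        by (simp add: distrib_right sum.distrib if_distribR if_distrib[of "\<lambda>c. c * _"] cong: if_cong)
      also have "\<dots> = wev u (lam k x *\<^sub>R U i k x + (\<Sum>j\<in>UNIV. E k j x * U i j x))"
        using u by (simp add: wev_add wev_scaleR wev_sum wev_mult)
      also have "\<dots> = wev u (L i x) * wev u (U i k (A x))"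
        unfolding Ue L_def[symmetric] using u by (simp add: wev_mult)
      finally show ?thesis .
    qed
    have "frechet_derivative (\<lambda>x. A x + (\<rho> * (\<tau> * u)) *\<^sub>R F x)
        (at (x + (\<Sum>n. (\<rho> * (\<tau> * u)) ^ Suc n *\<^sub>R h (Suc n) x))) ?V = y"
      unfolding DG[OF \<tau>u] y_def ..
    also have "y = (\<Sum>k\<in>UNIV. (\<Sum>l\<in>UNIV. C k l (A x) * y $ l) *\<^sub>R v k (A x))" by (rule exp)
    also have "\<dots> = wev u (L i x) *\<^sub>R (\<Sum>k\<in>UNIV. wev u (U i k (A x)) *\<^sub>R v k (A x))"
      by (simp add: yk scaleR_sum_right)
    finally show ?thesis by (simp add: evV[OF u] mult.assoc)
  qed
  have ind: "a i = 0" if u: "\<bar>u\<bar> < 1" and z: "(\<Sum>i\<in>UNIV. a i *\<^sub>R (\<chi> m. wev u (V i m x))) = 0" for x u a i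
  proof (rule diagonally_dominant_injective[where c = "\<lambda>i k. wev u (U i k x)"])
    show "wev u (U i i x) = 1" for i by (simp add: Ui)
    show "\<bar>wev u (U i k x)\<bar> \<le> 1 / (2 * real CARD('d))" if "i \<noteq> k" for i k
      using abs_wev_le[of u "U i k x"] Ua[of k i x] that u by (simp add: a0_def)
    have "(\<Sum>k\<in>UNIV. (\<Sum>i\<in>UNIV. a i * wev u (U i k x)) *\<^sub>R v k x)
      = (\<Sum>k\<in>UNIV. \<Sum>i\<in>UNIV. a i *\<^sub>R wev u (U i k x) *\<^sub>R v k x)"
      by (simp add: scaleR_sum_left)
    also have "\<dots> = (\<Sum>i\<in>UNIV. \<Sum>k\<in>UNIV. a i *\<^sub>R wev u (U i k x) *\<^sub>R v k x)" by (rule sum.swap)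
    also have "\<dots> = 0" using z by (simp add: evV[OF u] scaleR_sum_right)
    finally show "(\<Sum>i\<in>UNIV. a i * wev u (U i k x)) = 0" for k by (rule v(2))
  qed
  have V0: "wcoef 0 (V i m x) = v i x $ m" for i m x
  proof -
    have "wev 0 (V i m x) = (\<Sum>k\<in>UNIV. wev 0 (U i k x) * v k x $ m)"
      by (simp add: V_def wev_sum wev_mult)
    also have "\<dots> = v i x $ m"
      unfolding wev_0_eq_wcoef U0 by (simp add: if_distribR if_distrib[of "\<lambda>c. c * _"] cong: if_cong)
    finally show ?thesis unfolding wev_0_eq_wcoef .
  qed
  have L0: "wcoef 0 (L i x) = lam i x" for i x
    unfolding wev_0_eq_wcoef[symmetric] by (simp add: L_def wev_add wev_sum wev_mult E_0)
  define K' where "K' = max K1 K2"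
  have "lip_bounded dd K' (V i m)" "lip_bounded dd K' (L i)" for i m
    by (rule lip_bounded_mono[OF K1 _ dd], simp add: K'_def) (rule lip_bounded_mono[OF K2 _ dd], simp add: K'_def)
  moreover have "0 < \<rho> * \<tau>" using \<rho> \<tau> by simp
  ultimately show ?thesis using V0 L0 eq ind
    by (intro exI[of _ "\<rho> * \<tau>"] conjI exI[of _ V] exI[of _ L] exI[of _ K'] allI impI) blast+
qed

section \<open>Translation to the Hoelder norm\<close>

text \<open>A supremum over the empty set is negative infinity in \<open>ereal\<close>; a pair of
  inequivalent points makes \<open>holder_semi\<close> nonnegative.\<close>

lemma exists_not_tor_eq: "\<exists>x y :: real^'d. \<not> tor_eq x y"
proof -
  have False if hyp: "\<forall>i :: 'd. \<exists>k :: int. 1 = 2 * pi * k"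
  proof -
    obtain k :: int where k: "1 = 2 * pi * k" using hyp by blast
    then have "1 \<le> \<bar>k\<bar>" by (cases "k = 0") auto
    then have "1 \<le> \<bar>real_of_int k\<bar>" by linarith
    then have "2 * pi * 1 \<le> 2 * pi * \<bar>real_of_int k\<bar>" by (intro mult_left_mono) auto
    then have "1 < 2 * pi * \<bar>real_of_int k\<bar>" using pi_gt3 by linarith
    also have "\<dots> = \<bar>2 * pi * k\<bar>" by (simp add: abs_mult)
    finally show False using k by simp
  qed
  then have "\<not> tor_eq (\<chi> i. 1) (0 :: real^'d)" by (auto simp: tor_eq_def)
  then show ?thesis by blast
qed

lemma holder_semi_nonneg: "0 \<le> holder_semi \<beta> f"
proof -
  obtain x y :: "real^'a" where "\<not> tor_eq x y" using exists_not_tor_eq by blast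
  then show ?thesis unfolding holder_semi_def by (intro SUP_upper2[of "(x, y)"]) auto
qed

lemma sup_norm_nonneg: "0 \<le> sup_norm f"
  unfolding sup_norm_def by (rule SUP_upper2[of undefined]) auto

lemma norm_le_sup_norm: "ereal (norm (f x)) \<le> sup_norm f"
  unfolding sup_norm_def by (rule SUP_upper) simp

text \<open>The Hoelder quotient leaves out equivalent points; for these, periodicity makes the
  difference 0.\<close>

lemma lip_bounded_of_holder_norm:
  assumes "on_torus f" and le: "holder_norm \<beta> f \<le> ereal K"
  shows "lip_bounded (\<lambda>x y. tdist x y powr \<beta>) K f"
proof -
  have sup: "sup_norm f \<le> ereal K" and semi: "holder_semi \<beta> f \<le> ereal K"
    using le ereal_le_add_self[OF holder_semi_nonneg, of "sup_norm f" \<beta> f]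
      ereal_le_add_self2[OF sup_norm_nonneg, of "holder_semi \<beta> f" f]
    unfolding holder_norm_def by (auto elim: order_trans[rotated])
  have n: "norm (f x) \<le> K" for x
    using order_trans[OF norm_le_sup_norm sup, of x] by simp
  have "norm (f x - f y) \<le> K * tdist x y powr \<beta>" for x y
  proof (cases "tor_eq x y")
    case True
    then show ?thesis using assms(1) order_trans[OF norm_ge_zero n[of x]] by (simp add: on_torus_def)
  next
    case False
    then have t: "0 < tdist x y" using tdist_nonneg[of x y] tdist_eq_0_iff[of x y] by linarith
    have "ereal (norm (f x - f y) / tdist x y powr \<beta>) \<le> holder_semi \<beta> f"
      unfolding holder_semi_def using False by (intro SUP_upper2[of "(x, y)"]) auto
    then have "norm (f x - f y) / tdist x y powr \<beta> \<le> K" using order_trans[OF _ semi] by fastforce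
    then show ?thesis using t by (simp add: field_simps)
  qed
  with n show ?thesis by (simp add: lip_bounded_def)
qed

lemma lip_bounded_of_holder_norm_finite:
  assumes "on_torus f" "holder_norm \<beta> f < \<infinity>"
  shows "\<exists>K. lip_bounded (\<lambda>x y. tdist x y powr \<beta>) K f"
proof -
  have "\<exists>K. holder_norm \<beta> f \<le> ereal K" using assms(2) by (cases "holder_norm \<beta> f") auto
  then show ?thesis using lip_bounded_of_holder_norm[OF assms(1)] by blast
qed

lemma holder_norm_le:
  assumes "lip_bounded (\<lambda>x y. tdist x y powr \<beta>) K f"
  shows "holder_norm \<beta> f \<le> ereal (2 * K)"
proof -
  have "sup_norm f \<le> ereal K" unfolding sup_norm_def by (rule SUP_least) (simp add: lip_boundedD(1)[OF assms])
  moreover have "holder_semi \<beta> f \<le> ereal K"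
    unfolding holder_semi_def
  proof (rule SUP_least, clarify)
    fix x y :: "real^'a" assume "\<not> tor_eq x y"
    then have t: "0 < tdist x y" using tdist_nonneg[of x y] tdist_eq_0_iff[of x y] by linarith
    then show "ereal (norm (f (fst (x, y)) - f (snd (x, y))) / tdist (fst (x, y)) (snd (x, y)) powr \<beta>) \<le> ereal K"
      using lip_boundedD(2)[OF assms, of x y] by (simp add: field_simps)
  qed
  ultimately have "holder_norm \<beta> f \<le> ereal K + ereal K" unfolding holder_norm_def by (rule add_mono)
  then show ?thesis by simp
qed

lemma lip_bounded_on_torus: "lip_bounded (\<lambda>x y. tdist x y powr \<beta>) K f \<Longrightarrow> on_torus f"
  unfolding on_torus_def using lip_bounded_powr_cong by blast

lemma lip_bounded_vec:
  fixes f :: "'m::finite \<Rightarrow> 'x \<Rightarrow> real"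
  assumes "\<And>m. lip_bounded dd K (f m)"
  shows "lip_bounded dd (real CARD('m) * K) (\<lambda>x. \<chi> m. f m x)"
proof -
  have le: "norm (z :: real^'m) \<le> real CARD('m) * e" if "\<And>m. \<bar>z $ m\<bar> \<le> e" for z e
    using norm_le_l1_cart[of z] sum_bounded_above[of UNIV "\<lambda>m. \<bar>z $ m\<bar>" e] that by simp
  show ?thesis
    unfolding lip_bounded_def
    by (auto intro!: le simp: mult.assoc) (use lip_boundedD[OF assms] in \<open>simp_all add: real_norm_def[symmetric] del: real_norm_def\<close>)
qed

text \<open>Being nonnegative and less than 1, the product of the extended reals is a real number,
  and it serves as Q for all pairs of points at once.\<close>

lemma sup_norm_product_less_1:
  fixes f g :: "real^'d \<Rightarrow> real"
  assumes "sup_norm f * sup_norm (\<lambda>x. inverse (g x)) < 1" and g: "\<And>x. g x \<noteq> 0"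
  shows "\<exists>Q<1. \<forall>x y. \<bar>f x\<bar> \<le> Q * \<bar>g y\<bar>"
proof -
  let ?p = "sup_norm f * sup_norm (\<lambda>x. inverse (g x))"
  have "0 \<le> ?p" by (intro ereal_0_le_mult sup_norm_nonneg)
  then obtain Q where Q: "?p = ereal Q" "Q < 1" using assms(1) by (cases ?p) auto
  have "\<bar>f x\<bar> \<le> Q * \<bar>g y\<bar>" for x y
  proof -
    have "ereal \<bar>f x\<bar> * ereal \<bar>inverse (g y)\<bar> \<le> ?p"
      using norm_le_sup_norm[of f x] norm_le_sup_norm[of "\<lambda>x. inverse (g x)" y]
      by (intro ereal_mult_mono sup_norm_nonneg) auto
    then have "\<bar>f x\<bar> * \<bar>inverse (g y)\<bar> \<le> Q" by (simp add: Q(1))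
    then show ?thesis using g[of y] by (simp add: field_simps)
  qed
  with Q show ?thesis by blast
qed

theorem theorem2p2:
  fixes A0 F :: "real^'d \<Rightarrow> real^'d"
    and H :: "real \<Rightarrow> real^'d \<Rightarrow> real^'d"
    and h :: "nat \<Rightarrow> real^'d \<Rightarrow> real^'d"
    and v :: "nat \<Rightarrow> real^'d \<Rightarrow> real^'d"
    and \<Lambda> :: "nat \<Rightarrow> real^'d \<Rightarrow> real"
    and \<epsilon>0 \<beta>0 :: real
  assumes A0_analytic: "real_analytic A0"
    and A0_anosov: "anosov A0"
    and F_torus: "on_torus F"
    and F_analytic: "real_analytic F"
    and \<epsilon>0_pos: "\<epsilon>0 > 0"
    and H_homeo: "\<forall>\<epsilon>. \<bar>\<epsilon>\<bar> < \<epsilon>0 \<longrightarrow> torus_homeo (H \<epsilon>)"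
    and H_conj: "\<forall>\<epsilon> \<psi>. \<bar>\<epsilon>\<bar> < \<epsilon>0 \<longrightarrow>
                   tor_eq (H \<epsilon> (A0 \<psi>)) (A0 (H \<epsilon> \<psi>) + \<epsilon> *\<^sub>R F (H \<epsilon> \<psi>))"
    and H_series: "\<forall>\<epsilon> \<psi>. \<bar>\<epsilon>\<bar> < \<epsilon>0 \<longrightarrow>
                   H \<epsilon> \<psi> = \<psi> + (\<Sum>n. \<epsilon> ^ Suc n *\<^sub>R h (Suc n) \<psi>)"
    and h_torus: "\<forall>n. on_torus (h n)"
    and h_bound: "\<exists>\<beta>1>0. \<forall>\<beta>. 0 < \<beta> \<and> \<beta> < \<beta>1 \<longrightarrow>
                   (\<exists>C. \<forall>n\<ge>1. holder_norm \<beta> (h n) \<le> ereal (C ^ n))"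
    and \<beta>0_pos: "\<beta>0 > 0"
    and v_torus: "\<forall>i\<in>{1..CARD('d)}. on_torus (v i)"
    and v_unit: "\<forall>i\<in>{1..CARD('d)}. \<forall>\<psi>. norm (v i \<psi>) = 1"
    and v_basis: "\<forall>\<psi>. (\<forall>c. (\<Sum>i=1..CARD('d). c i *\<^sub>R v i \<psi>) = 0 \<longrightarrow> (\<forall>i\<in>{1..CARD('d)}. c i = 0))
                     \<and> (\<forall>w. \<exists>c. w = (\<Sum>i=1..CARD('d). c i *\<^sub>R v i \<psi>))"
    and v_holder: "\<forall>i\<in>{1..CARD('d)}. holder_norm \<beta>0 (v i) < \<infinity>"
    and \<Lambda>_torus: "\<forall>i\<in>{1..CARD('d)}. on_torus (\<Lambda> i)"
    and \<Lambda>_holder: "\<forall>i\<in>{1..CARD('d)}. holder_norm \<beta>0 (\<Lambda> i) < \<infinity>"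
    and \<Lambda>_nz: "\<forall>i\<in>{1..CARD('d)}. \<forall>\<psi>. \<Lambda> i \<psi> \<noteq> 0"
    and covariance: "\<forall>i\<in>{1..CARD('d)}. \<forall>\<psi>.
                   frechet_derivative A0 (at \<psi>) (v i \<psi>) = \<Lambda> i \<psi> *\<^sub>R v i (A0 \<psi>)"
    and domination: "\<exists>N0. \<forall>n\<ge>N0. \<forall>i\<in>{1..CARD('d) - 1}.
                   sup_norm (\<lambda>\<psi>. \<Prod>j<n. \<Lambda> i ((A0 ^^ j) \<psi>))
                 * sup_norm (\<lambda>\<psi>. inverse (\<Prod>j<n. \<Lambda> (Suc i) ((A0 ^^ j) \<psi>))) < 1"
  shows "\<exists>\<beta>b>0. \<forall>\<beta>. 0 < \<beta> \<and> \<beta> < \<beta>b \<longrightarrow>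
           (\<exists>\<epsilon>b>0. \<exists>V :: real \<Rightarrow> nat \<Rightarrow> real^'d \<Rightarrow> real^'d. \<exists>L :: real \<Rightarrow> nat \<Rightarrow> real^'d \<Rightarrow> real.
              \<exists>w :: nat \<Rightarrow> nat \<Rightarrow> real^'d \<Rightarrow> real^'d. \<exists>lc :: nat \<Rightarrow> nat \<Rightarrow> real^'d \<Rightarrow> real. \<exists>M K.
              \<epsilon>b * K < 1
            \<and> (\<forall>i\<in>{1..CARD('d)}. \<forall>n. on_torus (w i n) \<and> on_torus (lc i n)
                 \<and> holder_norm \<beta> (w i n) \<le> ereal (M * K ^ n)
                 \<and> holder_norm \<beta> (lc i n) \<le> ereal (M * K ^ n))
            \<and> (\<forall>\<epsilon>. \<bar>\<epsilon>\<bar> < \<epsilon>b \<longrightarrow>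
                 (\<forall>i\<in>{1..CARD('d)}. \<forall>\<psi>.
                     V \<epsilon> i \<psi> = (\<Sum>n. \<epsilon> ^ n *\<^sub>R w i n \<psi>)
                   \<and> L \<epsilon> i \<psi> = (\<Sum>n. \<epsilon> ^ n * lc i n \<psi>))
               \<and> (\<forall>i\<in>{1..CARD('d)}. on_torus (V \<epsilon> i) \<and> on_torus (L \<epsilon> i)
                   \<and> holder_norm \<beta> (V \<epsilon> i) < \<infinity> \<and> holder_norm \<beta> (L \<epsilon> i) < \<infinity>)
               \<and> (\<forall>\<psi>. \<forall>c. (\<Sum>i=1..CARD('d). c i *\<^sub>R V \<epsilon> i \<psi>) = 0
                        \<longrightarrow> (\<forall>i\<in>{1..CARD('d)}. c i = 0))
               \<and> (\<forall>i\<in>{1..CARD('d)}. \<forall>\<psi>.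
                   frechet_derivative (\<lambda>x. A0 x + \<epsilon> *\<^sub>R F x) (at (H \<epsilon> \<psi>)) (V \<epsilon> i \<psi>)
                     = L \<epsilon> i \<psi> *\<^sub>R V \<epsilon> i (A0 \<psi>)))
            \<and> (\<forall>i\<in>{1..CARD('d)}. V 0 i = v i \<and> L 0 i = \<Lambda> i))"
proof -
  have Adiff: "A0 differentiable (at x)" and Fdiff: "F differentiable (at x)" for x
    using A0_analytic F_analytic real_analytic_at_differentiable by (auto simp: real_analytic_def)
  have bijA: "torus_bij A0" and injD: "inj (frechet_derivative A0 (at x))" for x
    using A0_anosov by (auto simp: anosov_def bij_def)
  then have tmA: "torus_map A0" by (simp add: torus_bij_def)
  note perA = torus_map_frechet_periodic[OF tmA Adiff]
  note perF = on_torus_frechet_periodic[OF F_torus Fdiff]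
  obtain l where l: "1 \<le> l" and lA: "\<And>x y. tdist (A0 x) (A0 y) \<le> l * tdist x y"
    and lB: "\<And>x y. tdist x y \<le> l * tdist (A0 x) (A0 y)"
    using torus_diffeo_bilipschitz[OF A0_analytic bijA injD] by blast
  \<comment> \<open>An inverse of A_0 modulo periods, chosen pointwise on R^d without any continuity
    there; only its behaviour for the torus distance enters.\<close>
  define B where "B x = (SOME y. tor_eq (A0 y) x)" for x
  have AB: "tor_eq (A0 (B x)) x" for x
    unfolding B_def by (rule someI_ex) (use bijA in \<open>auto simp: torus_bij_def\<close>)
  have BA: "tor_eq (B (A0 x)) x" for x
    using bijA AB[of "A0 x"] by (auto simp: torus_bij_def)
  have lB': "tdist (B x) (B y) \<le> l * tdist x y" for x y
    using lB[of "B x" "B y"] tdist_cong[OF AB AB, of x y] by simp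
  have lpow: "s powr \<beta> \<le> l powr \<beta> * t powr \<beta>" if "0 \<le> s" "0 \<le> t" "s \<le> l * t" "0 < \<beta>" for s t \<beta>
    using that l by (simp add: powr_mult[symmetric] powr_mono2)
  let ?I = "{1..CARD('d)}"
  \<comment> \<open>The lemmas above index a frame by the type \<open>'d\<close>, the hypotheses by
    the numbers from 1 to d; \<open>b\<close> and its inverse \<open>g\<close> translate between
    them.\<close>
  obtain b :: "nat \<Rightarrow> 'd" where b: "bij_betw b ?I UNIV" using ex_bij_betw_nat_finite_1[of "UNIV :: 'd set"] by auto
  define g where "g = the_inv_into ?I b"
  have inj: "inj_on b ?I" and img: "b ` ?I = UNIV" using b by (auto simp: bij_betw_def)
  have g: "g k \<in> ?I" "b (g k) = k" for k
    unfolding g_def using the_inv_into_into[OF inj _ order_refl, of k] f_the_inv_into_f[OF inj, of k]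
    by (simp_all only: img UNIV_I)
  have gb: "g (b i) = i" if "i \<in> ?I" for i
    using b that by (auto simp: g_def bij_betw_def the_inv_into_f_f)
  have reindex: "(\<Sum>i=1..CARD('d). f i (b i)) = (\<Sum>k\<in>UNIV. f (g k) k)" for f :: "nat \<Rightarrow> 'd \<Rightarrow> real^'d"
  proof -
    have "(\<Sum>i=1..CARD('d). f (g (b i)) (b i)) = (\<Sum>k\<in>UNIV. f (g k) k)"
      by (rule sum.reindex_bij_betw[OF b])
    then show ?thesis by (simp add: gb)
  qed

  have "\<exists>K. lip_bounded (\<lambda>x y. tdist x y powr \<beta>0) K (\<Lambda> i)" if "i \<in> ?I" for i
    using that \<Lambda>_torus \<Lambda>_holder by (intro lip_bounded_of_holder_norm_finite) auto
  then obtain K\<Lambda> where K\<Lambda>: "\<And>i. i \<in> ?I \<Longrightarrow> lip_bounded (\<lambda>x y. tdist x y powr \<beta>0) (K\<Lambda> i) (\<Lambda> i)" by metis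
  obtain N0 where N0: "\<And>n i. n \<ge> N0 \<Longrightarrow> i \<in> {1..CARD('d) - 1} \<Longrightarrow>
    sup_norm (\<lambda>\<psi>. \<Prod>j<n. \<Lambda> i ((A0 ^^ j) \<psi>)) * sup_norm (\<lambda>\<psi>. inverse (\<Prod>j<n. \<Lambda> (Suc i) ((A0 ^^ j) \<psi>))) < 1"
    using domination by blast
  \<comment> \<open>The successor makes N positive, since \<open>adapted_rescaling\<close> divides
    by it.\<close>
  define N where "N = Suc N0"
  have "\<exists>Q<1. \<forall>x y. \<bar>\<Prod>j<N. \<Lambda> i ((A0 ^^ j) x)\<bar> \<le> Q * \<bar>\<Prod>j<N. \<Lambda> (Suc i) ((A0 ^^ j) y)\<bar>"
    if "i \<in> {1..CARD('d) - 1}" for i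
    using that \<Lambda>_nz by (intro sup_norm_product_less_1 N0) (auto simp: N_def)
  then obtain Qi where Qi: "\<And>i. i \<in> {1..CARD('d) - 1} \<Longrightarrow> Qi i < 1"
    "\<And>i x y. i \<in> {1..CARD('d) - 1} \<Longrightarrow> \<bar>\<Prod>j<N. \<Lambda> i ((A0 ^^ j) x)\<bar> \<le> Qi i * \<bar>\<Prod>j<N. \<Lambda> (Suc i) ((A0 ^^ j) y)\<bar>"
    by metis
  \<comment> \<open>The entry 1 / 2 makes Q positive and covers dimension 1, where no pair has to be
    compared.\<close>
  define Q where "Q = Max (insert (1 / 2) (Qi ` {1..CARD('d) - 1}))"
  have Q: "0 < Q" "Q < 1" "\<And>i. i \<in> {1..CARD('d) - 1} \<Longrightarrow> Qi i \<le> Q"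
  proof -
    have "1 / 2 \<le> Q" unfolding Q_def by (rule Max_ge) auto
    then show "0 < Q" by simp
    show "Q < 1" unfolding Q_def by (subst Max_less_iff) (use Qi(1) in auto)
    show "Qi i \<le> Q" if "i \<in> {1..CARD('d) - 1}" for i unfolding Q_def using that by (intro Max_ge) auto
  qed
  have "\<exists>\<theta> q. 0 < \<theta> \<and> \<theta> < 1 \<and>
    (\<forall>i\<in>?I. (\<exists>K. lip_bounded (\<lambda>x y. tdist x y powr \<beta>0) K (q i)) \<and> (\<exists>K. lip_bounded (\<lambda>x y. tdist x y powr \<beta>0) K (\<lambda>x. inverse (q i x))) \<and> (\<forall>x. 0 < q i x)) \<and>
    (\<forall>i\<in>?I. \<forall>k\<in>?I. i < k \<longrightarrow>
      (\<forall>x. \<bar>q i x * \<Lambda> i x / q i (A0 x)\<bar> \<le> \<theta> * \<bar>q k x * \<Lambda> k x / q k (A0 x)\<bar>))"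
  proof (rule adapted_rescaling[where l = "l powr \<beta>0" and K = K\<Lambda> and N = N and Q = Q])
    show "tdist (A0 x) (A0 y) powr \<beta>0 \<le> l powr \<beta>0 * tdist x y powr \<beta>0" for x y
      using lA \<beta>0_pos by (intro lpow) auto
    show "1 \<le> l powr \<beta>0" using l \<beta>0_pos by (simp add: ge_one_powr_ge_zero)
    show "\<bar>\<Prod>j<N. \<Lambda> i ((A0 ^^ j) x)\<bar> \<le> Q * \<bar>\<Prod>j<N. \<Lambda> (Suc i) ((A0 ^^ j) y)\<bar>"
      if "1 \<le> i" "Suc i \<le> CARD('d)" for i x y
    proof -
      have i: "i \<in> {1..CARD('d) - 1}" using that by auto
      show ?thesis by (rule order_trans[OF Qi(2)[OF i] mult_right_mono[OF Q(3)[OF i]]]) simp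
    qed
  qed (use \<beta>0_pos K\<Lambda> \<Lambda>_nz Q in \<open>auto simp: N_def\<close>)
  then obtain \<theta> q0 where \<theta>: "0 < \<theta>" "\<theta> < 1"
    and q0: "\<And>i. i \<in> ?I \<Longrightarrow> \<exists>K. lip_bounded (\<lambda>x y. tdist x y powr \<beta>0) K (q0 i)"
      "\<And>i. i \<in> ?I \<Longrightarrow> \<exists>K. lip_bounded (\<lambda>x y. tdist x y powr \<beta>0) K (\<lambda>x. inverse (q0 i x))" "\<And>i x. i \<in> ?I \<Longrightarrow> 0 < q0 i x"
    and q0dom: "\<And>i k x. i \<in> ?I \<Longrightarrow> k \<in> ?I \<Longrightarrow> i < k \<Longrightarrow>
      \<bar>q0 i x * \<Lambda> i x / q0 i (A0 x)\<bar> \<le> \<theta> * \<bar>q0 k x * \<Lambda> k x / q0 k (A0 x)\<bar>"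
    by blast
  define q where "q k = q0 (g k)" for k :: 'd
  have q: "0 < q k x" for k x using q0(3) g by (simp add: q_def)
  \<comment> \<open>The rescaling keeps the lines and multiplies each multiplier by the coboundary q
    / (q \<circ> A0).\<close>
  define v' where "v' k x = q k x *\<^sub>R v (g k) x" for k x
  define lam where "lam k x = q k x * \<Lambda> (g k) x / q k (A0 x)" for k x
  define G0 where "G0 = (\<lambda>x y :: real^'d. tdist x y powr \<beta>0)"
  have G0: "0 \<le> G0 x y" for x y by (simp add: G0_def)
  have GA: "G0 (A0 x) (A0 y) \<le> l powr \<beta>0 * G0 x y" for x y
    unfolding G0_def using lA \<beta>0_pos by (intro lpow) auto
  have l1: "1 \<le> l powr \<beta>0" using l \<beta>0_pos by (simp add: ge_one_powr_ge_zero)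
  have qbl: "\<exists>K. lip_bounded G0 K (q k)" "\<exists>K. lip_bounded G0 K (\<lambda>x. inverse (q k x))" for k
    using q0(1,2)[OF g(1)[of k]] by (simp_all add: q_def[abs_def] G0_def)
  have qAbl: "\<exists>K. lip_bounded G0 K (\<lambda>x. q k (A0 x))" "\<exists>K. lip_bounded G0 K (\<lambda>x. inverse (q k (A0 x)))" for k
  proof -
    obtain K1 K2 where K: "lip_bounded G0 K1 (q k)" "lip_bounded G0 K2 (\<lambda>x. inverse (q k x))" using qbl by meson
    show "\<exists>K. lip_bounded G0 K (\<lambda>x. q k (A0 x))" using lip_bounded_compose[where \<tau> = A0, OF K(1) GA l1] by blast
    show "\<exists>K. lip_bounded G0 K (\<lambda>x. inverse (q k (A0 x)))" using lip_bounded_compose[where \<tau> = A0, OF K(2) GA l1] by blast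
  qed
  have \<Lambda>bl: "\<exists>K. lip_bounded G0 K (\<Lambda> (g k))" "\<exists>K. lip_bounded G0 K (\<lambda>x. inverse (\<Lambda> (g k) x))" for k
  proof -
    show "\<exists>K. lip_bounded G0 K (\<Lambda> (g k))" using K\<Lambda>[OF g(1)] unfolding G0_def by blast
    obtain m where m: "0 < m" "\<And>x. m \<le> \<bar>\<Lambda> (g k) x\<bar>"
      using lip_bounded_powr_bounded_below[OF K\<Lambda>[OF g(1)] \<beta>0_pos] \<Lambda>_nz g(1) by metis
    show "\<exists>K. lip_bounded G0 K (\<lambda>x. inverse (\<Lambda> (g k) x))"
      using lip_bounded_inverse[OF K\<Lambda>[OF g(1)] m] unfolding G0_def by auto
  qed
  have lambl: "\<exists>K. lip_bounded G0 K (lam k)" "\<exists>K. lip_bounded G0 K (\<lambda>x. inverse (lam k x))" for k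
  proof -
    have "\<exists>K. lip_bounded G0 K (\<lambda>x. q k x * \<Lambda> (g k) x * inverse (q k (A0 x)))"
      by (intro lip_bounded_Ex_mult qbl qAbl \<Lambda>bl)
    then show "\<exists>K. lip_bounded G0 K (lam k)" by (simp add: lam_def[abs_def] divide_inverse)
    have "\<exists>K. lip_bounded G0 K (\<lambda>x. inverse (q k x) * inverse (\<Lambda> (g k) x) * q k (A0 x))"
      by (intro lip_bounded_Ex_mult qbl qAbl \<Lambda>bl)
    then show "\<exists>K. lip_bounded G0 K (\<lambda>x. inverse (lam k x))" by (simp add: lam_def[abs_def] divide_inverse mult_ac)
  qed
  have vbl: "\<exists>K. lip_bounded G0 K (v' k)" for k
  proof -
    obtain K1 where "lip_bounded G0 K1 (q k)" using qbl by blast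
    moreover obtain K2 where "lip_bounded G0 K2 (v (g k))"
      using lip_bounded_of_holder_norm_finite[of "v (g k)" \<beta>0] v_torus v_holder g(1) unfolding G0_def by blast
    ultimately show ?thesis unfolding v'_def[abs_def] using lip_bounded_scaleR by blast
  qed
  obtain Kv where Kv: "\<And>k. lip_bounded G0 Kv (v' k)" using lip_bounded_Ex_uniform[where f = v', OF vbl G0] by blast
  obtain R1 where R1: "\<And>k. lip_bounded G0 R1 (lam k)" using lip_bounded_Ex_uniform[where f = lam, OF lambl(1) G0] by blast
  obtain R2 where R2: "\<And>k. lip_bounded G0 R2 (\<lambda>x. inverse (lam k x))" using lip_bounded_Ex_uniform[where f = "\<lambda>k x. inverse (lam k x)", OF lambl(2) G0] by blast
  obtain Kq where Kq: "\<And>k. lip_bounded G0 Kq (\<lambda>x. inverse (q k x))" using lip_bounded_Ex_uniform[where f = "\<lambda>k x. inverse (q k x)", OF qbl(2) G0] by blast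
  have "\<exists>K. lip_bounded G0 K (\<lambda>x. q k (A0 x) * inverse (q k x))" for k by (intro lip_bounded_Ex_mult qbl qAbl)
  from lip_bounded_Ex_uniform[where f = "\<lambda>k x. q k (A0 x) * inverse (q k x)", OF this G0] obtain Kr where Kr: "\<And>k. lip_bounded G0 Kr (\<lambda>x. q k (A0 x) * inverse (q k x))" by blast
  have lamnz: "lam k x \<noteq> 0" for k x using q[of k] \<Lambda>_nz g(1)[of k] by (simp add: lam_def less_imp_neq[symmetric])
  have lamdom: "(\<forall>x. \<bar>lam k x\<bar> \<le> \<theta> * \<bar>lam i x\<bar>) \<or> (\<forall>x. \<bar>lam i x\<bar> \<le> \<theta> * \<bar>lam k x\<bar>)" if "k \<noteq> i" for i k
  proof -
    have "g k \<noteq> g i" using that g(2) by metis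
    then consider "g k < g i" | "g i < g k" by linarith
    then show ?thesis
      by cases (use q0dom[OF g(1) g(1), of k i] q0dom[OF g(1) g(1), of i k] in \<open>auto simp: lam_def q_def\<close>)
  qed
  have cov: "frechet_derivative A0 (at x) (v' k x) = lam k x *\<^sub>R v' k (A0 x)" for k x
    using covariance g(1)[of k] q[of k "A0 x"]
    by (simp add: v'_def lam_def linear_scale[OF linear_frechet_derivative[OF Adiff]])
  have ind: "c k = 0" if "(\<Sum>k\<in>UNIV. c k *\<^sub>R v' k x) = 0" for c x k
  proof -
    have "(\<Sum>i=1..CARD('d). (c (b i) * q (b i) x) *\<^sub>R v i x) = (\<Sum>k\<in>UNIV. (c k * q k x) *\<^sub>R v (g k) x)"
      by (rule reindex[of "\<lambda>i k. (c k * q k x) *\<^sub>R v i x"])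
    also have "\<dots> = 0" using that by (simp add: v'_def)
    finally have "\<forall>i\<in>?I. c (b i) * q (b i) x = 0"
      by (rule v_basis[THEN spec, THEN conjunct1, THEN spec, THEN mp])
    then have "c (b (g k)) * q (b (g k)) x = 0" using g(1) by blast
    then show ?thesis using q[of k x] by (simp add: g)
  qed
  have span: "\<exists>c. w = (\<Sum>k\<in>UNIV. c k *\<^sub>R v' k x)" for x w
  proof -
    obtain c where "w = (\<Sum>i=1..CARD('d). c i *\<^sub>R v i x)" using v_basis by blast
    also have "\<dots> = (\<Sum>k\<in>UNIV. c (g k) *\<^sub>R v (g k) x)" by (rule reindex[of "\<lambda>i k. c i *\<^sub>R v i x"])
    also have "\<dots> = (\<Sum>k\<in>UNIV. (c (g k) / q k x) *\<^sub>R v' k x)"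
      using q by (intro sum.cong refl) (simp add: v'_def less_imp_neq[symmetric])
    finally show ?thesis by (intro exI)
  qed
  obtain \<beta>1 where \<beta>1: "0 < \<beta>1" and hC: "\<And>\<beta>. 0 < \<beta> \<Longrightarrow> \<beta> < \<beta>1 \<Longrightarrow> \<exists>C. \<forall>n\<ge>1. holder_norm \<beta> (h n) \<le> ereal (C ^ n)"
    using h_bound by blast
  \<comment> \<open>The last entry yields \<beta> ln l < ln (1 / \<theta>), that is \<theta>
    l^\<beta> < 1; adding 1 to ln l covers l = 1. The other entries keep \<beta> within the
    exponents of the data and below 1.\<close>
  define \<beta>b where "\<beta>b = min (min \<beta>0 \<beta>1) (min 1 (ln (1 / \<theta>) / (ln l + 1)))"
  have lnl: "0 \<le> ln l" using l by simp
  have \<beta>b: "0 < \<beta>b" using \<beta>0_pos \<beta>1 \<theta> lnl by (simp add: \<beta>b_def)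
  show ?thesis
  proof (rule exI[of _ \<beta>b], intro conjI[OF \<beta>b] allI impI, goal_cases)
    case (1 \<beta>)
    then have \<beta>: "0 < \<beta>" "\<beta> < \<beta>b" by auto
    then have \<beta>le: "\<beta> \<le> \<beta>0" "\<beta> < \<beta>1" "\<beta> \<le> 1" by (auto simp: \<beta>b_def)
    have \<theta>l: "\<theta> * l powr \<beta> < 1"
    proof -
      have "\<beta> * ln l \<le> \<beta> * (ln l + 1)" using \<beta> by simp
      also have "\<dots> < ln (1 / \<theta>)"
        using \<beta> lnl by (subst pos_less_divide_eq[symmetric]) (auto simp: \<beta>b_def)
      finally have "exp (\<beta> * ln l) < exp (ln (1 / \<theta>))" by simp
      then have "l powr \<beta> < 1 / \<theta>" using l \<theta> by (simp add: powr_def)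
      then show ?thesis using \<theta> by (simp add: field_simps)
    qed
    have l\<beta>: "1 \<le> l powr \<beta>" using l \<beta> by (simp add: ge_one_powr_ge_zero)
    obtain C where C: "\<And>n. 1 \<le> n \<Longrightarrow> holder_norm \<beta> (h n) \<le> ereal (C ^ n)" using hC[OF \<beta>(1) \<beta>le(2)] by blast
    define dd where "dd = (\<lambda>x y :: real^'d. tdist x y powr \<beta>)"
    have dd0: "0 \<le> dd x y" for x y by (simp add: dd_def)
    have down: "lip_bounded dd (2 * K) f" if "lip_bounded G0 K f" for K and f :: "real^'d \<Rightarrow> 'b::real_normed_vector"
      using lip_bounded_powr_mono[OF that[unfolded G0_def] \<beta>(1) \<beta>le(1)] by (simp add: dd_def)
    \<comment> \<open>C may be negative; the powers of its absolute value still majorise the given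
      bounds.\<close>
    have hbl: "lip_bounded dd (\<bar>C\<bar> ^ n) (h n)" if "1 \<le> n" for n
    proof -
      have "holder_norm \<beta> (h n) \<le> ereal (\<bar>C\<bar> ^ n)"
        using order_trans[OF C[OF that]] abs_ge_self[of "C ^ n"] by (simp add: power_abs)
      then show ?thesis unfolding dd_def using h_torus by (intro lip_bounded_of_holder_norm) auto
    qed
    have "\<exists>\<rho>>0. \<exists>V L K'. (\<forall>i m. lip_bounded dd K' (V i m)) \<and> (\<forall>i. lip_bounded dd K' (L i)) \<and>
      (\<forall>i m x. wcoef 0 (V i m x) = v' i x $ m) \<and> (\<forall>i x. wcoef 0 (L i x) = lam i x) \<and>
      (\<forall>x u i. \<bar>u\<bar> < 1 \<longrightarrow> frechet_derivative (\<lambda>x. A0 x + (\<rho> * u) *\<^sub>R F x)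
          (at (x + (\<Sum>n. (\<rho> * u) ^ Suc n *\<^sub>R h (Suc n) x))) (\<chi> m. wev u (V i m x))
        = wev u (L i x) *\<^sub>R (\<chi> m. wev u (V i m (A0 x)))) \<and>
      (\<forall>x u a i. \<bar>u\<bar> < 1 \<longrightarrow> (\<Sum>i\<in>UNIV. a i *\<^sub>R (\<chi> m. wev u (V i m x))) = 0 \<longrightarrow> a i = 0)"
      unfolding dd_def
    proof (rule perturbed_frame[where B = B and l = "l powr \<beta>" and \<theta> = \<theta> and K = "2 * Kv" and R = "2 * max R1 R2"])
      show "tdist (A0 x) (A0 y) powr \<beta> \<le> l powr \<beta> * tdist x y powr \<beta>"
        "tdist (B x) (B y) powr \<beta> \<le> l powr \<beta> * tdist x y powr \<beta>" for x y
        using lA lB' \<beta> by (auto intro!: lpow)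
      show "tdist (A0 (B x)) x powr \<beta> = 0" "tdist (B (A0 x)) x powr \<beta> = 0" for x
        using AB BA by (simp_all add: tdist_eq_0_iff)
      show "lip_bounded (\<lambda>x y. tdist x y powr \<beta>) (\<bar>C\<bar> ^ n) (h n)" if "1 \<le> n" for n using hbl[OF that] by (simp add: dd_def)
      show "lip_bounded (\<lambda>x y. tdist x y powr \<beta>) (2 * Kv) (v' k)" for k using down[OF Kv] by (simp add: dd_def)
      show "lip_bounded (\<lambda>x y. tdist x y powr \<beta>) (2 * max R1 R2) (lam k)"
        "lip_bounded (\<lambda>x y. tdist x y powr \<beta>) (2 * max R1 R2) (\<lambda>x. inverse (lam k x))" for k
        using lip_bounded_mono[OF down[OF R1] _ dd0, of "2 * max R1 R2"] lip_bounded_mono[OF down[OF R2] _ dd0, of "2 * max R1 R2"]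
        by (simp_all add: dd_def)
      show "c k = 0" if "(\<Sum>k\<in>UNIV. c k *\<^sub>R v' k x) = 0" for x c k using ind[OF that] .
      show "\<exists>c. w = (\<Sum>k\<in>UNIV. c k *\<^sub>R v' k x)" for x w by (rule span)
      show "(\<forall>x. \<bar>lam k x\<bar> \<le> \<theta> * \<bar>lam i x\<bar>) \<or> (\<forall>x. \<bar>lam i x\<bar> \<le> \<theta> * \<bar>lam k x\<bar>)" if "k \<noteq> i" for i k
        by (rule lamdom[OF that])
    qed (fact A0_analytic perA F_analytic perF \<beta>(1) \<beta>le(3) abs_ge_zero l\<beta> lamnz cov less_imp_le[OF \<theta>(1)] \<theta>l)+
    then obtain \<rho> V L K' where \<rho>: "0 < \<rho>" and V': "\<forall>i m. lip_bounded dd K' (V i m)" and L': "\<forall>i. lip_bounded dd K' (L i)"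
      and V0': "\<forall>i m x. wcoef 0 (V i m x) = v' i x $ m" and L0': "\<forall>i x. wcoef 0 (L i x) = lam i x"
      and eq': "\<forall>x u i. \<bar>u\<bar> < 1 \<longrightarrow> frechet_derivative (\<lambda>x. A0 x + (\<rho> * u) *\<^sub>R F x)
          (at (x + (\<Sum>n. (\<rho> * u) ^ Suc n *\<^sub>R h (Suc n) x))) (\<chi> m. wev u (V i m x))
        = wev u (L i x) *\<^sub>R (\<chi> m. wev u (V i m (A0 x)))"
      and indep': "\<forall>x u a i. \<bar>u\<bar> < 1 \<longrightarrow> (\<Sum>i\<in>UNIV. a i *\<^sub>R (\<chi> m. wev u (V i m x))) = 0 \<longrightarrow> a i = 0"
      by (elim exE conjE)
    note V = V'[rule_format] and L = L'[rule_format] and V0 = V0'[rule_format] and L0 = L0'[rule_format]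
      and eq = eq'[rule_format] and indep = indep'[rule_format]
    have K': "0 \<le> K'" using L by (rule lip_bounded_nonneg)
    have Kq0: "0 \<le> Kq" using Kq by (rule lip_bounded_nonneg)
    have Kr0: "0 \<le> Kr" using Kr by (rule lip_bounded_nonneg)
    \<comment> \<open>Division by \<open>q\<close> returns to the original frame, and (1 / \<rho>)^n
      undoes \<epsilon> = \<rho> u. Correspondingly, the coefficients \<open>lc\<close> of the
      multiplier carry the inverse coboundary.\<close>
    define w where "w k n x = inverse (q k x) *\<^sub>R (\<chi> m. (1 / \<rho>) ^ n * wcoef n (V k m x))" for k n x
    define lc where "lc k n x = (q k (A0 x) * inverse (q k x)) * ((1 / \<rho>) ^ n * wcoef n (L k x))" for k n x
    have cbl: "lip_bounded dd ((1 / \<rho>) ^ n * K') (\<lambda>x. (1 / \<rho>) ^ n * wcoef n (f x))" if "lip_bounded dd K' f" for n f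
      by (rule lip_bounded_bounded_linear[OF that, where h = "\<lambda>a. (1 / \<rho>) ^ n * wcoef n a"])
        (use \<rho> abs_wcoef_le bounded_linear_compose[OF bounded_linear_mult_right bounded_linear_wcoef]
          in \<open>auto simp: abs_mult divide_right_mono\<close>)
    define D where "D = real CARD('d)"
    have D: "0 \<le> D" by (simp add: D_def)
    have wbl: "lip_bounded dd (2 * (2 * Kq) * (D * ((1 / \<rho>) ^ n * K'))) (w k n)" for k n
      unfolding w_def[abs_def] D_def by (intro lip_bounded_scaleR lip_bounded_vec cbl V down Kq)
    have lcbl: "lip_bounded dd (2 * (2 * Kr) * ((1 / \<rho>) ^ n * K')) (lc k n)" for k n
      unfolding lc_def[abs_def] by (intro lip_bounded_mult cbl L down Kr)
    \<comment> \<open>The 8 is a factor 2 for the two parts of the Hoelder norm, a 2 for the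
      product, and a 2 for lowering the exponent from \<beta>0 to \<beta>.\<close>
    define MM where "MM = 8 * Kq * D * K' + 8 * Kr * K'"
    have pn: "0 \<le> (1 / \<rho>) ^ n" for n using \<rho> by simp
    have holder: "holder_norm \<beta> (w k n) \<le> ereal (MM * (1 / \<rho>) ^ n)" "holder_norm \<beta> (lc k n) \<le> ereal (MM * (1 / \<rho>) ^ n)" for k n
    proof -
      have "holder_norm \<beta> (w k n) \<le> ereal (2 * (2 * (2 * Kq) * (D * ((1 / \<rho>) ^ n * K'))))"
        by (rule holder_norm_le[OF wbl[unfolded dd_def]])
      also have "\<dots> = ereal ((8 * Kq * D * K') * (1 / \<rho>) ^ n)" by (simp add: mult_ac)
      also have "\<dots> \<le> ereal (MM * (1 / \<rho>) ^ n)"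
        unfolding ereal_less_eq using pn K' Kr0 by (intro mult_right_mono) (auto simp: MM_def)
      finally show "holder_norm \<beta> (w k n) \<le> ereal (MM * (1 / \<rho>) ^ n)" .
      have "holder_norm \<beta> (lc k n) \<le> ereal (2 * (2 * (2 * Kr) * ((1 / \<rho>) ^ n * K')))"
        by (rule holder_norm_le[OF lcbl[unfolded dd_def]])
      also have "\<dots> = ereal ((8 * Kr * K') * (1 / \<rho>) ^ n)" by (simp add: mult_ac)
      also have "\<dots> \<le> ereal (MM * (1 / \<rho>) ^ n)"
        unfolding ereal_less_eq using pn K' Kq0 D by (intro mult_right_mono) (auto simp: MM_def)
      finally show "holder_norm \<beta> (lc k n) \<le> ereal (MM * (1 / \<rho>) ^ n)" .
    qed
    define VV where "VV \<epsilon> k x = (\<Sum>n. \<epsilon> ^ n *\<^sub>R w k n x)" for \<epsilon> k x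
    define LL where "LL \<epsilon> k x = (\<Sum>n. \<epsilon> ^ n * lc k n x)" for \<epsilon> k x
    have sumwev: "(\<lambda>n. \<epsilon> ^ n * ((1 / \<rho>) ^ n * wcoef n a)) sums wev (\<epsilon> / \<rho>) a" if "\<bar>\<epsilon> / \<rho>\<bar> < 1" for \<epsilon> a
    proof -
      have "(\<lambda>n. wcoef n a * (\<epsilon> / \<rho>) ^ n) sums wev (\<epsilon> / \<rho>) a"
        unfolding wev_suminf using that by (intro summable_sums summable_rabs_cancel[OF summable_wev]) simp
      then show ?thesis by (simp add: power_divide mult_ac)
    qed
    have VV: "VV \<epsilon> k x = inverse (q k x) *\<^sub>R (\<chi> m. wev (\<epsilon> / \<rho>) (V k m x))" if "\<bar>\<epsilon> / \<rho>\<bar> < 1" for \<epsilon> k x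
    proof -
      have "(\<lambda>n. \<epsilon> ^ n *\<^sub>R w k n x) sums (inverse (q k x) *\<^sub>R (\<chi> m. wev (\<epsilon> / \<rho>) (V k m x)))"
      proof (rule vec_sums)
        show "(\<lambda>n. (\<epsilon> ^ n *\<^sub>R w k n x) $ m) sums ((inverse (q k x) *\<^sub>R (\<chi> m. wev (\<epsilon> / \<rho>) (V k m x))) $ m)" for m
          using sums_mult[OF sumwev[OF that, of "V k m x"], of "inverse (q k x)"] by (simp add: w_def mult_ac)
      qed
      then show ?thesis by (simp add: VV_def sums_iff)
    qed
    have LL: "LL \<epsilon> k x = (q k (A0 x) * inverse (q k x)) * wev (\<epsilon> / \<rho>) (L k x)" if "\<bar>\<epsilon> / \<rho>\<bar> < 1" for \<epsilon> k x
      using sums_mult[OF sumwev[OF that, of "L k x"], of "q k (A0 x) * inverse (q k x)"]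
      by (simp add: LL_def lc_def sums_iff mult_ac)
    have evbl: "lip_bounded dd (1 * K') (\<lambda>x. wev u (f x))" if "\<bar>u\<bar> < 1" "lip_bounded dd K' f" for u f
      by (rule lip_bounded_bounded_linear[OF that(2) bounded_linear_wev]) (use that abs_wev_le in auto)
    have VVbl: "\<exists>K. lip_bounded dd K (VV \<epsilon> k)" if "\<bar>\<epsilon> / \<rho>\<bar> < 1" for \<epsilon> k
      unfolding VV[OF that, abs_def] by (rule exI) (rule lip_bounded_scaleR[OF down[OF Kq] lip_bounded_vec[OF evbl[OF that V]]])
    have LLbl: "\<exists>K. lip_bounded dd K (LL \<epsilon> k)" if "\<bar>\<epsilon> / \<rho>\<bar> < 1" for \<epsilon> k
      unfolding LL[OF that, abs_def] by (rule exI) (rule lip_bounded_mult[OF down[OF Kr] evbl[OF that L]])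
    have fin: "holder_norm \<beta> f < \<infinity>" if "lip_bounded dd K f" for K and f :: "real^'d \<Rightarrow> 'b::real_normed_vector"
      using holder_norm_le[OF that[unfolded dd_def]] by (rule order_le_less_trans) simp
    \<comment> \<open>Half of the minimum stays strictly below \<rho>: then \<epsilon> / \<rho> lies
      in the open interval of evaluation, and \<epsilon>b / \<rho> < 1 is the required convergence
      condition.\<close>
    define \<epsilon>b where "\<epsilon>b = min \<epsilon>0 \<rho> / 2"
    have \<epsilon>b: "0 < \<epsilon>b" "\<epsilon>b < \<epsilon>0" "\<epsilon>b < \<rho>" using \<epsilon>0_pos \<rho> by (auto simp: \<epsilon>b_def min_def)
    have small: "\<bar>\<epsilon> / \<rho>\<bar> < 1" if "\<bar>\<epsilon>\<bar> < \<epsilon>b" for \<epsilon> using that \<epsilon>b \<rho> by (simp add: field_simps)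
    have AFdiff: "(\<lambda>x. A0 x + \<epsilon> *\<^sub>R F x) differentiable (at x)" for \<epsilon> x
      using Adiff Fdiff by (intro differentiable_add differentiable_scaleR differentiable_const)
    have feq: "frechet_derivative (\<lambda>x. A0 x + \<epsilon> *\<^sub>R F x) (at (H \<epsilon> x)) (VV \<epsilon> k x) = LL \<epsilon> k x *\<^sub>R VV \<epsilon> k (A0 x)"
      if "\<bar>\<epsilon>\<bar> < \<epsilon>b" for \<epsilon> x k
    proof -
      note u = small[OF that]
      have "\<bar>\<epsilon>\<bar> < \<epsilon>0" using that \<epsilon>b by simp
      then have H: "H \<epsilon> x = x + (\<Sum>n. \<epsilon> ^ Suc n *\<^sub>R h (Suc n) x)" using H_series by blast
      have e: "\<rho> * (\<epsilon> / \<rho>) = \<epsilon>" using \<rho> by simp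
      have "frechet_derivative (\<lambda>x. A0 x + \<epsilon> *\<^sub>R F x) (at (H \<epsilon> x)) (VV \<epsilon> k x)
        = inverse (q k x) *\<^sub>R (wev (\<epsilon> / \<rho>) (L k x) *\<^sub>R (\<chi> m. wev (\<epsilon> / \<rho>) (V k m (A0 x))))"
        unfolding VV[OF u] linear_scale[OF linear_frechet_derivative[OF AFdiff]] H
        using eq[OF u, unfolded e] by simp
      also have "\<dots> = LL \<epsilon> k x *\<^sub>R VV \<epsilon> k (A0 x)"
        unfolding VV[OF u] LL[OF u] using q[of k "A0 x"] by (simp add: mult_ac)
      finally show ?thesis .
    qed
    have find: "c i = 0" if e: "\<bar>\<epsilon>\<bar> < \<epsilon>b" and z: "(\<Sum>i=1..CARD('d). c i *\<^sub>R VV \<epsilon> (b i) x) = 0" and i: "i \<in> ?I" for \<epsilon> x c i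
    proof -
      have "(\<Sum>k\<in>UNIV. (c (g k) * inverse (q k x)) *\<^sub>R (\<chi> m. wev (\<epsilon> / \<rho>) (V k m x)))
        = (\<Sum>k\<in>UNIV. c (g k) *\<^sub>R VV \<epsilon> k x)" by (simp add: VV[OF small[OF e]])
      also have "\<dots> = 0" using reindex[of "\<lambda>i k. c i *\<^sub>R VV \<epsilon> k x"] z by simp
      finally have "c (g (b i)) * inverse (q (b i) x) = 0" by (rule indep[OF small[OF e]])
      then show ?thesis using q[of "b i" x] gb[OF i] by simp
    qed
    have V_0: "VV 0 (b i) = v i" and L_0: "LL 0 (b i) = \<Lambda> i" if i: "i \<in> ?I" for i
    proof -
      have z: "\<bar>0 / \<rho>\<bar> < 1" by simp
      have "VV 0 (b i) x = v i x" for x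
        using q[of "b i" x] gb[OF i] unfolding VV[OF z] by (simp add: wev_0_eq_wcoef V0 v'_def vec_eq_iff)
      then show "VV 0 (b i) = v i" by blast
      have "LL 0 (b i) x = \<Lambda> i x" for x
        using q[of "b i" x] q[of "b i" "A0 x"] gb[OF i] unfolding LL[OF z] by (simp add: wev_0_eq_wcoef L0 lam_def)
      then show "LL 0 (b i) = \<Lambda> i" by blast
    qed
    show ?case
    proof (rule exI[of _ \<epsilon>b], intro conjI[OF \<epsilon>b(1)], rule exI[of _ "\<lambda>\<epsilon> i. VV \<epsilon> (b i)"],
        rule exI[of _ "\<lambda>\<epsilon> i. LL \<epsilon> (b i)"], rule exI[of _ "\<lambda>i. w (b i)"], rule exI[of _ "\<lambda>i. lc (b i)"],
        rule exI[of _ MM], rule exI[of _ "1 / \<rho>"], intro conjI allI impI ballI)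
      show "\<epsilon>b * (1 / \<rho>) < 1" using \<epsilon>b by simp
      show "on_torus (w (b i) n)" "on_torus (lc (b i) n)" for i n
        using lip_bounded_on_torus[OF wbl[unfolded dd_def]] lip_bounded_on_torus[OF lcbl[unfolded dd_def]] by blast+
      show "holder_norm \<beta> (w (b i) n) \<le> ereal (MM * (1 / \<rho>) ^ n)"
        "holder_norm \<beta> (lc (b i) n) \<le> ereal (MM * (1 / \<rho>) ^ n)" for i n by (rule holder)+
      show "VV \<epsilon> (b i) x = (\<Sum>n. \<epsilon> ^ n *\<^sub>R w (b i) n x)"
        "LL \<epsilon> (b i) x = (\<Sum>n. \<epsilon> ^ n * lc (b i) n x)" for \<epsilon> i x by (simp_all add: VV_def LL_def)
      show "on_torus (VV \<epsilon> (b i))" "on_torus (LL \<epsilon> (b i))"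
        "holder_norm \<beta> (VV \<epsilon> (b i)) < \<infinity>" "holder_norm \<beta> (LL \<epsilon> (b i)) < \<infinity>" if "\<bar>\<epsilon>\<bar> < \<epsilon>b" for \<epsilon> i
        using VVbl[OF small[OF that], of "b i"] LLbl[OF small[OF that], of "b i"] fin lip_bounded_on_torus
        unfolding dd_def by blast+
      show "c i = 0" if "\<bar>\<epsilon>\<bar> < \<epsilon>b" "(\<Sum>i=1..CARD('d). c i *\<^sub>R VV \<epsilon> (b i) x) = 0" "i \<in> ?I" for \<epsilon> x c i
        by (rule find[OF that])
      show "frechet_derivative (\<lambda>x. A0 x + \<epsilon> *\<^sub>R F x) (at (H \<epsilon> x)) (VV \<epsilon> (b i) x)
          = LL \<epsilon> (b i) x *\<^sub>R VV \<epsilon> (b i) (A0 x)" if "\<bar>\<epsilon>\<bar> < \<epsilon>b" for \<epsilon> i x by (rule feq[OF that])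
      show "VV 0 (b i) = v i" "LL 0 (b i) = \<Lambda> i" if "i \<in> ?I" for i using V_0[OF that] L_0[OF that] .
    qed
  qed
qed

end
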